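(* Let $\{\Theta(k)\}_{k=0}^{\infty}$ be a bounded sequence of arbitrary real or complex numbers, and let $\upsilon,b,c,\lambda\in\mathbb{C}$ and $y\in\mathbb{R}$ satisfy $\Re(\upsilon)>0$, $\Re(c)>0$, $y>0$, and either $\Re(\lambda)>0,\ \Re(b)>0$ or $\Re(\lambda)<0,\ \Re(b)<0$. Define \[ I_{C}^{*}(\upsilon,b,c,\lambda,y)=\sum_{k=0}^{\infty}\frac{\Theta(k)}{k!}\int_{0}^{\infty}x^{\upsilon-1}e^{-(\lambda b+ck)\sqrt{x}}\cos(xy)\,dx . \] Then, writing $w_k=\lambda b+ck$ and $z_k=\dfrac{64y^{2}}{w_k^{4}}$, each of the following five equalities holds: \[ I_{C}^{*}(\upsilon,b,c,\lambda,y)=\frac{2^{4\upsilon-\frac{3}{2}}}{\pi}\sum_{k=0}^{\infty}\frac{\Theta(k)}{k!\,w_k^{2\upsilon}}\,G^{1,4}_{4,2}\!\left(z_k\,\middle|\,\begin{matrix}\frac{4-2\upsilon}{4},\frac{3-2\upsilon}{4},\frac{2-2\upsilon}{4},\frac{1-2\upsilon}{4};-\\ 0;\ \frac12\end{matrix}\right), \] \[ I_{C}^{*}(\upsilon,b,c,\lambda,y)=\frac{\sqrt{y}\,2^{4\upsilon}}{\pi}\sum_{k=0}^{\infty}\frac{\Theta(k)}{k!\,w_k^{2\upsilon+1}}\,G^{1,4}_{4,2}\!\left(z_k\,\middle|\,\begin{matrix}\frac{3-2\upsilon}{4},\frac{2-2\upsilon}{4},\frac{1-2\upsilon}{4},\frac{-2\upsilon}{4};-\\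 -\frac14;\ \frac14\end{matrix}\right), \] \[ I_{C}^{*}(\upsilon,b,c,\lambda,y)=\frac{2^{4\upsilon-\frac{9}{2}}}{\pi y}\sum_{k=0}^{\infty}\frac{\Theta(k)}{k!\,w_k^{2\upsilon-2}}\,G^{1,4}_{4,2}\!\left(z_k\,\middle|\,\begin{matrix}\frac{6-2\upsilon}{4},\frac{5-2\upsilon}{4},\frac{4-2\upsilon}{4},\frac{3-2\upsilon}{4};-\\ \frac12;\ 1\end{matrix}\right), \] \[ I_{C}^{*}(\upsilon,b,c,\lambda,y)=\frac{y\,2^{4\upsilon+\frac{3}{2}}}{\pi}\sum_{k=0}^{\infty}\frac{\Theta(k)}{k!\,w_k^{2\upsilon+2}}\,G^{1,4}_{4,2}\!\left(z_k\,\middle|\,\begin{matrix}\frac{2-2\upsilon}{4},\frac{1-2\upsilon}{4},\frac{-2\upsilon}{4},\frac{-1-2\upsilon}{4};-\\ -\frac12;\ 0\end{matrix}\right), \] \[ I_{C}^{*}(\upsilon,b,c,\lambda,y)=\frac{2^{6\upsilon-\frac{7}{2}}}{\pi^{3}}\sum_{k=0}^{\infty}\frac{\Theta(k)}{k!\,w_k^{2\upsilon}}\,G^{2,8}_{8,4}\!\left(\frac{4^{8}y^{4}}{w_k^{8}}\,\middle|\,\begin{matrix}\frac{8-2\upsilon}{8},\frac{7-2\upsilon}{8},\frac{6-2\upsilon}{8},\frac{5-2\upsilon}{8},\frac{4-2\upsilon}{8},\frac{3-2\upsilon}{8},\frac{2-2\upsilon}{8},\frac{1-2\upsilon}{8};-\\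 0,\frac12;\ \frac14,\frac34\end{matrix}\right). \]
   Context: Meijer's $G$-function is defined by the Mellin–Barnes integral \[ G^{m,n}_{p,q}\!\left(z\,\middle|\,\begin{matrix}\alpha_1,\dots,\alpha_n;\alpha_{n+1},\dots,\alpha_p\\ \beta_1,\dots,\beta_m;\beta_{m+1},\dots,\beta_q\end{matrix}\right)=\frac{1}{2\pi i}\int_{L}\frac{\prod_{j=1}^{m}\Gamma(\beta_j-\zeta)\prod_{j=1}^{n}\Gamma(1-\alpha_j+\zeta)}{\prod_{j=m+1}^{q}\Gamma(1-\beta_j+\zeta)\prod_{j=n+1}^{p}\Gamma(\alpha_j-\zeta)}\,z^{\zeta}\,d\zeta, \] where $L$ is an upward-oriented contour from $-i\infty$ to $+i\infty$ separating the poles of the $\Gamma(\beta_j-\zeta)$ ($j\le m$) from those of the $\Gamma(1-\alpha_j+\zeta)$ ($j\le n$), and $z\neq0$. In the parameter display, the upper row lists $\alpha_1,\dots,\alpha_n$ then (after the semicolon) $\alpha_{n+1},\dots,\alpha_p$, with "$-$" meaning that this second group is empty; the lower row lists $\beta_1,\dots,\beta_m$ then $\beta_{m+1},\dots,\beta_q$.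
   Formalization: The integrals defining I_C^* are assumed absolutely convergent (i.e. Re(λb)>0; λ=b=1+2i shows divergence otherwise), and in G the power z_k^ζ uses arg z_k = −4 arg w_k (−8 arg w_k in the fifth formula), not necessarily the principal argument. *)

theory Defs
  imports "HOL-Analysis.Analysis"
begin

text \<open>
  A contour is a curve \<open>\<gamma>\<close> parametrised by the whole real line. A point lies to the right
  (left) of it if it lies in the component of the complement of \<open>\<gamma>\<close> that contains a right
  (left) half plane.
\<close>

definition right_of_contour :: "(real \<Rightarrow> complex) \<Rightarrow> complex \<Rightarrow> bool" where
  "right_of_contour \<gamma> p \<longleftrightarrow> (\<exists>R. \<forall>q. Re q \<ge> R \<longrightarrow> connected_component (- range \<gamma>) p q)"

definition left_of_contour :: "(real \<Rightarrow> complex) \<Rightarrow> complex \<Rightarrow> bool" where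
  "left_of_contour \<gamma> p \<longleftrightarrow> (\<exists>R. \<forall>q. Re q \<le> R \<longrightarrow> connected_component (- range \<gamma>) p q)"

text \<open>
  Upward contours from \<open>-\<i>\<infinity>\<close> to \<open>\<i>\<infinity>\<close> with the poles \<open>\<beta> + j\<close> of \<open>Gamma (\<beta> - \<zeta>)\<close> on the right
  and the poles \<open>\<alpha> - 1 - j\<close> of \<open>Gamma (1 - \<alpha> + \<zeta>)\<close> on the left.
\<close>

definition mellin_barnes_contour ::
  "complex list \<Rightarrow> complex list \<Rightarrow> (real \<Rightarrow> complex) \<Rightarrow> bool" where
  "mellin_barnes_contour as bs \<gamma> \<longleftrightarrow>
     \<gamma> piecewise_C1_differentiable_on UNIV \<and> inj \<gamma> \<and>
     filterlim (\<lambda>t. Im (\<gamma> t)) at_bot at_bot \<and>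
     filterlim (\<lambda>t. Im (\<gamma> t)) at_top at_top \<and>
     bounded (range (\<lambda>t. Re (\<gamma> t))) \<and>
     (\<forall>\<beta>\<in>set bs. \<forall>j::nat. right_of_contour \<gamma> (\<beta> + of_nat j)) \<and>
     (\<forall>\<alpha>\<in>set as. \<forall>j::nat. left_of_contour \<gamma> (\<alpha> - 1 - of_nat j))"

text \<open>
  The upper parameters are \<open>as; as'\<close> and the lower parameters \<open>bs; bs'\<close>, so \<open>n = length as\<close>,
  \<open>p = n + length as'\<close>, \<open>m = length bs\<close>, \<open>q = m + length bs'\<close>.

  The G-function is a function on the Riemann surface of the logarithm: \<open>z\<^sup>\<zeta>\<close> means
  \<open>exp (\<zeta> (ln \<bar>z\<bar> + \<i> arg z))\<close> where \<open>arg z\<close> need not be the principal argument. The last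
  argument \<open>l\<close> is the chosen logarithm of \<open>z\<close>.

  At a pole of a Gamma function in the denominator the convention \<open>Gamma = 0\<close>, \<open>x / 0 = 0\<close>
  gives the correct value 0 of the quotient.
\<close>

definition meijerG_integrand ::
  "complex list \<Rightarrow> complex list \<Rightarrow> complex list \<Rightarrow> complex list \<Rightarrow> complex \<Rightarrow> complex \<Rightarrow> complex" where
  "meijerG_integrand as as' bs bs' l \<zeta> =
     ((\<Prod>\<beta>\<leftarrow>bs. Gamma (\<beta> - \<zeta>)) * (\<Prod>\<alpha>\<leftarrow>as. Gamma (1 - \<alpha> + \<zeta>))) /
     ((\<Prod>\<beta>\<leftarrow>bs'. Gamma (1 - \<beta> + \<zeta>)) * (\<Prod>\<alpha>\<leftarrow>as'. Gamma (\<alpha> - \<zeta>))) * exp (\<zeta> * l)"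

text \<open>
  The gauge integral over \<open>UNIV\<close> is the improper contour integral (limits at both ends taken
  independently), in analogy with \<open>has_contour_integral\<close>. Its value does not depend on the
  contour; \<open>THE\<close> picks the common value.
\<close>

definition meijerG_log ::
  "complex list \<Rightarrow> complex list \<Rightarrow> complex list \<Rightarrow> complex list \<Rightarrow> complex \<Rightarrow> complex" where
  "meijerG_log as as' bs bs' l =
     1 / (2 * of_real pi * \<i>) *
     (THE v. \<exists>\<gamma>. mellin_barnes_contour as bs \<gamma> \<and>
        ((\<lambda>t. meijerG_integrand as as' bs bs' l (\<gamma> t) * vector_derivative \<gamma> (at t))
           has_integral v) UNIV)"

definition wC :: "complex \<Rightarrow> complex \<Rightarrow> complex \<Rightarrow> nat \<Rightarrow> complex" where
  "wC lam b c k = lam * b + c * of_nat k"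

definition IC_integrand :: "complex \<Rightarrow> complex \<Rightarrow> real \<Rightarrow> real \<Rightarrow> complex" where
  "IC_integrand \<upsilon> w y x =
     of_real x powr (\<upsilon> - 1) * exp (- w * of_real (sqrt x)) * of_real (cos (x * y))"

definition IC_term ::
  "(nat \<Rightarrow> complex) \<Rightarrow> complex \<Rightarrow> complex \<Rightarrow> complex \<Rightarrow> complex \<Rightarrow> real \<Rightarrow> nat \<Rightarrow> complex" where
  "IC_term \<Theta> \<upsilon> b c lam y k =
     \<Theta> k / fact k * (LBINT x:{0<..}. IC_integrand \<upsilon> (wC lam b c k) y x)"

definition IC_star ::
  "(nat \<Rightarrow> complex) \<Rightarrow> complex \<Rightarrow> complex \<Rightarrow> complex \<Rightarrow> complex \<Rightarrow> real \<Rightarrow> complex" where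
  "IC_star \<Theta> \<upsilon> b c lam y = (\<Sum>k. IC_term \<Theta> \<upsilon> b c lam y k)"

text \<open>
  The logarithm of \<open>r / w\<^sup>n\<close> (\<open>r > 0\<close>) obtained by continuation in \<open>w\<close> from the positive real
  axis. For \<open>n = 4\<close> and \<open>Re w > 0\<close> its imaginary part ranges over \<open>(-2\<pi>, 2\<pi>)\<close>, which is the
  domain of convergence of the Mellin--Barnes integral with \<open>m = 1\<close>, \<open>n = p = 4\<close>, \<open>q = 2\<close>;
  the principal logarithm would jump at \<open>\<bar>Arg w\<bar> = \<pi>/4\<close>.
\<close>

definition log_quot_power :: "real \<Rightarrow> complex \<Rightarrow> nat \<Rightarrow> complex" where
  "log_quot_power r w n = of_real (ln r) - of_nat n * Ln w"

lemma exp_log_quot_power: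
  assumes "r > 0" "w \<noteq> 0"
  shows "exp (log_quot_power r w n) = of_real r / w ^ n"
  using assms by (simp add: log_quot_power_def exp_diff exp_of_nat_mult exp_of_real)

lemma log_quot_power_principal:
  assumes "r > 0" "w \<noteq> 0" "of_nat n * \<bar>Arg w\<bar> < pi"
  shows "log_quot_power r w n = Ln (of_real r / w ^ n)"
proof -
  have "Im (log_quot_power r w n) = - (of_nat n * Arg w)"
    using assms by (simp add: log_quot_power_def Arg_eq_Im_Ln)
  moreover have "\<bar>of_nat n * Arg w\<bar> < pi"
    using assms by (simp add: abs_mult)
  ultimately have "Ln (exp (log_quot_power r w n)) = log_quot_power r w n"
    by (intro Ln_exp) auto
  then show ?thesis
    using exp_log_quot_power[OF assms(1,2)] by simp
qed

end

theory Submission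
  imports Defs "HOL-Complex_Analysis.Complex_Analysis"
begin

text \<open>
  After the substitution \<open>x = s\<^sup>2\<close> and insertion of the Cahen-Mellin integral for \<open>exp (- p s\<^sup>2)\<close>,
  Fubini and the limits \<open>p \<rightarrow> \<plusminus>\<i> y\<close> express each integral of \<open>IC_star\<close> as the integral over a vertical line of
  \<open>\<Gamma>(-2\<zeta>) y\<^bsup>2\<zeta>\<^esup> cos(\<pi>\<zeta>) \<Gamma>(2\<upsilon>+4\<zeta>) w\<^bsup>-2\<upsilon>-4\<zeta>\<^esup>\<close>. By the reflection and duplication formulas this kernel is
  a multiple of the integrand of the first G-function. The next three G-functions arise by translating
  \<open>\<zeta>\<close>, the last one by replacing \<open>\<zeta>\<close> with \<open>2\<zeta>\<close>.

  An arbitrary admissible contour is compared with a vertical line by closing long pieces of the two with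
  horizontal segments: this loop has winding number 0 about every pole, because moving the vertical side
  away from a pole does not change the winding number, and the pole can then be connected to the
  exterior of the loop.

  Integrability of the term \<open>k = 0\<close> forces \<open>Re (w 0) > 0\<close>, which the sign conditions alone do not give.
\<close>

subsection \<open>The Laplace transform of a power\<close>

text \<open>The proof is shaped by exponential rates in |Im \<zeta>|. At \<open>p = \<i> y\<close>
  or \<open>p = - \<i> y\<close> the Cahen-Mellin integral alone has no room: Gamma decays at rate
  pi/2 and \<open>exp (z * - Ln p)\<close> may grow at the same rate. So the integral over s is
  evaluated while Re p > 0; the factor
  \<open>Gamma (2 * v - 2 * z) * w powr - (2 * v - 2 * z)\<close> that it produces brings extra
  decay, which survives the limit. In the final kernel Gamma(-2 \<zeta>) merely balances the cosine,
  and Gamma(2 v + 4 \<zeta>), of rate 2 pi, has to beat the power of w, of rate 4 |Arg w|: this is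
  exactly Re w > 0. Since these inequalities are strict, it suffices to know that Gamma decays at
  every rate below pi/2. That follows by rotating the ray in Euler's integral, which is why the
  Laplace transform of a power is needed for complex arguments. The constants 64 and 4^8 are those
  for which the \<zeta>-dependent powers of 2 from the multiplication formulas cancel.\<close>

lemma of_real_powr_eq_exp:
  "x > 0 \<Longrightarrow> complex_of_real x powr z = exp (z * of_real (ln x))"
  by (simp add: powr_def Ln_of_real)

lemma norm_of_real_powr: "x > 0 \<Longrightarrow> norm (complex_of_real x powr z) = x powr Re z"
  by (simp add: norm_powr_real_powr)

lemma borel_measurable_of_real_powr [measurable]:
  "(\<lambda>x. complex_of_real x powr z) \<in> borel_measurable borel"
proof -
  \<comment> \<open>The branch cut of \<open>Ln\<close> is the negative axis, so measurability is
    read off from separate formulas on the two half lines and at 0.\<close>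
  have *: "complex_of_real x powr z =
      (if x = 0 then 0 else if x > 0 then exp (z * of_real (ln x)) else exp (z * (of_real (ln (- x)) + \<i> * pi)))" for x
  proof (cases "x < 0")
    case True
    then show ?thesis using Ln_of_real'[of x] by (simp add: powr_def mult.commute)
  qed (auto simp: powr_def Ln_of_real)
  show ?thesis unfolding * by measurable
qed

lemma set_integrable_powr_exp:
  assumes "x > 0" "a > 0"
  shows "set_integrable lborel {0<..} (\<lambda>s::real. s powr (x - 1) * exp (- a * s))"
proof -
  have "(\<lambda>t. complex_of_real t powr (of_real x - 1) / of_real (exp (a * t))) absolutely_integrable_on {0<..}"
    using assms by (intro absolutely_integrable_Gamma_integral) auto
  then have "integrable lebesgue (\<lambda>t. norm (indicator {0<..} t *\<^sub>R (complex_of_real t powr (of_real x - 1) / of_real (exp (a * t)))))"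
    unfolding set_integrable_def by (rule integrable_norm)
  also have "(\<lambda>t. norm (indicator {0<..} t *\<^sub>R (complex_of_real t powr (of_real x - 1) / of_real (exp (a * t))))) =
      (\<lambda>s::real. indicator {0<..} s *\<^sub>R (s powr (x - 1) * exp (- a * s)))"
    by (rule ext) (simp add: indicator_def norm_divide norm_of_real_powr exp_minus field_simps)
  finally show ?thesis
    unfolding set_integrable_def by (subst (asm) integrable_completion) auto
qed

lemma set_integrable_powr_exp_complex:
  assumes "Re z > 0" "Re u > 0"
  shows "set_integrable lborel {0<..} (\<lambda>s. of_real s powr (z - 1) * exp (- u * of_real s))"
  by (rule set_integrable_bound[OF set_integrable_powr_exp[OF assms]])
    (auto simp: set_borel_measurable_def norm_mult norm_of_real_powr)

text \<open>Euler's integral for Gamma, rescaled by \<open>a\<close>.\<close>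

lemma Laplace_powr_real:
  assumes "Re z > 0" "a > 0"
  shows "(LBINT s:{0<..}. of_real s powr (z - 1) * exp (- of_real a * of_real s)) = Gamma z * of_real a powr - z"
proof -
  have 1: "set_integrable lborel {0<..} (\<lambda>t. of_real t powr (z - 1) * exp (- 1 * complex_of_real t))"
    using assms by (intro set_integrable_powr_exp_complex) auto
  have "((\<lambda>t. of_real t powr (z - 1) / of_real (exp t)) has_integral Gamma z) {0<..}"
    by (rule Gamma_integral_complex'[OF assms(1)])
  moreover have "(\<lambda>t. of_real t powr (z - 1) / of_real (exp t)) = (\<lambda>t. of_real t powr (z - 1) * exp (- 1 * complex_of_real t))"
    by (auto simp: exp_minus field_simps exp_of_real)
  ultimately have G: "(LBINT s:{0<..}. of_real s powr (z - 1) * exp (- 1 * complex_of_real s)) = Gamma z"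
    using has_integral_set_lebesgue set_borel_integral_eq_integral(2)[OF 1] by (auto simp: integral_unique)
  have "(LBINT s:{0<..}. of_real s powr (z - 1) * exp (- 1 * complex_of_real s)) =
      \<bar>a\<bar> *\<^sub>R (LBINT s. indicator {0<..} (0 + a * s) *\<^sub>R (of_real (0 + a * s) powr (z - 1) * exp (- 1 * complex_of_real (0 + a * s))))"
    unfolding set_lebesgue_integral_def
    using assms by (subst lborel_integral_real_affine[of a _ 0]) auto
  also have "(LBINT s. indicator {0<..} (0 + a * s) *\<^sub>R (of_real (0 + a * s) powr (z - 1) * exp (- 1 * complex_of_real (0 + a * s))))
     = (LBINT s. of_real a powr (z - 1) * (indicator {0<..} s *\<^sub>R (of_real s powr (z - 1) * exp (- of_real a * complex_of_real s))))"
    using assms by (intro Bochner_Integration.integral_cong refl)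
      (auto simp: indicator_def zero_less_mult_iff of_real_powr_eq_exp ln_mult exp_add [symmetric] ring_distribs
        simp flip: of_real_mult)
  also have "\<dots> = of_real a powr (z - 1) * (LBINT s:{0<..}. of_real s powr (z - 1) * exp (- of_real a * of_real s))"
    unfolding set_lebesgue_integral_def by (rule integral_mult_right_zero)
  finally have "Gamma z = of_real a * of_real a powr (z - 1) * (LBINT s:{0<..}. of_real s powr (z - 1) * exp (- of_real a * of_real s))"
    using G assms by (simp add: scaleR_conv_of_real mult.assoc)
  also have "of_real a * of_real a powr (z - 1) = complex_of_real a powr z"
    using assms by (simp add: powr_diff)
  finally show ?thesis using assms by (simp add: powr_minus)
qed

text \<open>Expand exp (- u s) around a real centre a as exp (- a s) times the power series of exp
  (d s), where d = a - u. Each term falls under \<open>Laplace_powr_real\<close>, and the resulting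
  values form the binomial series of (1 - d / a) powr - z.\<close>

proposition Laplace_powr:
  assumes z: "Re z > 0" and u: "Re u > 0"
  shows "(LBINT s:{0<..}. of_real s powr (z - 1) * exp (- u * of_real s)) = Gamma z * u powr - z"
proof -
  \<comment> \<open>This centre gives |a - u|^2 = a^2 - |u|^2 < a^2, so the binomial series
    converges at d / a. It is twice the threshold that a has to exceed.\<close>
  define a where "a = (norm u)\<^sup>2 / Re u"
  have u0: "u \<noteq> 0" using u by auto
  have a: "a > 0" using u0 u by (simp add: a_def)
  have "(norm (of_real a - u))\<^sup>2 = a\<^sup>2 - 2 * a * Re u + (norm u)\<^sup>2"
    by (simp only: cmod_power2) (simp add: algebra_simps power2_eq_square)
  also have "\<dots> < a\<^sup>2" using u u0 by (simp add: a_def)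
  finally have less: "norm (of_real a - u) < a" using a by (simp add: power2_less_imp_less)
  define d where "d = of_real a - u"
  define f where "f n s = of_real s powr (z - 1) * exp (- of_real a * of_real s) * ((d * of_real s) ^ n / fact n)"
    for n :: nat and s :: real
  have nz: "z \<notin> \<int>\<^sub>\<le>\<^sub>0" using z by (auto simp: nonpos_Ints_def)
  have f_eq: "f n s = d ^ n / fact n * (of_real s powr (z + of_nat n - 1) * exp (- of_real a * of_real s))" if "s > 0" for n s
    using that by (simp add: f_def of_real_powr_eq_exp ring_distribs exp_add exp_diff exp_of_nat_mult exp_of_real power_mult_distrib mult_ac)
  have int: "set_integrable lborel {0<..} (f n)" for n
  proof -
    have "set_integrable lborel {0<..} (\<lambda>s. d ^ n / fact n * (of_real s powr (z + of_nat n - 1) * exp (- of_real a * of_real s)))"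
      using z a by (intro set_integrable_mult_right set_integrable_powr_exp_complex) auto
    also have "?this \<longleftrightarrow> ?thesis" by (intro set_integrable_cong refl) (simp add: f_eq)
    finally show ?thesis .
  qed
  define c where "c = Gamma z * of_real a powr - z"
  have val: "(LBINT s:{0<..}. f n s) = c * ((- z gchoose n) * (- d / of_real a) ^ n)" for n
  proof -
    have "(LBINT s:{0<..}. f n s) = (LBINT s:{0<..}. d ^ n / fact n * (of_real s powr (z + of_nat n - 1) * exp (- of_real a * of_real s)))"
      by (intro set_lebesgue_integral_cong) (auto simp: f_eq)
    also have "\<dots> = d ^ n / fact n * (Gamma (z + of_nat n) * of_real a powr - (z + of_nat n))"
      using z a by (subst set_integral_mult_right, subst Laplace_powr_real) auto
    also have "Gamma (z + of_nat n) = Gamma z * pochhammer z n"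
      using nz by (simp add: pochhammer_Gamma Gamma_eq_zero_iff)
    also have "complex_of_real a powr - (z + of_nat n) = of_real a powr - z / of_real a ^ n"
      using a by (simp add: of_real_powr_eq_exp left_diff_distrib exp_diff exp_of_nat_mult exp_of_real)
    also have "d ^ n / fact n * (Gamma z * pochhammer z n * (of_real a powr - z / of_real a ^ n))
        = c * (pochhammer z n / fact n * (d / of_real a) ^ n)"
      by (simp add: c_def power_divide)
    also have "pochhammer z n / fact n * (d / of_real a) ^ n = ((- z gchoose n) * (- d / of_real a) ^ n)"
    proof -
      have "(- d / of_real a) ^ n = (-1) ^ n * (d / of_real a) ^ n"
        by (subst power_mult_distrib [symmetric]) simp
      moreover have "(-1) ^ n * ((-1) ^ n * w) = w" for w :: complex
        by (metis left_minus_one_mult_self)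
      ultimately show ?thesis by (simp add: gbinomial_pochhammer mult.assoc mult.left_commute[of "(-1) ^ n"])
    qed
    finally show ?thesis .
  qed
  \<comment> \<open>The partial sums of exp (d s) are bounded by exp (|d| s), and |d| < a leaves the
    integrable factor exp (- (a - |d|) s).\<close>
  have "(\<lambda>N. LBINT s. (\<Sum>n<N. indicator {0<..} s *\<^sub>R f n s)) \<longlonglongrightarrow> (LBINT s. indicator {0<..} s *\<^sub>R (of_real s powr (z - 1) * exp (- u * of_real s)))"
  proof (rule integral_dominated_convergence)
    have "a - norm d > 0" using less by (simp add: d_def)
    then show "integrable lborel (\<lambda>s. indicator {0<..} s *\<^sub>R (s powr (Re z - 1) * exp (- (a - norm d) * s)))"
      using set_integrable_powr_exp[OF z] unfolding set_integrable_def by blast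
    show "(\<lambda>s. \<Sum>n<N. indicator {0<..} s *\<^sub>R f n s) \<in> borel_measurable lborel" for N
      using int unfolding set_integrable_def by (intro borel_measurable_sum borel_measurable_integrable) blast
    show "AE s in lborel. (\<lambda>N. \<Sum>n<N. indicator {0<..} s *\<^sub>R f n s) \<longlonglongrightarrow> indicator {0<..} s *\<^sub>R (of_real s powr (z - 1) * exp (- u * of_real s))"
    proof (intro AE_I2)
      fix s :: real
      have "(\<lambda>n. of_real s powr (z - 1) * exp (- of_real a * of_real s) * ((d * of_real s) ^ n / fact n)) sums
         (of_real s powr (z - 1) * exp (- of_real a * of_real s) * exp (d * of_real s))"
        using exp_converges[of "d * of_real s"] by (intro sums_mult) (simp add: scaleR_conv_of_real field_simps)
      moreover have "exp (- of_real a * of_real s) * exp (d * of_real s) = exp (- u * of_real s)"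
        by (simp add: d_def algebra_simps flip: exp_add)
      ultimately have "(\<lambda>n. f n s) sums (of_real s powr (z - 1) * exp (- u * of_real s))"
        by (simp add: f_def mult.assoc)
      then show "(\<lambda>N. \<Sum>n<N. indicator {0<..} s *\<^sub>R f n s) \<longlonglongrightarrow> indicator {0<..} s *\<^sub>R (of_real s powr (z - 1) * exp (- u * of_real s))"
        unfolding sums_def [symmetric] by (intro sums_scaleR_right)
    qed
    show "AE s in lborel. norm (\<Sum>n<N. indicator {0<..} s *\<^sub>R f n s) \<le> indicator {0<..} s *\<^sub>R (s powr (Re z - 1) * exp (- (a - norm d) * s))" for N
    proof (intro AE_I2)
      fix s :: real
      show "norm (\<Sum>n<N. indicator {0<..} s *\<^sub>R f n s) \<le> indicator {0<..} s *\<^sub>R (s powr (Re z - 1) * exp (- (a - norm d) * s))"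
      proof (cases "s > 0")
        case True
        have "norm (\<Sum>n<N. f n s) \<le> (\<Sum>n<N. s powr (Re z - 1) * exp (- a * s) * ((norm d * s) ^ n / fact n))"
          using True by (intro sum_norm_le)
            (simp add: f_def norm_mult norm_divide norm_power norm_of_real_powr)
        also have "\<dots> = s powr (Re z - 1) * exp (- a * s) * (\<Sum>n<N. (norm d * s) ^ n / fact n)"
          by (simp add: sum_distrib_left)
        also have "(\<Sum>n<N. (norm d * s) ^ n / fact n) \<le> exp (norm d * s)"
        proof -
          have "(\<lambda>n. (norm d * s) ^ n / fact n) sums exp (norm d * s)"
            using exp_converges[of "norm d * s"] by (simp add: field_simps)
          then show ?thesis using True
            by (subst sums_unique[OF \<open>_ sums _\<close>], intro sum_le_suminf) (auto simp: sums_iff)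
        qed
        finally have "norm (\<Sum>n<N. f n s) \<le> s powr (Re z - 1) * exp (- a * s) * exp (norm d * s)"
          by (simp add: mult_left_mono)
        also have "\<dots> = s powr (Re z - 1) * exp (- (a - norm d) * s)"
          by (simp add: algebra_simps flip: exp_add)
        finally show ?thesis using True by simp
      qed simp
    qed
  qed auto
  moreover have "(LBINT s. (\<Sum>n<N. indicator {0<..} s *\<^sub>R f n s)) = (\<Sum>n<N. c * ((- z gchoose n) * (- d / of_real a) ^ n))" for N
  proof -
    have "(LBINT s. (\<Sum>n<N. indicator {0<..} s *\<^sub>R f n s)) = (\<Sum>n<N. (LBINT s. indicator {0<..} s *\<^sub>R f n s))"
      using int unfolding set_integrable_def by (intro Bochner_Integration.integral_sum) blast
    then show ?thesis unfolding val [symmetric] set_lebesgue_integral_def .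
  qed
  ultimately have "(\<lambda>n. c * ((- z gchoose n) * (- d / of_real a) ^ n)) sums (LBINT s:{0<..}. of_real s powr (z - 1) * exp (- u * of_real s))"
    by (simp add: sums_def set_lebesgue_integral_def)
  moreover have "(\<lambda>n. c * ((- z gchoose n) * (- d / of_real a) ^ n)) sums (c * (1 + - d / of_real a) powr - z)"
    using less a by (intro sums_mult gen_binomial_complex) (simp add: d_def norm_divide norm_minus_commute)
  ultimately have "(LBINT s:{0<..}. of_real s powr (z - 1) * exp (- u * of_real s)) = c * (1 + - d / of_real a) powr - z"
    by (rule sums_unique2)
  also have "1 + - d / of_real a = u / of_real a" using a by (simp add: d_def field_simps)
  also have "c * (u / of_real a) powr - z = Gamma z * u powr - z"
  proof -
    \<comment> \<open>Dividing by a positive real keeps the argument, so no multiple of 2 pi i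
      appears.\<close>
    have "Ln (u / of_real a) = Ln u - of_real (ln a)"
      using a u0 by (simp add: Ln_divide_of_real Ln_of_real)
    then show ?thesis using a u0 by (simp add: c_def powr_def Ln_of_real ring_distribs flip: exp_add)
  qed
  finally show ?thesis .
qed

subsection \<open>Growth in vertical strips\<close>

text \<open>Take u = \<open>cis \<phi>\<close> in \<open>Laplace_powr\<close>, with \<phi> of the
  sign of \<open>Im z\<close>: the factor \<open>u powr - z\<close> has modulus exp(\<theta> |Im
  z|), while the integral is at most its absolute version, a real Laplace integral with Re u = cos
  \<theta>.\<close>

lemma norm_Gamma_le:
  assumes z: "Re z > 0" and \<theta>: "0 \<le> \<theta>" "\<theta> < pi / 2"
  shows "norm (Gamma z) \<le> exp (- \<theta> * \<bar>Im z\<bar>) * (Gamma (Re z) * cos \<theta> powr - Re z)"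
proof -

  have cos_pos: "cos \<theta> > 0" using \<theta> by (intro cos_gt_zero_pi) auto
  define \<phi> where "\<phi> = (if Im z \<ge> 0 then \<theta> else - \<theta>)"
  have Re: "Re (cis \<phi>) = cos \<theta>" by (auto simp: \<phi>_def)
  have "Ln (cis \<phi>) = \<i> * of_real \<phi>"
    using \<theta> by (simp add: cis_conv_exp, subst Ln_exp) (auto simp: \<phi>_def)
  then have "norm (cis \<phi> powr - z) = exp (\<theta> * \<bar>Im z\<bar>)"
    by (simp add: powr_def norm_exp_eq_Re \<phi>_def)
  then have "norm (Gamma z) * exp (\<theta> * \<bar>Im z\<bar>) = norm (LBINT s:{0<..}. of_real s powr (z - 1) * exp (- cis \<phi> * of_real s))"
    using z cos_pos by (subst Laplace_powr) (simp_all add: Re norm_mult del: cis.simps)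
  also have "\<dots> \<le> (LBINT s:{0<..}. s powr (Re z - 1) * exp (- cos \<theta> * s))"
  proof -
    have "norm (LBINT s:{0<..}. of_real s powr (z - 1) * exp (- cis \<phi> * of_real s))
       \<le> (LBINT s. norm (indicator {0<..} s *\<^sub>R (of_real s powr (z - 1) * exp (- cis \<phi> * of_real s))))"
      unfolding set_lebesgue_integral_def by (rule integral_norm_bound)
    also have "\<dots> = (LBINT s:{0<..}. s powr (Re z - 1) * exp (- cos \<theta> * s))"
      unfolding set_lebesgue_integral_def using Re
      by (intro Bochner_Integration.integral_cong refl) (auto simp: indicator_def norm_mult norm_of_real_powr simp del: cis.simps)
    finally show ?thesis .
  qed
  also have "\<dots> = Gamma (Re z) * cos \<theta> powr - Re z"
  proof -
    have "complex_of_real (LBINT s:{0<..}. s powr (Re z - 1) * exp (- cos \<theta> * s)) =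
      (LBINT s:{0<..}. of_real s powr (of_real (Re z) - 1) * exp (- of_real (cos \<theta>) * of_real s))"
      unfolding set_lebesgue_integral_def
      by (subst integral_complex_of_real [symmetric], intro Bochner_Integration.integral_cong refl)
        (auto simp: indicator_def of_real_powr_eq_exp powr_def Ln_of_real simp flip: exp_of_real)
    also have "\<dots> = of_real (Gamma (Re z) * cos \<theta> powr - Re z)"
      using z cos_pos by (subst Laplace_powr_real) (auto simp: Gamma_complex_of_real powr_of_real[symmetric] simp flip: of_real_minus)
    finally show ?thesis unfolding of_real_eq_iff .
  qed
  finally show ?thesis by (simp add: exp_minus field_simps)
qed

text \<open>Exponential type r, uniform on each vertical strip; negative r means decay. Only large
  |Im z| is constrained, so poles of bounded height do no harm. Rates add under products and scale
  under real affine substitutions, which reduces every estimate below to arithmetic.\<close>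

definition strip_growth :: "real \<Rightarrow> (complex \<Rightarrow> complex) \<Rightarrow> bool" where
  "strip_growth r f \<longleftrightarrow>
     (\<forall>M. \<exists>C T. \<forall>z. \<bar>Re z\<bar> \<le> M \<longrightarrow> \<bar>Im z\<bar> \<ge> T \<longrightarrow> norm (f z) \<le> C * exp (r * \<bar>Im z\<bar>))"

lemma strip_growthI:
  assumes "\<And>M z. \<bar>Re z\<bar> \<le> M \<Longrightarrow> \<bar>Im z\<bar> \<ge> T M \<Longrightarrow> norm (f z) \<le> C M * exp (r * \<bar>Im z\<bar>)"
  shows "strip_growth r f"
  unfolding strip_growth_def using assms by blast

lemma strip_growthE:
  assumes "strip_growth r f"
  obtains C T where "C > 0" "T > 0" "\<And>z. \<bar>Re z\<bar> \<le> M \<Longrightarrow> \<bar>Im z\<bar> \<ge> T \<Longrightarrow> norm (f z) \<le> C * exp (r * \<bar>Im z\<bar>)"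
proof -
  obtain C T where *: "\<And>z. \<bar>Re z\<bar> \<le> M \<Longrightarrow> \<bar>Im z\<bar> \<ge> T \<Longrightarrow> norm (f z) \<le> C * exp (r * \<bar>Im z\<bar>)"
    using assms unfolding strip_growth_def by blast
  have "norm (f z) \<le> (\<bar>C\<bar> + 1) * exp (r * \<bar>Im z\<bar>)" if "\<bar>Re z\<bar> \<le> M" "\<bar>Im z\<bar> \<ge> \<bar>T\<bar> + 1" for z
  proof -
    have "norm (f z) \<le> C * exp (r * \<bar>Im z\<bar>)" using that by (intro *) auto
    also have "\<dots> \<le> (\<bar>C\<bar> + 1) * exp (r * \<bar>Im z\<bar>)" by (intro mult_right_mono) auto
    finally show ?thesis .
  qed
  then show thesis by (rule that[rotated 2]) auto
qed

lemma strip_growth_mult: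
  assumes "strip_growth r f" "strip_growth s g"
  shows "strip_growth (r + s) (\<lambda>z. f z * g z)"
  unfolding strip_growth_def
proof
  fix M
  from assms(1) obtain C T where f: "C > 0" "T > 0" "\<And>z. \<bar>Re z\<bar> \<le> M \<Longrightarrow> \<bar>Im z\<bar> \<ge> T \<Longrightarrow> norm (f z) \<le> C * exp (r * \<bar>Im z\<bar>)"
    by (rule strip_growthE[where M = M]) blast
  from assms(2) obtain D S where g: "D > 0" "S > 0" "\<And>z. \<bar>Re z\<bar> \<le> M \<Longrightarrow> \<bar>Im z\<bar> \<ge> S \<Longrightarrow> norm (g z) \<le> D * exp (s * \<bar>Im z\<bar>)"
    by (rule strip_growthE[where M = M]) blast
  have "norm (f z * g z) \<le> (C * D) * exp ((r + s) * \<bar>Im z\<bar>)" if "\<bar>Re z\<bar> \<le> M" "\<bar>Im z\<bar> \<ge> max S T" for z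
  proof -
    have "norm (f z * g z) \<le> (C * exp (r * \<bar>Im z\<bar>)) * (D * exp (s * \<bar>Im z\<bar>))"
      unfolding norm_mult using that f g by (intro mult_mono) auto
    then show ?thesis by (simp add: ring_distribs exp_add mult_ac)
  qed
  then show "\<exists>C T. \<forall>z. \<bar>Re z\<bar> \<le> M \<longrightarrow> \<bar>Im z\<bar> \<ge> T \<longrightarrow> norm (f z * g z) \<le> C * exp ((r + s) * \<bar>Im z\<bar>)" by blast
qed

lemma strip_growth_const: "strip_growth 0 (\<lambda>_. c)"
  by (rule strip_growthI[where T = "\<lambda>_. 0" and C = "\<lambda>_. norm c"]) auto

text \<open>A real factor k maps strips to strips. The translation changes |Im| by at most |Im d|,
  which only costs the constant exp(|r| |Im d|).\<close>

lemma strip_growth_affine: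
  assumes f: "strip_growth r f" and k: "k \<noteq> 0"
  shows "strip_growth (r * \<bar>k\<bar>) (\<lambda>z. f (of_real k * z + d))"
  unfolding strip_growth_def
proof
  fix M
  from f obtain C T where C: "C > 0" "T > 0" "\<And>z. \<bar>Re z\<bar> \<le> \<bar>k\<bar> * M + \<bar>Re d\<bar> \<Longrightarrow> \<bar>Im z\<bar> \<ge> T \<Longrightarrow> norm (f z) \<le> C * exp (r * \<bar>Im z\<bar>)"
    by (rule strip_growthE[where M = "\<bar>k\<bar> * M + \<bar>Re d\<bar>"]) blast
  have "norm (f (of_real k * z + d)) \<le> (C * exp (\<bar>r\<bar> * \<bar>Im d\<bar>)) * exp (r * \<bar>k\<bar> * \<bar>Im z\<bar>)"
    if z: "\<bar>Re z\<bar> \<le> M" "\<bar>Im z\<bar> \<ge> (T + \<bar>Im d\<bar>) / \<bar>k\<bar>" for z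
  proof -
    define w where "w = of_real k * z + d"
    have "\<bar>Re w\<bar> \<le> \<bar>k * Re z\<bar> + \<bar>Re d\<bar>" by (simp add: w_def)
    moreover have "\<bar>k * Re z\<bar> \<le> \<bar>k\<bar> * M" using z unfolding abs_mult by (intro mult_left_mono) auto
    ultimately have 1: "\<bar>Re w\<bar> \<le> \<bar>k\<bar> * M + \<bar>Re d\<bar>" by linarith
    have "Im w = k * Im z + Im d" by (simp add: w_def)
    then have "\<bar>\<bar>Im w\<bar> - \<bar>k * Im z\<bar>\<bar> \<le> \<bar>Im d\<bar>" by linarith
    then have 2: "\<bar>\<bar>Im w\<bar> - \<bar>k\<bar> * \<bar>Im z\<bar>\<bar> \<le> \<bar>Im d\<bar>" by (simp only: abs_mult)
    have "\<bar>k\<bar> * \<bar>Im z\<bar> \<ge> T + \<bar>Im d\<bar>" using z k by (simp add: field_simps)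
    moreover from 2 have "\<bar>k\<bar> * \<bar>Im z\<bar> \<le> \<bar>Im w\<bar> + \<bar>Im d\<bar>" unfolding abs_le_iff
      by (elim conjE) (simp add: algebra_simps)
    ultimately have "T \<le> \<bar>Im w\<bar>" by simp
    with 1 have 3: "norm (f w) \<le> C * exp (r * \<bar>Im w\<bar>)" by (rule C(3))
    have "r * \<bar>Im w\<bar> \<le> \<bar>r\<bar> * \<bar>Im d\<bar> + r * \<bar>k\<bar> * \<bar>Im z\<bar>"
    proof -
      have "r * (\<bar>Im w\<bar> - \<bar>k\<bar> * \<bar>Im z\<bar>) \<le> \<bar>r\<bar> * \<bar>\<bar>Im w\<bar> - \<bar>k\<bar> * \<bar>Im z\<bar>\<bar>"
        unfolding abs_mult [symmetric] by (rule abs_ge_self)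
      also have "\<dots> \<le> \<bar>r\<bar> * \<bar>Im d\<bar>" using 2 by (intro mult_left_mono) auto
      finally show ?thesis by (simp add: algebra_simps)
    qed
    then have "C * exp (r * \<bar>Im w\<bar>) \<le> C * exp (\<bar>r\<bar> * \<bar>Im d\<bar> + r * \<bar>k\<bar> * \<bar>Im z\<bar>)"
      using C(1) by simp
    with 3 show ?thesis unfolding w_def exp_add mult.assoc by (rule order_trans)
  qed
  then show "\<exists>C T. \<forall>z. \<bar>Re z\<bar> \<le> M \<longrightarrow> \<bar>Im z\<bar> \<ge> T \<longrightarrow> norm (f (of_real k * z + d)) \<le> C * exp (r * \<bar>k\<bar> * \<bar>Im z\<bar>)" by blast
qed

text \<open>The threshold T may be taken positive, so the real axis is never seen. This matters for
  identities that fail at real poles.\<close>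

lemma strip_growth_cong:
  assumes "strip_growth r f" "\<And>z. Im z \<noteq> 0 \<Longrightarrow> f z = g z"
  shows "strip_growth r g"
  unfolding strip_growth_def
proof
  fix M
  from assms(1) obtain C T where "C > 0" "T > 0" "\<And>z. \<bar>Re z\<bar> \<le> M \<Longrightarrow> \<bar>Im z\<bar> \<ge> T \<Longrightarrow> norm (f z) \<le> C * exp (r * \<bar>Im z\<bar>)"
    by (rule strip_growthE[where M = M]) blast
  then show "\<exists>C T. \<forall>z. \<bar>Re z\<bar> \<le> M \<longrightarrow> \<bar>Im z\<bar> \<ge> T \<longrightarrow> norm (g z) \<le> C * exp (r * \<bar>Im z\<bar>)"
    using assms(2) by (intro exI[of _ C] exI[of _ T]) force
qed

lemma strip_growth_exp: "strip_growth \<bar>Im l\<bar> (\<lambda>z. exp (z * l))"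
proof (rule strip_growthI)
  fix M z assume "\<bar>Re z\<bar> \<le> M" "\<bar>Im z\<bar> \<ge> 0"
  have "Re z * Re l - Im z * Im l \<le> \<bar>Re z * Re l\<bar> + \<bar>Im z * Im l\<bar>" by linarith
  then have "Re z * Re l - Im z * Im l \<le> \<bar>Re z\<bar> * \<bar>Re l\<bar> + \<bar>Im z\<bar> * \<bar>Im l\<bar>"
    by (simp only: abs_mult)
  also have "\<bar>Re z\<bar> * \<bar>Re l\<bar> \<le> M * \<bar>Re l\<bar>" using \<open>\<bar>Re z\<bar> \<le> M\<close> by (intro mult_right_mono) auto
  finally show "norm (exp (z * l)) \<le> exp (M * \<bar>Re l\<bar>) * exp (\<bar>Im l\<bar> * \<bar>Im z\<bar>)"
    by (simp add: norm_exp_eq_Re mult.commute[of "\<bar>Im l\<bar>"] flip: exp_add)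
qed

lemma norm_cos_le_exp: "norm (cos z) \<le> exp \<bar>Im z\<bar>"
proof -
  have "norm (cos z) \<le> (norm (exp (\<i> * z)) + norm (exp (- \<i> * z))) / 2"
    unfolding cos_exp_eq norm_divide using norm_triangle_ineq[of "exp (\<i> * z)" "exp (- \<i> * z)"] by simp
  also have "\<dots> \<le> (exp \<bar>Im z\<bar> + exp \<bar>Im z\<bar>) / 2"
    by (intro divide_right_mono add_mono) (auto simp: norm_exp_eq_Re)
  finally show ?thesis by simp
qed

lemma strip_growth_cos: "strip_growth 1 cos"
  by (rule strip_growthI[where T = "\<lambda>_. 0" and C = "\<lambda>_. 1"]) (auto intro: norm_cos_le_exp)

lemma norm_pochhammer_ge: "\<bar>Im z\<bar> ^ n \<le> norm (pochhammer z n)"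
proof -
  have "(\<Prod>i = 0..<n. \<bar>Im z\<bar>) \<le> (\<Prod>i = 0..<n. norm (z + of_nat i))"
    using abs_Im_le_cmod[of "z + of_nat _"] by (intro prod_mono) auto
  then show ?thesis by (simp add: pochhammer_prod prod_norm)
qed

text \<open>\<open>norm_Gamma_le\<close> needs a positive real part. The functional equation moves
  the strip to the right by n > M; for |Im z| \<ge> 1 the Pochhammer factor has modulus at least 1,
  so the move cannot decrease |Gamma|. Compactness of [n - M, n + M] bounds the factor depending on
  Re z.\<close>

lemma strip_growth_Gamma:
  assumes \<theta>: "0 \<le> \<theta>" "\<theta> < pi / 2"
  shows "strip_growth (- \<theta>) Gamma"
  unfolding strip_growth_def
proof
  fix M :: real
  obtain n :: nat where n: "real n > M" using reals_Archimedean2 by blast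
  have cos_pos: "cos \<theta> > 0" using \<theta> by (intro cos_gt_zero_pi) auto
  have "continuous_on {n - M..n + M} (\<lambda>x. Gamma x * cos \<theta> powr - x)"
    using n cos_pos by (intro continuous_intros) (auto simp: nonpos_Ints_def)
  then have "bounded ((\<lambda>x. Gamma x * cos \<theta> powr - x) ` {n - M..n + M})"
    by (intro compact_imp_bounded compact_continuous_image) auto
  then obtain B where "\<forall>x\<in>{n - M..n + M}. \<bar>Gamma x * cos \<theta> powr - x\<bar> \<le> B"
    unfolding bounded_real by blast
  then have B: "Gamma x * cos \<theta> powr - x \<le> B" if "x \<in> {n - M..n + M}" for x
    using that abs_le_D1 by blast
  have "norm (Gamma z) \<le> B * exp (- \<theta> * \<bar>Im z\<bar>)" if z: "\<bar>Re z\<bar> \<le> M" "\<bar>Im z\<bar> \<ge> 1" for z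
  proof -
    have nz: "z \<notin> \<int>\<^sub>\<le>\<^sub>0" using z by (auto simp: nonpos_Ints_def)
    have "1 \<le> norm (pochhammer z n)"
      using norm_pochhammer_ge[of z n] one_le_power[OF z(2), of n] by linarith
    moreover have "norm (Gamma (z + of_nat n)) = norm (Gamma z) * norm (pochhammer z n)"
      using nz by (simp add: pochhammer_Gamma Gamma_eq_zero_iff norm_divide)
    ultimately have "norm (Gamma z) \<le> norm (Gamma (z + of_nat n))"
      using mult_left_mono[of 1 "norm (pochhammer z n)" "norm (Gamma z)"] by simp
    also have "\<dots> \<le> exp (- \<theta> * \<bar>Im (z + of_nat n)\<bar>) * (Gamma (Re (z + of_nat n)) * cos \<theta> powr - Re (z + of_nat n))"
      using z n \<theta> by (intro norm_Gamma_le) auto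
    also have "\<dots> \<le> exp (- \<theta> * \<bar>Im (z + of_nat n)\<bar>) * B"
      using z by (intro mult_left_mono B) auto
    finally show ?thesis by (simp add: mult.commute)
  qed
  then show "\<exists>C T. \<forall>z. \<bar>Re z\<bar> \<le> M \<longrightarrow> \<bar>Im z\<bar> \<ge> T \<longrightarrow> norm (Gamma z) \<le> C * exp (- \<theta> * \<bar>Im z\<bar>)" by blast
qed

lemma strip_growth_tendsto_0:
  assumes "strip_growth r f" "r < 0" "e > 0"
  obtains T where "\<And>z. \<bar>Re z\<bar> \<le> M \<Longrightarrow> \<bar>Im z\<bar> \<ge> T \<Longrightarrow> norm (f z) < e"
proof -
  from assms(1) obtain C T where C: "C > 0" "T > 0" "\<And>z. \<bar>Re z\<bar> \<le> M \<Longrightarrow> \<bar>Im z\<bar> \<ge> T \<Longrightarrow> norm (f z) \<le> C * exp (r * \<bar>Im z\<bar>)"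
    by (rule strip_growthE[where M = M]) blast
  have "((\<lambda>t. C * exp (r * t)) \<longlongrightarrow> C * 0) at_top"
    using assms(2) by (intro tendsto_intros filterlim_compose[OF exp_at_bot])
      (auto intro: filterlim_tendsto_neg_mult_at_bot filterlim_ident)
  then have "eventually (\<lambda>t. C * exp (r * t) < e) at_top"
    using order_tendstoD(2) assms(3) by fastforce
  then obtain T' where "\<And>t. t \<ge> T' \<Longrightarrow> C * exp (r * t) < e" by (auto simp: eventually_at_top_linorder)
  then have "norm (f z) < e" if "\<bar>Re z\<bar> \<le> M" "\<bar>Im z\<bar> \<ge> max T T'" for z
    using that C(3)[of z] by (intro le_less_trans[of "norm (f z)" "C * exp (r * \<bar>Im z\<bar>)"]) auto
  then show thesis by (rule that)
qed

lemma integrable_exp_abs: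
  assumes "r < 0" shows "integrable lborel (\<lambda>t::real. exp (r * \<bar>t\<bar>))"
proof -
  have 1: "integrable lborel (\<lambda>t::real. indicator {0<..} t *\<^sub>R exp (r * t))"
  proof -
    have "(\<lambda>x. indicator {0<..} x *\<^sub>R (x powr (1 - 1) * exp (- (- r) * x))) = (\<lambda>t::real. indicator {0<..} t *\<^sub>R exp (r * t))"
      by (rule ext) (simp add: indicator_def)
    then show ?thesis using set_integrable_powr_exp[of 1 "- r"] assms unfolding set_integrable_def by simp
  qed
  have 2: "integrable lborel (\<lambda>t::real. indicator {0<..} (0 + (-1) * t) *\<^sub>R exp (r * (0 + (-1) * t)))"
    by (rule lborel_integrable_real_affine[OF 1]) auto
  show ?thesis
  proof (rule integrable_cong_AE_imp[OF Bochner_Integration.integrable_add[OF 1 2]])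
    show "AE t in lborel. indicator {0<..} t *\<^sub>R exp (r * t) + indicator {0<..} (0 + (-1) * t) *\<^sub>R exp (r * (0 + (-1) * t)) = exp (r * \<bar>t\<bar>)"
      using AE_lborel_singleton[of "0::real"] by eventually_elim (auto simp: indicator_def)
  qed auto
qed

text \<open>On one line, continuity handles the compact middle part and removes the threshold
  T.\<close>

lemma strip_growth_line_bound:
  assumes "strip_growth r f" and cont: "continuous_on UNIV (\<lambda>t. f (Complex \<sigma> t))"
  obtains C where "\<And>t. norm (f (Complex \<sigma> t)) \<le> C * exp (r * \<bar>t\<bar>)"
proof -
  from assms(1) obtain C T where C: "C > 0" "T > 0" "\<And>z. \<bar>Re z\<bar> \<le> \<bar>\<sigma>\<bar> \<Longrightarrow> \<bar>Im z\<bar> \<ge> T \<Longrightarrow> norm (f z) \<le> C * exp (r * \<bar>Im z\<bar>)"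
    by (rule strip_growthE[where M = "\<bar>\<sigma>\<bar>"]) blast
  have "continuous_on {-T..T} (\<lambda>t. f (Complex \<sigma> t) * of_real (exp (- r * \<bar>t\<bar>)))"
    by (intro continuous_intros continuous_on_subset[OF cont]) auto
  then have "bounded ((\<lambda>t. f (Complex \<sigma> t) * of_real (exp (- r * \<bar>t\<bar>))) ` {-T..T})"
    by (intro compact_imp_bounded compact_continuous_image) auto
  then obtain B where B: "\<And>t. t \<in> {-T..T} \<Longrightarrow> norm (f (Complex \<sigma> t) * of_real (exp (- r * \<bar>t\<bar>))) \<le> B"
    unfolding bounded_iff by blast
  have "norm (f (Complex \<sigma> t)) \<le> max B C * exp (r * \<bar>t\<bar>)" for t
  proof (cases "\<bar>t\<bar> \<le> T")
    case True
    then have "norm (f (Complex \<sigma> t)) * exp (- r * \<bar>t\<bar>) \<le> B"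
      using B[of t] by (auto simp: norm_mult abs_le_iff)
    then have "norm (f (Complex \<sigma> t)) \<le> B * exp (r * \<bar>t\<bar>)" by (simp add: exp_minus field_simps)
    then show ?thesis by (rule order_trans) (auto intro: mult_right_mono)
  next
    case False
    then have "norm (f (Complex \<sigma> t)) \<le> C * exp (r * \<bar>t\<bar>)" using C(3)[of "Complex \<sigma> t"] by simp
    then show ?thesis by (rule order_trans) (auto intro: mult_right_mono)
  qed
  then show thesis by (rule that)
qed

lemma strip_growth_line_integrable:
  assumes "strip_growth r f" "r < 0" and cont: "continuous_on UNIV (\<lambda>t. f (Complex \<sigma> t))"
  shows "integrable lborel (\<lambda>t. f (Complex \<sigma> t))"
proof -
  obtain C where C: "\<And>t. norm (f (Complex \<sigma> t)) \<le> C * exp (r * \<bar>t\<bar>)"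
    using strip_growth_line_bound[OF assms(1,3)] by blast
  have "integrable lborel (\<lambda>t. C * exp (r * \<bar>t\<bar>))"
    using integrable_exp_abs[OF assms(2)] by simp
  then show ?thesis
  proof (rule Bochner_Integration.integrable_bound)
    show "(\<lambda>t. f (Complex \<sigma> t)) \<in> borel_measurable lborel"
      using borel_measurable_continuous_onI[OF cont] by simp
    show "AE t in lborel. norm (f (Complex \<sigma> t)) \<le> norm (C * exp (r * \<bar>t\<bar>))"
      using C by (intro AE_I2) (auto intro: order_trans[OF _ abs_ge_self])
  qed
qed

subsection \<open>Contour integrals and vertical lines\<close>

text \<open>The end points are arbitrary functions because a contour will be cut at parameter
  values, but the vertical line at the heights that the contour has there.\<close>

lemma has_integral_UNIV_tendsto:
  fixes h :: "real \<Rightarrow> complex"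
  assumes "(h has_integral v) UNIV" "filterlim a at_bot F" "filterlim b at_top F"
  shows "((\<lambda>x. integral {a x..b x} h) \<longlongrightarrow> v) F"
proof (rule tendstoI)
  fix e :: real assume "e > 0"
  with assms(1) obtain B where B: "\<And>a b. ball 0 B \<subseteq> cbox a b \<Longrightarrow> norm (integral (cbox a b) h - v) < e"
    unfolding has_integral_alt'[of h] by (auto simp del: box_real) (metis UNIV_I)
  have "eventually (\<lambda>x. a x \<le> - B) F" "eventually (\<lambda>x. B \<le> b x) F"
    using assms(2,3) by (auto simp: filterlim_at_bot filterlim_at_top)
  then show "eventually (\<lambda>x. dist (integral {a x..b x} h) v < e) F"
  proof eventually_elim
    case (elim x)
    then have "ball 0 B \<subseteq> cbox (a x) (b x)" by (auto simp: dist_real_def)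
    from B[OF this] show ?case by (simp add: dist_norm)
  qed
qed

lemma contour_integral_vertical:
  assumes "(f has_contour_integral I) (linepath (Complex c b) (Complex c a))" "a < b"
  shows "I = - (\<i> * integral {a..b} (\<lambda>t. f (Complex c t)))"
proof -
  have "(f has_contour_integral - I) (linepath (Complex c a) (Complex c b))"
    using has_contour_integral_reversepath[OF valid_path_linepath assms(1)] by simp
  then have "- I = \<i> * integral {a..b} (\<lambda>t. f (Complex c t))"
    using contour_integral_linepath_same_Re[of "Complex c a" c "Complex c b" a b f] assms(2)
    by (simp add: contour_integral_unique)
  then show ?thesis by (metis minus_minus)
qed

lemma closed_segment_same_Re: "closed_segment (Complex x c) (Complex x d) \<subseteq> {z. Re z = x}"
  by (auto simp: closed_segment_def) (simp add: algebra_simps)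

lemma closed_segment_same_Im: "closed_segment z (Complex x (Im z)) \<subseteq> {w. Im w = Im z \<and> Re w \<in> closed_segment (Re z) x}"
  by (auto simp: closed_segment_def) (simp add: algebra_simps)

text \<open>The abscissa L of the vertical side is a parameter, since winding numbers are found by
  sliding that side sideways.\<close>

definition truncated_loop :: "(real \<Rightarrow> complex) \<Rightarrow> real \<Rightarrow> real \<Rightarrow> real \<Rightarrow> real \<Rightarrow> complex" where
  "truncated_loop \<gamma> a b L =
     (\<lambda>x. \<gamma> (a + (b - a) * x)) +++ linepath (\<gamma> b) (Complex L (Im (\<gamma> b))) +++
     linepath (Complex L (Im (\<gamma> b))) (Complex L (Im (\<gamma> a))) +++ linepath (Complex L (Im (\<gamma> a))) (\<gamma> a)"

section \<open>Regularity and winding numbers of the closed loops\<close>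

context
  fixes \<gamma> :: "real \<Rightarrow> complex"
  assumes \<gamma>: "\<gamma> piecewise_C1_differentiable_on UNIV"
begin

lemma continuous_on_contour: "continuous_on S \<gamma>"
  using \<gamma> unfolding piecewise_C1_differentiable_on_def by (blast intro: continuous_on_subset)

lemma valid_path_truncated_arc:
  assumes "a < b" shows "valid_path (\<lambda>x. \<gamma> (a + (b - a) * x))"
proof -
  obtain S D where S: "finite S" "\<And>t. t \<notin> S \<Longrightarrow> (\<gamma> has_vector_derivative D t) (at t)" "continuous_on (UNIV - S) D"
    using \<gamma> unfolding piecewise_C1_differentiable_on_def C1_differentiable_on_def by auto
  define S' where "S' = (\<lambda>x. a + (b - a) * x) -` S"
  have "finite S'" unfolding S'_def using assms by (intro finite_vimageI S(1)) (auto simp: inj_def)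
  moreover have "(\<lambda>x. \<gamma> (a + (b - a) * x)) C1_differentiable_on ({0..1} - S')"
    unfolding C1_differentiable_on_def
  proof (intro exI conjI ballI)
    show "((\<lambda>x. \<gamma> (a + (b - a) * x)) has_vector_derivative (b - a) *\<^sub>R D (a + (b - a) * x)) (at x)" if "x \<in> {0..1} - S'" for x
    proof -
      have "((\<lambda>x. a + (b - a) * x) has_real_derivative (b - a)) (at x)"
        by (auto intro!: derivative_eq_intros)
      then have "((\<lambda>x. a + (b - a) * x) has_vector_derivative (b - a)) (at x)"
        by (simp add: has_real_derivative_iff_has_vector_derivative)
      then show ?thesis
        using vector_diff_chain_at[OF _ S(2), of _ _ x] that by (auto simp: o_def S'_def)
    qed
    show "continuous_on ({0..1} - S') (\<lambda>x. (b - a) *\<^sub>R D (a + (b - a) * x))"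
      by (intro continuous_intros continuous_on_compose2[OF S(3)]) (auto simp: S'_def)
  qed
  moreover have "continuous_on {0..1} (\<lambda>x. \<gamma> (a + (b - a) * x))"
    by (intro continuous_on_compose2[OF continuous_on_contour[of UNIV]] continuous_intros) auto
  ultimately show ?thesis unfolding valid_path_def piecewise_C1_differentiable_on_def by blast
qed

lemma has_contour_integral_truncated_arc:
  assumes ab: "a < b" and int: "((\<lambda>t. f (\<gamma> t) * vector_derivative \<gamma> (at t)) has_integral J) {a..b}"
  shows "(f has_contour_integral J) (\<lambda>x. \<gamma> (a + (b - a) * x))"
proof -
  obtain S D where S: "finite S" "\<And>t. t \<notin> S \<Longrightarrow> (\<gamma> has_vector_derivative D t) (at t)"
    using \<gamma> unfolding piecewise_C1_differentiable_on_def C1_differentiable_on_def by auto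
  \<comment> \<open>The end points are exceptional as well: only in the interior is the derivative
    within [0, 1] compared with the two-sided one.\<close>
  define S' where "S' = insert 0 (insert 1 ((\<lambda>x. a + (b - a) * x) -` S))"
  have "finite ((\<lambda>x. a + (b - a) * x) -` S)" using ab by (intro finite_vimageI S(1)) (auto simp: inj_def)
  then have fin: "finite S'" by (simp add: S'_def)
  define h where "h = (\<lambda>t. f (\<gamma> t) * vector_derivative \<gamma> (at t))"
  have "((\<lambda>x. h ((b - a) *\<^sub>R x + a)) has_integral (J /\<^sub>R (b - a) ^ DIM(real))) (cbox ((a - a) /\<^sub>R (b - a)) ((b - a) /\<^sub>R (b - a)))"
    using ab int unfolding h_def by (intro has_integral_affinity') auto
  then have "((\<lambda>x. (b - a) *\<^sub>R h ((b - a) *\<^sub>R x + a)) has_integral ((b - a) *\<^sub>R (J /\<^sub>R (b - a)))) {0..1}"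
    using ab by (intro has_integral_cmul) (simp add: field_simps)
  then have *: "((\<lambda>x. (b - a) *\<^sub>R h (a + (b - a) * x)) has_integral J) {0..1}"
    using ab by (simp add: add.commute)
  show ?thesis
    unfolding has_contour_integral_def
  proof (rule has_integral_spike_finite[OF fin _ *])
    fix x assume x: "x \<in> {0..1} - S'"
    then have x01: "x \<in> {0<..<1}" by (auto simp: S'_def)
    have "((\<lambda>x. a + (b - a) * x) has_real_derivative (b - a)) (at x)"
      by (auto intro!: derivative_eq_intros)
    then have "((\<lambda>x. a + (b - a) * x) has_vector_derivative (b - a)) (at x)"
      by (simp add: has_real_derivative_iff_has_vector_derivative)
    then have d: "((\<lambda>x. \<gamma> (a + (b - a) * x)) has_vector_derivative (b - a) *\<^sub>R D (a + (b - a) * x)) (at x)"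
      using vector_diff_chain_at[OF _ S(2), of _ _ x] x by (auto simp: o_def S'_def)
    have "vector_derivative (\<lambda>x. \<gamma> (a + (b - a) * x)) (at x within {0..1}) = (b - a) *\<^sub>R D (a + (b - a) * x)"
      using x01 by (intro vector_derivative_within_cbox[of 0 1, simplified] has_vector_derivative_at_within[OF d]) auto
    moreover have "vector_derivative \<gamma> (at (a + (b - a) * x)) = D (a + (b - a) * x)"
      using x by (intro vector_derivative_at S(2)) (auto simp: S'_def)
    ultimately show "f (\<gamma> (a + (b - a) * x)) * vector_derivative (\<lambda>x. \<gamma> (a + (b - a) * x)) (at x within {0..1}) = (b - a) *\<^sub>R h (a + (b - a) * x)"
      by (simp add: h_def)
  qed
qed

lemma truncated_loop_basic [simp]:
  assumes "a < b"
  shows "valid_path (truncated_loop \<gamma> a b L)" "path (truncated_loop \<gamma> a b L)"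
    "pathfinish (truncated_loop \<gamma> a b L) = pathstart (truncated_loop \<gamma> a b L)"
proof -
  show *: "valid_path (truncated_loop \<gamma> a b L)"
    unfolding truncated_loop_def using valid_path_truncated_arc[OF assms]
    by (intro valid_path_join valid_path_linepath) (auto simp: pathfinish_def pathstart_def joinpaths_def linepath_def)
  then show "path (truncated_loop \<gamma> a b L)" by (rule valid_path_imp_path)
  show "pathfinish (truncated_loop \<gamma> a b L) = pathstart (truncated_loop \<gamma> a b L)"
    by (simp add: truncated_loop_def pathfinish_def pathstart_def joinpaths_def linepath_def)
qed

lemma path_image_truncated_loop:
  assumes "a < b"
  shows "path_image (truncated_loop \<gamma> a b L) = \<gamma> ` {a..b} \<union> closed_segment (\<gamma> b) (Complex L (Im (\<gamma> b))) \<union>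
    closed_segment (Complex L (Im (\<gamma> b))) (Complex L (Im (\<gamma> a))) \<union> closed_segment (Complex L (Im (\<gamma> a))) (\<gamma> a)"
proof -
  have "(\<lambda>x. a + (b - a) * x) ` {0..1} = {a..b}"
    using assms image_affinity_atLeastAtMost[of "b - a" a 0 1] by (simp add: add.commute)
  then have "path_image (\<lambda>x. \<gamma> (a + (b - a) * x)) = \<gamma> ` {a..b}"
    unfolding path_image_def by (metis image_image)
  then show ?thesis unfolding truncated_loop_def
    by (subst path_image_join path_image_linepath | simp add: pathfinish_def pathstart_def joinpaths_def linepath_def Un_assoc)+
qed

text \<open>Prepares the linear homotopy between loops with different vertical sides: at equal
  parameters the joining segment is a point of the contour, stays at one of the two end heights, or
  has abscissae between L and L'.\<close>

lemma truncated_loop_cases: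
  assumes "a < b" "x \<in> {0..1}"
  shows "(truncated_loop \<gamma> a b L x = truncated_loop \<gamma> a b L' x \<and> truncated_loop \<gamma> a b L x \<in> range \<gamma>) \<or>
     (Im (truncated_loop \<gamma> a b L x) = Im (truncated_loop \<gamma> a b L' x) \<and> Im (truncated_loop \<gamma> a b L x) \<in> {Im (\<gamma> a), Im (\<gamma> b)}) \<or>
     (Re (truncated_loop \<gamma> a b L x) = L \<and> Re (truncated_loop \<gamma> a b L' x) = L')"
  unfolding truncated_loop_def joinpaths_def linepath_def by (simp add: algebra_simps)

text \<open>The side is slid from \<sigma> to L without crossing p. The loop with side L misses the
  connected set P, so p can be traded for q, and q lies outside the convex set C that contains this
  loop.\<close>

lemma winding_number_truncated_loop_eq_0:
  assumes ab: "a < b" and P: "connected P" "p \<in> P" "q \<in> P"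
    and avoid: "\<And>z. z \<in> P \<Longrightarrow> z \<notin> range \<gamma> \<and> Im z \<noteq> Im (\<gamma> a) \<and> Im z \<noteq> Im (\<gamma> b) \<and> Re z \<noteq> L"
    and p: "Re p \<notin> closed_segment \<sigma> L"
    and C: "convex C" "\<gamma> ` {a..b} \<subseteq> C" "Complex L (Im (\<gamma> a)) \<in> C" "Complex L (Im (\<gamma> b)) \<in> C" "q \<notin> C"
  shows "winding_number (truncated_loop \<gamma> a b \<sigma>) p = 0"
proof -
  have "winding_number (truncated_loop \<gamma> a b \<sigma>) p = winding_number (truncated_loop \<gamma> a b L) p"
  proof (rule winding_number_loops_linear_eq)
    fix x :: real assume x: "x \<in> {0..1}"
    let ?u = "truncated_loop \<gamma> a b L x" and ?v = "truncated_loop \<gamma> a b \<sigma> x"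
    show "p \<notin> closed_segment ?u ?v"
    proof
      assume "p \<in> closed_segment ?u ?v"
      then obtain s where s: "0 \<le> s" "s \<le> 1" "p = (1 - s) *\<^sub>R ?u + s *\<^sub>R ?v" by (auto simp: closed_segment_def)
      from truncated_loop_cases[OF ab x, of L \<sigma>] show False
      proof (elim disjE conjE)
        assume "?u = ?v" "?u \<in> range \<gamma>"
        then have "p \<in> range \<gamma>" using s(3) by (simp add: algebra_simps flip: scaleR_add_left)
        with avoid P(2) show False by blast
      next
        assume "Im ?u = Im ?v" "Im ?u \<in> {Im (\<gamma> a), Im (\<gamma> b)}"
        moreover from this have "Im p = (1 - s) * Im ?v + s * Im ?v" unfolding s(3) by simp
        then have "Im p = Im ?v" by (simp add: algebra_simps)
        ultimately have "Im p \<in> {Im (\<gamma> a), Im (\<gamma> b)}" by simp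
        with avoid P(2) show False by blast
      next
        assume "Re ?u = L" "Re ?v = \<sigma>"
        then have "Re p = (1 - s) *\<^sub>R L + s *\<^sub>R \<sigma>" using s(3) by simp
        with s p show False unfolding closed_segment_commute[of \<sigma>] by (auto simp: closed_segment_def)
      qed
    qed
  qed (use ab in auto)
  also have "\<dots> = winding_number (truncated_loop \<gamma> a b L) q"
  proof (rule winding_number_eq[OF _ _ P(2,3,1)])
    show "P \<inter> path_image (truncated_loop \<gamma> a b L) = {}"
      unfolding path_image_truncated_loop[OF ab]
      using avoid closed_segment_same_Re[of L "Im (\<gamma> b)" "Im (\<gamma> a)"]
        closed_segment_same_Im[of "\<gamma> a" L] closed_segment_same_Im[of "\<gamma> b" L]
      unfolding closed_segment_commute[of _ "\<gamma> a"] by fastforce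
  qed (use ab in auto)
  also have "\<dots> = 0"
  proof (rule winding_number_zero_outside[OF _ C(1) _ C(5)])
    show "path_image (truncated_loop \<gamma> a b L) \<subseteq> C"
    proof -
      have "\<gamma> a \<in> C" "\<gamma> b \<in> C" using C(2) ab by auto
      then show ?thesis
        unfolding path_image_truncated_loop[OF ab] using C by (intro Un_least closed_segment_subset) auto
    qed
  qed (use ab in auto)
  finally show ?thesis .
qed

end

lemma Re_convex: "convex {z. Re z \<le> K}" "convex {z. Re z \<ge> K}"
  by (rule convex_halfspace_Re_le convex_halfspace_Re_ge)+

section \<open>Comparing an arbitrary contour with a vertical line\<close>

context
  fixes \<gamma> :: "real \<Rightarrow> complex" and M :: real
  assumes \<gamma>: "\<gamma> piecewise_C1_differentiable_on UNIV"
    and Im_bot: "filterlim (\<lambda>t. Im (\<gamma> t)) at_bot at_bot"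
    and Im_top: "filterlim (\<lambda>t. Im (\<gamma> t)) at_top at_top"
    and Re_le: "\<And>t. \<bar>Re (\<gamma> t)\<bar> \<le> M"
begin

text \<open>Since Im \<gamma> tends to infinity at both ends, only a compact piece of the curve can
  enter a unit ball; the margin 1 in the choice of A and B matches the radius.\<close>

lemma open_complement_contour: "open (- range \<gamma>)"
proof (rule openI)
  fix z assume z: "z \<in> - range \<gamma>"
  have "eventually (\<lambda>t. Im (\<gamma> t) < Im z - 1) at_bot" "eventually (\<lambda>t. Im (\<gamma> t) > Im z + 1) at_top"
    using Im_bot Im_top by (auto simp: filterlim_at_bot_dense filterlim_at_top_dense)
  then obtain A B where AB: "\<And>t. t \<le> A \<Longrightarrow> Im (\<gamma> t) < Im z - 1" "\<And>t. t \<ge> B \<Longrightarrow> Im (\<gamma> t) > Im z + 1"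
    by (auto simp: eventually_at_bot_linorder eventually_at_top_linorder)
  let ?U = "ball z 1 \<inter> - \<gamma> ` {A..B}"
  have "open ?U"
    by (intro open_Int open_Compl compact_imp_closed compact_continuous_image continuous_on_contour[OF \<gamma>]) auto
  moreover have "z \<in> ?U" using z by auto
  moreover have "?U \<subseteq> - range \<gamma>"
  proof safe
    fix t assume t: "\<gamma> t \<in> ball z 1" "\<gamma> t \<notin> \<gamma> ` {A..B}"
    have "\<bar>Im (z - \<gamma> t)\<bar> < 1" using t(1) abs_Im_le_cmod[of "z - \<gamma> t"] by (simp add: dist_norm)
    then have "\<not> t \<le> A" "\<not> t \<ge> B" using AB[of t] by force+
    with t(2) show False by auto
  qed
  ultimately show "\<exists>e>0. ball z e \<subseteq> - range \<gamma>"
    by (meson open_contains_ball order_trans)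
qed

text \<open>Openness turns connectedness into a path, whose image is bounded. Boundedness is the
  point: the horizontal sides and the displaced vertical side can then be placed beyond it.\<close>

lemma obtain_connecting_set:
  assumes "connected_component (- range \<gamma>) p q"
  obtains P B where "connected P" "p \<in> P" "q \<in> P" "P \<inter> range \<gamma> = {}" "\<And>z. z \<in> P \<Longrightarrow> norm z < B"
proof -
  have "path_component (- range \<gamma>) p q"
    using assms open_path_connected_component[OF open_complement_contour] by metis
  then obtain g where g: "path g" "path_image g \<subseteq> - range \<gamma>" "pathstart g = p" "pathfinish g = q"
    unfolding path_component_def by blast
  have "bounded (path_image g)" using g(1) by (rule bounded_path_image)
  then obtain B where "\<forall>z\<in>path_image g. norm z \<le> B" by (auto simp: bounded_iff)
  then show thesis
    using g pathstart_in_path_image[of g] pathfinish_in_path_image[of g]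
    by (intro that[of "path_image g" "B + 1"] connected_path_image) force+
qed

lemma not_in_range_contour:
  assumes "right_of_contour \<gamma> p \<or> left_of_contour \<gamma> p"
  shows "p \<notin> range \<gamma>"
proof -
  from assms obtain R where "(\<forall>q. Re q \<ge> R \<longrightarrow> connected_component (- range \<gamma>) p q) \<or>
      (\<forall>q. Re q \<le> R \<longrightarrow> connected_component (- range \<gamma>) p q)"
    unfolding right_of_contour_def left_of_contour_def by blast
  then have "connected_component (- range \<gamma>) p (of_real R)" by auto
  then show ?thesis using connected_component_in(1) by blast
qed

text \<open>A pole to the right of the line is not crossed when the vertical side is slid to the
  left, and to the right it can escape along P to a point beyond the whole loop.\<close>

lemma winding_number_right_of_contour:
  assumes p: "right_of_contour \<gamma> p" "Re p > \<sigma>"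
  shows "\<exists>T. \<forall>a b. a < b \<longrightarrow> Im (\<gamma> a) \<le> - T \<longrightarrow> Im (\<gamma> b) \<ge> T \<longrightarrow> winding_number (truncated_loop \<gamma> a b \<sigma>) p = 0"
proof -
  obtain R where R: "\<And>q. Re q \<ge> R \<Longrightarrow> connected_component (- range \<gamma>) p q"
    using p(1) unfolding right_of_contour_def by blast
  \<comment> \<open>Far enough right to lie in the component of p and outside the half plane Re z
    \<le> max M \<sigma>, which contains the loop.\<close>
  define q where "q = Complex (max R (max M \<sigma> + 1)) 0"
  obtain P B where P: "connected P" "p \<in> P" "q \<in> P" "P \<inter> range \<gamma> = {}" "\<And>z. z \<in> P \<Longrightarrow> norm z < B"
    using obtain_connecting_set[OF R[of q]] by (auto simp: q_def)
  have B: "\<bar>Re z\<bar> < B \<and> \<bar>Im z\<bar> < B" if "z \<in> P" for z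
    using P(5)[OF that] abs_Re_le_cmod[of z] abs_Im_le_cmod[of z] by linarith
  \<comment> \<open>At or to the left of the line \<sigma>, and to the left of all of P.\<close>
  define L where "L = min \<sigma> (- B)"
  have "winding_number (truncated_loop \<gamma> a b \<sigma>) p = 0" if "a < b" "Im (\<gamma> a) \<le> - B" "Im (\<gamma> b) \<ge> B" for a b
  proof (rule winding_number_truncated_loop_eq_0[OF \<gamma> that(1) P(1-3)])
    show "z \<notin> range \<gamma> \<and> Im z \<noteq> Im (\<gamma> a) \<and> Im z \<noteq> Im (\<gamma> b) \<and> Re z \<noteq> L" if "z \<in> P" for z
      using that P(4) B[OF that] \<open>Im (\<gamma> a) \<le> - B\<close> \<open>Im (\<gamma> b) \<ge> B\<close> by (auto simp: L_def)
    show "Re p \<notin> closed_segment \<sigma> L" using p(2) by (simp add: L_def closed_segment_eq_real_ivl)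
    show "convex {z. Re z \<le> max M \<sigma>}" by (rule Re_convex)
    show "\<gamma> ` {a..b} \<subseteq> {z. Re z \<le> max M \<sigma>}" using Re_le by (auto simp: abs_le_iff le_max_iff_disj)
  qed (auto simp: L_def q_def)
  then show ?thesis by blast
qed

text \<open>The mirror image: the side slides to the right and the escape is to the left.\<close>

lemma winding_number_left_of_contour:
  assumes p: "left_of_contour \<gamma> p" "Re p < \<sigma>"
  shows "\<exists>T. \<forall>a b. a < b \<longrightarrow> Im (\<gamma> a) \<le> - T \<longrightarrow> Im (\<gamma> b) \<ge> T \<longrightarrow> winding_number (truncated_loop \<gamma> a b \<sigma>) p = 0"
proof -
  obtain R where R: "\<And>q. Re q \<le> R \<Longrightarrow> connected_component (- range \<gamma>) p q"
    using p(1) unfolding left_of_contour_def by blast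
  define q where "q = Complex (min R (min (- M) \<sigma> - 1)) 0"
  obtain P B where P: "connected P" "p \<in> P" "q \<in> P" "P \<inter> range \<gamma> = {}" "\<And>z. z \<in> P \<Longrightarrow> norm z < B"
    using obtain_connecting_set[OF R[of q]] by (auto simp: q_def)
  have B: "\<bar>Re z\<bar> < B \<and> \<bar>Im z\<bar> < B" if "z \<in> P" for z
    using P(5)[OF that] abs_Re_le_cmod[of z] abs_Im_le_cmod[of z] by linarith
  define L where "L = max \<sigma> B"
  have "winding_number (truncated_loop \<gamma> a b \<sigma>) p = 0" if "a < b" "Im (\<gamma> a) \<le> - B" "Im (\<gamma> b) \<ge> B" for a b
  proof (rule winding_number_truncated_loop_eq_0[OF \<gamma> that(1) P(1-3)])
    show "z \<notin> range \<gamma> \<and> Im z \<noteq> Im (\<gamma> a) \<and> Im z \<noteq> Im (\<gamma> b) \<and> Re z \<noteq> L" if "z \<in> P" for z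
      using that P(4) B[OF that] \<open>Im (\<gamma> a) \<le> - B\<close> \<open>Im (\<gamma> b) \<ge> B\<close> by (auto simp: L_def)
    show "Re p \<notin> closed_segment \<sigma> L" using p(2) by (simp add: L_def closed_segment_eq_real_ivl)
    show "convex {z. Re z \<ge> min (- M) \<sigma>}" by (rule Re_convex)
    show "\<gamma> ` {a..b} \<subseteq> {z. Re z \<ge> min (- M) \<sigma>}"
    proof safe
      fix t show "min (- M) \<sigma> \<le> Re (\<gamma> t)" using Re_le[of t] by linarith
    qed
  qed (auto simp: L_def q_def)
  then show ?thesis by blast
qed

text \<open>The loop stays in a half plane that excludes p. No lower bound on the size of the loop
  is required, so this disposes of infinitely many poles at once.\<close>

lemma winding_number_beyond_contour:
  assumes ab: "a < b" and p: "Re p > max M \<sigma> \<or> Re p < min (- M) \<sigma>"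
  shows "winding_number (truncated_loop \<gamma> a b \<sigma>) p = 0"
proof -
  have *: "path_image (truncated_loop \<gamma> a b \<sigma>) \<subseteq> C"
    if "convex C" "\<gamma> ` {a..b} \<subseteq> C" "Complex \<sigma> (Im (\<gamma> a)) \<in> C" "Complex \<sigma> (Im (\<gamma> b)) \<in> C" for C
  proof -
    have "\<gamma> a \<in> C" "\<gamma> b \<in> C" using that(2) ab by auto
    then show ?thesis
      unfolding path_image_truncated_loop[OF \<gamma> ab] using that by (intro Un_least closed_segment_subset) auto
  qed
  have R: "Re (\<gamma> t) \<le> max M \<sigma>" "min (- M) \<sigma> \<le> Re (\<gamma> t)" for t
    using Re_le[of t] by linarith+
  show ?thesis
  proof (cases "Re p > max M \<sigma>")
    case True
    have "path_image (truncated_loop \<gamma> a b \<sigma>) \<subseteq> {z. Re z \<le> max M \<sigma>}"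
      by (rule * [OF Re_convex(1)]) (use R in auto)
    then show ?thesis
      using True by (intro winding_number_zero_outside[OF _ Re_convex(1)] truncated_loop_basic[OF \<gamma> ab]) auto
  next
    case False
    have "path_image (truncated_loop \<gamma> a b \<sigma>) \<subseteq> {z. Re z \<ge> min (- M) \<sigma>}"
      by (rule * [OF Re_convex(2)]) (use R in auto)
    then show ?thesis
      using False p by (intro winding_number_zero_outside[OF _ Re_convex(2)] truncated_loop_basic[OF \<gamma> ab]) auto
  qed
qed

proposition contour_integral_eq_vertical_line:
  fixes f :: "complex \<Rightarrow> complex"
  assumes right: "\<And>p. p \<in> PR \<Longrightarrow> right_of_contour \<gamma> p \<and> Re p > \<sigma>"
    and left: "\<And>p. p \<in> PL \<Longrightarrow> left_of_contour \<gamma> p \<and> Re p < \<sigma>"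
    and fin: "\<And>K. finite {p \<in> PR. Re p \<le> K}" "\<And>K. finite {p \<in> PL. Re p \<ge> K}"
    and holo: "open (- (PR \<union> PL))" "f holomorphic_on - (PR \<union> PL)"
    and decay: "\<And>K e. e > 0 \<Longrightarrow> \<exists>T. \<forall>z. \<bar>Re z\<bar> \<le> K \<longrightarrow> \<bar>Im z\<bar> \<ge> T \<longrightarrow> norm (f z) < e"
    and int: "((\<lambda>t. f (\<gamma> t) * vector_derivative \<gamma> (at t)) has_integral v) UNIV"
    and line: "((\<lambda>t. f (Complex \<sigma> t)) has_integral u) UNIV"
  shows "v = \<i> * u"
proof -
  define h where "h = (\<lambda>t. f (\<gamma> t) * vector_derivative \<gamma> (at t))"
  define K where "K = max M \<bar>\<sigma>\<bar>"
  have ReK: "\<bar>Re (\<gamma> t)\<bar> \<le> K" for t using Re_le[of t] by (simp add: K_def)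
  have K0: "K \<ge> 0" "\<bar>\<sigma>\<bar> \<le> K" by (auto simp: K_def)
  \<comment> \<open>These finitely many poles each impose a threshold on the height of the loop; all
    other poles lie beyond the contour and the line.\<close>
  define F where "F = {p \<in> PR. Re p \<le> K} \<union> {p \<in> PL. Re p \<ge> - K}"
  have "finite F" unfolding F_def using fin by auto
  have "\<forall>p\<in>F. \<exists>T. \<forall>a b. a < b \<longrightarrow> Im (\<gamma> a) \<le> - T \<longrightarrow> Im (\<gamma> b) \<ge> T \<longrightarrow> winding_number (truncated_loop \<gamma> a b \<sigma>) p = 0"
    using right left winding_number_right_of_contour winding_number_left_of_contour unfolding F_def by blast
  then obtain T where T: "\<And>p a b. p \<in> F \<Longrightarrow> a < b \<Longrightarrow> Im (\<gamma> a) \<le> - T p \<Longrightarrow> Im (\<gamma> b) \<ge> T p \<Longrightarrow> winding_number (truncated_loop \<gamma> a b \<sigma>) p = 0"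
    by metis
  \<comment> \<open>Besides the thresholds, T0 exceeds the heights of the poles in F, so the
    horizontal segments miss every pole.\<close>
  define T0 where "T0 = Max (insert 0 ((\<lambda>p. max (T p) (\<bar>Im p\<bar> + 1)) ` F))"
  have T0: "T p \<le> T0" "\<bar>Im p\<bar> < T0" if "p \<in> F" for p
  proof -
    have "max (T p) (\<bar>Im p\<bar> + 1) \<le> T0"
      unfolding T0_def using \<open>finite F\<close> that by (intro Max_ge) auto
    then show "T p \<le> T0" "\<bar>Im p\<bar> < T0" by auto
  qed
  have T0_nonneg: "T0 \<ge> 0" unfolding T0_def using \<open>finite F\<close> by (intro Max_ge) auto
  have range: "\<gamma> t \<notin> PR \<union> PL" for t
    using not_in_range_contour[of "\<gamma> t"] right[of "\<gamma> t"] left[of "\<gamma> t"] by blast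
  \<comment> \<open>By Cauchy's theorem the difference is carried by the two horizontal segments,
    each of length at most 2 K.\<close>
  have main: "norm (integral {a..b} h - \<i> * integral {Im (\<gamma> a)..Im (\<gamma> b)} (\<lambda>t. f (Complex \<sigma> t))) \<le> 4 * K * e"
    if ab: "a < b" "Im (\<gamma> a) < - T0" "Im (\<gamma> b) > T0"
      and e: "e > 0" "\<And>z. \<bar>Re z\<bar> \<le> K \<Longrightarrow> Im z \<in> {Im (\<gamma> a), Im (\<gamma> b)} \<Longrightarrow> norm (f z) \<le> e" for a b e
  proof -
    let ?S = "- (PR \<union> PL)"
    have horiz: "closed_segment (\<gamma> t) (Complex \<sigma> (Im (\<gamma> t))) \<subseteq> {z. Im z = Im (\<gamma> t) \<and> \<bar>Re z\<bar> \<le> K}" for t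
    proof
      fix z assume "z \<in> closed_segment (\<gamma> t) (Complex \<sigma> (Im (\<gamma> t)))"
      then have z: "Im z = Im (\<gamma> t)" "Re z \<in> closed_segment (Re (\<gamma> t)) \<sigma>"
        using closed_segment_same_Im[of "\<gamma> t" \<sigma>] by auto
      have "Re z \<in> {- K..K}"
        using ReK[of t] K0(2) by (intro subsetD[OF closed_segment_subset z(2)]) auto
      with z show "z \<in> {z. Im z = Im (\<gamma> t) \<and> \<bar>Re z\<bar> \<le> K}" by auto
    qed
    have horiz_S: "closed_segment (\<gamma> t) (Complex \<sigma> (Im (\<gamma> t))) \<subseteq> ?S" if "t \<in> {a, b}" for t
    proof
      fix z assume "z \<in> closed_segment (\<gamma> t) (Complex \<sigma> (Im (\<gamma> t)))"
      with horiz have z: "Im z = Im (\<gamma> t)" "\<bar>Re z\<bar> \<le> K" by auto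
      then have "\<bar>Im z\<bar> > T0" using that ab T0_nonneg by auto
      then have "z \<notin> F" using T0(2)[of z] by auto
      with z show "z \<in> ?S" by (auto simp: F_def)
    qed
    have vert_S: "closed_segment (Complex \<sigma> c) (Complex \<sigma> d) \<subseteq> ?S" for c d
      using closed_segment_same_Re[of \<sigma> c d] right left by force
    have image_S: "path_image (truncated_loop \<gamma> a b \<sigma>) \<subseteq> ?S"
      unfolding path_image_truncated_loop[OF \<gamma> ab(1)]
      using range horiz_S[of a] horiz_S[of b] vert_S by (auto simp: closed_segment_commute[of _ "\<gamma> a"])
    have "(f has_contour_integral 0) (truncated_loop \<gamma> a b \<sigma>)"
    proof (rule Cauchy_theorem_global[OF holo _ _ image_S])
      fix w assume "w \<notin> ?S"
      show "winding_number (truncated_loop \<gamma> a b \<sigma>) w = 0"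
      proof (cases "w \<in> F")
        case True
        with T[of w a b] T0(1)[of w] ab show ?thesis by auto
      next
        case False
        with \<open>w \<notin> ?S\<close> have "Re w > K \<or> Re w < - K" by (auto simp: F_def)
        then show ?thesis using K0 by (intro winding_number_beyond_contour[OF ab(1)]) (auto simp: K_def)
      qed
    qed (use truncated_loop_basic[OF \<gamma> ab(1)] in auto)
    have cint: "f contour_integrable_on linepath z w" if "closed_segment z w \<subseteq> ?S" for z w
      using holomorphic_on_imp_continuous_on[OF holo(2)] that
      by (intro contour_integrable_continuous_linepath) (auto intro: continuous_on_subset)
    define H1 where "H1 = contour_integral (linepath (\<gamma> b) (Complex \<sigma> (Im (\<gamma> b)))) f"
    define H2 where "H2 = contour_integral (linepath (Complex \<sigma> (Im (\<gamma> a))) (\<gamma> a)) f"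
    define V where "V = contour_integral (linepath (Complex \<sigma> (Im (\<gamma> b))) (Complex \<sigma> (Im (\<gamma> a)))) f"
    have h1: "(f has_contour_integral H1) (linepath (\<gamma> b) (Complex \<sigma> (Im (\<gamma> b))))"
      unfolding H1_def by (intro has_contour_integral_integral cint horiz_S) auto
    have h2: "(f has_contour_integral H2) (linepath (Complex \<sigma> (Im (\<gamma> a))) (\<gamma> a))"
      unfolding H2_def using horiz_S[of a] by (intro has_contour_integral_integral cint) (auto simp: closed_segment_commute)
    have V: "(f has_contour_integral V) (linepath (Complex \<sigma> (Im (\<gamma> b))) (Complex \<sigma> (Im (\<gamma> a))))"
      unfolding V_def by (intro has_contour_integral_integral cint vert_S)
    have "(h has_integral integral {a..b} h) {a..b}"
      using int unfolding h_def
      by (intro integrable_integral integrable_on_subinterval[OF has_integral_integrable]) auto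
    then have A: "(f has_contour_integral integral {a..b} h) (\<lambda>x. \<gamma> (a + (b - a) * x))"
      unfolding h_def by (rule has_contour_integral_truncated_arc[OF \<gamma> ab(1)])
    have "(f has_contour_integral (integral {a..b} h + (H1 + (V + H2)))) (truncated_loop \<gamma> a b \<sigma>)"
      unfolding truncated_loop_def
      by (intro has_contour_integral_join A h1 h2 V valid_path_join valid_path_truncated_arc[OF \<gamma> ab(1)]) auto
    with \<open>(f has_contour_integral 0) _\<close> have "integral {a..b} h + (H1 + (V + H2)) = 0"
      by (rule has_contour_integral_unique[symmetric])
    moreover have "V = - (\<i> * integral {Im (\<gamma> a)..Im (\<gamma> b)} (\<lambda>t. f (Complex \<sigma> t)))"
      using ab T0_nonneg by (intro contour_integral_vertical[OF V]) auto
    ultimately have "integral {a..b} h - \<i> * integral {Im (\<gamma> a)..Im (\<gamma> b)} (\<lambda>t. f (Complex \<sigma> t)) = - (H1 + H2)"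
      by (simp add: algebra_simps eq_neg_iff_add_eq_0)
    also have "norm \<dots> \<le> norm H1 + norm H2" unfolding norm_minus_cancel by (rule norm_triangle_ineq)
    also have "norm H1 \<le> e * (2 * K)"
    proof -
      have "norm H1 \<le> e * norm (Complex \<sigma> (Im (\<gamma> b)) - \<gamma> b)"
        using horiz[of b] e by (intro has_contour_integral_bound_linepath[OF h1]) auto
      also have "norm (Complex \<sigma> (Im (\<gamma> b)) - \<gamma> b) \<le> 2 * K"
        using ReK[of b] K0 by (subst cmod_eq_Re) auto
      finally show ?thesis using e(1) by simp
    qed
    also have "norm H2 \<le> e * (2 * K)"
    proof -
      have "norm H2 \<le> e * norm (\<gamma> a - Complex \<sigma> (Im (\<gamma> a)))"
        using horiz[of a] e by (intro has_contour_integral_bound_linepath[OF h2]) (auto simp: closed_segment_commute)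
      also have "norm (\<gamma> a - Complex \<sigma> (Im (\<gamma> a))) \<le> 2 * K"
        using ReK[of a] K0 by (subst cmod_eq_Re) auto
      finally show ?thesis using e(1) by simp
    qed
    finally show ?thesis by (simp add: algebra_simps)
  qed
  have lim_n: "filterlim (\<lambda>n. real n) at_top sequentially" "filterlim (\<lambda>n. - real n) at_bot sequentially"
    by (auto intro: filterlim_real_sequentially simp: filterlim_uminus_at_top[symmetric])
  have lims: "filterlim (\<lambda>n. Im (\<gamma> (real n))) at_top sequentially" "filterlim (\<lambda>n. Im (\<gamma> (- real n))) at_bot sequentially"
    using filterlim_compose[OF Im_top lim_n(1)] filterlim_compose[OF Im_bot lim_n(2)] by auto
  have 1: "(\<lambda>n. integral {- real n..real n} h - \<i> * integral {Im (\<gamma> (- real n))..Im (\<gamma> (real n))} (\<lambda>t. f (Complex \<sigma> t))) \<longlonglongrightarrow> v - \<i> * u"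
    using has_integral_UNIV_tendsto[OF int lim_n(2,1)] has_integral_UNIV_tendsto[OF line lims(2,1)]
    unfolding h_def by (intro tendsto_intros)
  have 2: "(\<lambda>n. integral {- real n..real n} h - \<i> * integral {Im (\<gamma> (- real n))..Im (\<gamma> (real n))} (\<lambda>t. f (Complex \<sigma> t))) \<longlonglongrightarrow> 0"
  proof (rule tendstoI)
    fix e :: real assume e: "e > 0"
    \<comment> \<open>The summand 1 covers K = 0 and makes the final estimate strict.\<close>
    define c where "c = 4 * K + 1"
    define d where "d = e / c"
    have c: "c > 0" "4 * K < c" using K0 by (auto simp: c_def)
    have "d > 0" using e c by (simp add: d_def)
    have "4 * K * d < c * d" using \<open>d > 0\<close> c by (intro mult_strict_right_mono)
    also have "c * d = e" using c by (simp add: d_def)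
    finally have "4 * K * d < e" .
    note d = \<open>d > 0\<close> this
    obtain T1 where T1: "\<And>z. \<bar>Re z\<bar> \<le> K \<Longrightarrow> \<bar>Im z\<bar> \<ge> T1 \<Longrightarrow> norm (f z) < d" using decay[OF d(1)] by blast
    have "eventually (\<lambda>n. Im (\<gamma> (real n)) > max T0 \<bar>T1\<bar>) sequentially" "eventually (\<lambda>n. Im (\<gamma> (- real n)) < - max T0 \<bar>T1\<bar>) sequentially"
      using lims unfolding filterlim_at_bot_dense filterlim_at_top_dense by blast+
    then show "eventually (\<lambda>n. dist (integral {- real n..real n} h - \<i> * integral {Im (\<gamma> (- real n))..Im (\<gamma> (real n))} (\<lambda>t. f (Complex \<sigma> t))) 0 < e) sequentially"
      using eventually_gt_at_top[of 0]
    proof eventually_elim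
      case (elim n)
      have "norm (integral {- real n..real n} h - \<i> * integral {Im (\<gamma> (- real n))..Im (\<gamma> (real n))} (\<lambda>t. f (Complex \<sigma> t))) \<le> 4 * K * d"
        using elim d(1) by (intro main less_imp_le[OF T1]) auto
      with d(2) show ?case by simp
    qed
  qed
  from LIMSEQ_unique[OF 1 2] show ?thesis by simp
qed

end

text \<open>The residue theorem for one simple pole, with Cauchy's formula applied to g on
  rectangles of growing height. The factor \<i> from parametrising the lines cancels the one in 2 pi
  \<i>.\<close>

proposition vertical_line_shift:
  fixes f g :: "complex \<Rightarrow> complex"
  assumes strip: "A < ca" "ca < Re p" "Re p < cb" "cb < B"
    and holo: "g holomorphic_on {z. A < Re z \<and> Re z < B}"
    and fg: "\<And>z. A < Re z \<Longrightarrow> Re z < B \<Longrightarrow> z \<noteq> p \<Longrightarrow> f z = g z / (z - p)"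
    and decay: "\<And>e. e > 0 \<Longrightarrow> \<exists>T. \<forall>z. ca \<le> Re z \<longrightarrow> Re z \<le> cb \<longrightarrow> \<bar>Im z\<bar> \<ge> T \<longrightarrow> norm (f z) < e"
    and int1: "((\<lambda>t. f (Complex ca t)) has_integral u1) UNIV"
    and int2: "((\<lambda>t. f (Complex cb t)) has_integral u2) UNIV"
  shows "u2 - u1 = 2 * of_real pi * g p"
proof -
  let ?S = "{z. A < Re z \<and> Re z < B}"
  have conv: "convex ?S"
    using convex_Int[OF convex_halfspace_Re_gt[of A] convex_halfspace_Re_lt[of B]] by (simp add: Collect_conj_eq[symmetric])
  have op: "open ?S"
    using open_Int[OF open_halfspace_Re_gt[of A] open_halfspace_Re_lt[of B]] by (simp add: Collect_conj_eq[symmetric])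
  have f_cont: "continuous_on (?S - {p}) f"
  proof -
    have "(\<lambda>z. g z / (z - p)) holomorphic_on (?S - {p})"
      by (intro holomorphic_intros holomorphic_on_subset[OF holo]) auto
    then have "continuous_on (?S - {p}) (\<lambda>z. g z / (z - p))" by (rule holomorphic_on_imp_continuous_on)
    then show ?thesis by (rule continuous_on_eq) (auto simp: fg)
  qed
  define I where "I = (\<lambda>T. \<i> * integral {-T..T} (\<lambda>t. f (Complex cb t)) - \<i> * integral {-T..T} (\<lambda>t. f (Complex ca t)))"
  have main: "norm (I T - 2 * of_real pi * \<i> * g p) \<le> 2 * (cb - ca) * e"
    if T: "T > \<bar>Im p\<bar>" and e: "e > 0" "\<And>z. ca \<le> Re z \<Longrightarrow> Re z \<le> cb \<Longrightarrow> \<bar>Im z\<bar> = T \<Longrightarrow> norm (f z) \<le> e" for T e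
  proof -
    let ?r = "rectpath (Complex ca (-T)) (Complex cb T)"
    have T0: "T > 0" using T by linarith
    have pin: "p \<in> box (Complex ca (-T)) (Complex cb T)"
      using strip T by (auto simp: in_box_complex_iff)
    have "path_image ?r = cbox (Complex ca (-T)) (Complex cb T) - box (Complex ca (-T)) (Complex cb T)"
      using strip T0 by (intro path_image_rectpath_cbox_minus_box) auto
    moreover have "cbox (Complex ca (-T)) (Complex cb T) \<subseteq> ?S"
      using strip by (auto simp: in_cbox_complex_iff)
    ultimately have img: "path_image ?r \<subseteq> ?S - {p}" using pin by blast
    have "((\<lambda>w. g w / (w - p)) has_contour_integral (2 * pi * \<i> * winding_number ?r p * g p)) ?r"
      using strip img op by (intro Cauchy_integral_formula_convex_simple[OF conv holo]) (auto simp: interior_open)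
    then have "((\<lambda>w. g w / (w - p)) has_contour_integral (2 * pi * \<i> * g p)) ?r"
      using winding_number_rectpath[OF pin] by simp
    then have 1: "(f has_contour_integral (2 * pi * \<i> * g p)) ?r"
    proof (rule has_contour_integral_eq)
      fix x assume "x \<in> path_image ?r"
      then have "x \<in> ?S - {p}" using img by blast
      then show "g x / (x - p) = f x" by (simp add: fg)
    qed
    have cint: "f contour_integrable_on linepath z w" if "closed_segment z w \<subseteq> path_image ?r" for z w
      using f_cont that img by (intro contour_integrable_continuous_linepath) (auto intro: continuous_on_subset)
    have img_eq: "path_image ?r = closed_segment (Complex ca (-T)) (Complex cb (-T)) \<union> closed_segment (Complex cb (-T)) (Complex cb T)
       \<union> closed_segment (Complex cb T) (Complex ca T) \<union> closed_segment (Complex ca T) (Complex ca (-T))"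
      by (simp add: rectpath_def Let_def path_image_join Un_assoc)
    define H1 where "H1 = contour_integral (linepath (Complex ca (-T)) (Complex cb (-T))) f"
    define H2 where "H2 = contour_integral (linepath (Complex cb T) (Complex ca T)) f"
    define V1 where "V1 = contour_integral (linepath (Complex ca T) (Complex ca (-T))) f"
    define V2 where "V2 = contour_integral (linepath (Complex cb (-T)) (Complex cb T)) f"
    have h1: "(f has_contour_integral H1) (linepath (Complex ca (-T)) (Complex cb (-T)))"
     and h2: "(f has_contour_integral H2) (linepath (Complex cb T) (Complex ca T))"
     and v1: "(f has_contour_integral V1) (linepath (Complex ca T) (Complex ca (-T)))"
     and v2: "(f has_contour_integral V2) (linepath (Complex cb (-T)) (Complex cb T))"
      unfolding H1_def H2_def V1_def V2_def
      by (intro has_contour_integral_integral cint; force simp: img_eq)+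
    have "(f has_contour_integral (H1 + (V2 + (H2 + V1)))) ?r"
      unfolding rectpath_def Let_def using h1 h2 v1 v2 by (auto intro!: has_contour_integral_join)
    with 1 have "H1 + (V2 + (H2 + V1)) = 2 * pi * \<i> * g p" by (rule has_contour_integral_unique[rotated])
    moreover have "V1 = - (\<i> * integral {-T..T} (\<lambda>t. f (Complex ca t)))"
      using T0 by (intro contour_integral_vertical[OF v1]) auto
    moreover have "V2 = \<i> * integral {-T..T} (\<lambda>t. f (Complex cb t))"
      unfolding V2_def using T0 by (intro contour_integral_linepath_same_Re) auto
    ultimately have "I T - 2 * of_real pi * \<i> * g p = - (H1 + H2)"
      by (simp add: I_def algebra_simps eq_neg_iff_add_eq_0)
    also have "norm \<dots> \<le> norm H1 + norm H2" unfolding norm_minus_cancel by (rule norm_triangle_ineq)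
    also have "norm H1 \<le> e * norm (Complex cb (-T) - Complex ca (-T))"
    proof (rule has_contour_integral_bound_linepath[OF h1])
      fix x assume "x \<in> closed_segment (Complex ca (-T)) (Complex cb (-T))"
      then have "Im x = - T" "Re x \<in> closed_segment ca cb"
        using closed_segment_same_Im[of "Complex ca (-T)" cb] by auto
      then show "norm (f x) \<le> e" using e strip T0 by (auto simp: closed_segment_eq_real_ivl split: if_splits)
    qed (use e in auto)
    also have "norm H2 \<le> e * norm (Complex ca T - Complex cb T)"
    proof (rule has_contour_integral_bound_linepath[OF h2])
      fix x assume "x \<in> closed_segment (Complex cb T) (Complex ca T)"
      then have "Im x = T" "Re x \<in> closed_segment cb ca"
        using closed_segment_same_Im[of "Complex cb T" ca] by auto
      then show "norm (f x) \<le> e" using e strip T0 by (auto simp: closed_segment_eq_real_ivl split: if_splits)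
    qed (use e in auto)
    also have "norm (Complex cb (-T) - Complex ca (-T)) = cb - ca"
      using strip by (subst cmod_eq_Re) auto
    also have "norm (Complex ca T - Complex cb T) = cb - ca"
      using strip by (subst cmod_eq_Re) auto
    finally show ?thesis by (simp add: algebra_simps)
  qed
  have lim_n: "filterlim (\<lambda>n. real n) at_top sequentially" "filterlim (\<lambda>n. - real n) at_bot sequentially"
    by (auto intro: filterlim_real_sequentially simp: filterlim_uminus_at_top[symmetric])
  have 1: "(\<lambda>n. I (real n)) \<longlonglongrightarrow> \<i> * u2 - \<i> * u1"
    unfolding I_def
    using has_integral_UNIV_tendsto[OF int1 lim_n(2,1)] has_integral_UNIV_tendsto[OF int2 lim_n(2,1)]
    by (intro tendsto_intros)
  have 2: "(\<lambda>n. I (real n)) \<longlonglongrightarrow> 2 * of_real pi * \<i> * g p"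
  proof (rule tendstoI)
    fix e :: real assume e: "e > 0"
    \<comment> \<open>The horizontal sides contribute at most 2 (cb - ca) d; the factor 3 makes the
      bound strict.\<close>
    define c where "c = 3 * (cb - ca)"
    define d where "d = e / c"
    have c: "c > 0" "2 * (cb - ca) < c" using strip by (auto simp: c_def)
    have "d > 0" using e c by (simp add: d_def)
    have "2 * (cb - ca) * d < c * d" using \<open>d > 0\<close> c by (intro mult_strict_right_mono)
    also have "c * d = e" using c by (simp add: d_def)
    finally have d: "d > 0" "2 * (cb - ca) * d < e" using \<open>d > 0\<close> by auto
    obtain T1 where T1: "\<And>z. ca \<le> Re z \<Longrightarrow> Re z \<le> cb \<Longrightarrow> \<bar>Im z\<bar> \<ge> T1 \<Longrightarrow> norm (f z) < d" using decay[OF d(1)] by blast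
    have "eventually (\<lambda>n. real n > max \<bar>Im p\<bar> T1) sequentially"
      using lim_n(1) unfolding filterlim_at_top_dense by blast
    then show "eventually (\<lambda>n. dist (I (real n)) (2 * of_real pi * \<i> * g p) < e) sequentially"
    proof eventually_elim
      case (elim n)
      have "norm (I (real n) - 2 * of_real pi * \<i> * g p) \<le> 2 * (cb - ca) * d"
        using elim d(1) by (intro main less_imp_le[OF T1]) auto
      with d(2) show ?case by (simp add: dist_norm)
    qed
  qed
  from LIMSEQ_unique[OF 1 2] have "\<i> * (u2 - u1) = \<i> * (2 * of_real pi * g p)"
    by (simp add: algebra_simps)
  then show ?thesis by simp
qed

subsection \<open>The G-function as an integral over a vertical line\<close>

lemma vertical_line_has_vector_derivative: "(Complex \<sigma> has_vector_derivative \<i>) (at t)"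
proof -
  have "((\<lambda>t. of_real \<sigma> + \<i> * of_real t) has_vector_derivative \<i>) (at t)"
    by (auto intro!: derivative_eq_intros)
  then show ?thesis by (simp add: Complex_eq[abs_def])
qed

text \<open>The open half planes on the two sides of the line are convex, hence connected.\<close>

lemma mellin_barnes_contour_vertical_line:
  assumes bs: "\<And>\<beta>. \<beta> \<in> set bs \<Longrightarrow> \<sigma> < Re \<beta>" and as: "\<And>\<alpha>. \<alpha> \<in> set as \<Longrightarrow> Re \<alpha> - 1 < \<sigma>"
  shows "mellin_barnes_contour as bs (Complex \<sigma>)"
  unfolding mellin_barnes_contour_def
proof (intro conjI ballI allI)
  show "Complex \<sigma> piecewise_C1_differentiable_on UNIV"
    using vertical_line_has_vector_derivative continuous_on_vector_derivative[OF has_vector_derivative_at_within]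
    unfolding piecewise_C1_differentiable_on_def C1_differentiable_on_def by (metis Diff_empty continuous_on_const finite.emptyI)
  show "inj (Complex \<sigma>)" by (auto simp: inj_def)
  show "filterlim (\<lambda>t. Im (Complex \<sigma> t)) at_bot at_bot" "filterlim (\<lambda>t. Im (Complex \<sigma> t)) at_top at_top"
    by (auto simp: filterlim_ident)
  show "bounded (range (\<lambda>t. Re (Complex \<sigma> t)))" by simp
  show "right_of_contour (Complex \<sigma>) (\<beta> + of_nat j)" if "\<beta> \<in> set bs" for \<beta> j
    unfolding right_of_contour_def
  proof (intro exI allI impI)
    fix q assume q: "Re (\<beta> + of_nat j) \<le> Re q"
    show "connected_component (- range (Complex \<sigma>)) (\<beta> + of_nat j) q"
      using q bs[OF that]
      by (intro connected_componentI[of "{z. Re z > \<sigma>}"] convex_connected convex_halfspace_Re_gt) auto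
  qed
  show "left_of_contour (Complex \<sigma>) (\<alpha> - 1 - of_nat j)" if "\<alpha> \<in> set as" for \<alpha> j
    unfolding left_of_contour_def
  proof (intro exI allI impI)
    fix q assume q: "Re q \<le> Re (\<alpha> - 1 - of_nat j)"
    show "connected_component (- range (Complex \<sigma>)) (\<alpha> - 1 - of_nat j) q"
      using q as[OF that]
      by (intro connected_componentI[of "{z. Re z < \<sigma>}"] convex_connected convex_halfspace_Re_lt) auto
  qed
qed

lemma holomorphic_on_prod_list:
  assumes "\<And>x. x \<in> set xs \<Longrightarrow> f x holomorphic_on A"
  shows "(\<lambda>z. \<Prod>x\<leftarrow>xs. f x z) holomorphic_on A"
  using assms by (induction xs) (auto intro!: holomorphic_intros)

lemma inverse_prod_list: "inverse (\<Prod>x\<leftarrow>xs. f x) = (\<Prod>x\<leftarrow>xs. inverse (f x :: complex))"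
  by (induction xs) auto

text \<open>The denominator is rewritten with the entire function \<open>rGamma\<close>, whose zeros
  agree with the convention x / 0 = 0; only numerator poles remain.\<close>

lemma holomorphic_on_meijerG_integrand:
  assumes "\<And>\<zeta> \<beta>. \<zeta> \<in> A \<Longrightarrow> \<beta> \<in> set bs \<Longrightarrow> \<beta> - \<zeta> \<notin> \<int>\<^sub>\<le>\<^sub>0"
    and "\<And>\<zeta> \<alpha>. \<zeta> \<in> A \<Longrightarrow> \<alpha> \<in> set as \<Longrightarrow> 1 - \<alpha> + \<zeta> \<notin> \<int>\<^sub>\<le>\<^sub>0"
  shows "meijerG_integrand as as' bs bs' l holomorphic_on A"
proof -
  have "meijerG_integrand as as' bs bs' l = (\<lambda>\<zeta>. (\<Prod>\<beta>\<leftarrow>bs. Gamma (\<beta> - \<zeta>)) * (\<Prod>\<alpha>\<leftarrow>as. Gamma (1 - \<alpha> + \<zeta>)) *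
     ((\<Prod>\<beta>\<leftarrow>bs'. rGamma (1 - \<beta> + \<zeta>)) * (\<Prod>\<alpha>\<leftarrow>as'. rGamma (\<alpha> - \<zeta>))) * exp (\<zeta> * l))"
    by (rule ext) (simp add: meijerG_integrand_def rGamma_inverse_Gamma divide_inverse inverse_prod_list)
  then show ?thesis
    using assms by (auto intro!: holomorphic_intros holomorphic_on_prod_list)
qed

lemma finite_nonpos_Ints_translates:
  "finite {\<zeta>. a - \<zeta> \<in> \<int>\<^sub>\<le>\<^sub>0 \<and> Re \<zeta> \<le> K}" "finite {\<zeta>. a + \<zeta> \<in> \<int>\<^sub>\<le>\<^sub>0 \<and> Re \<zeta> \<ge> K}"
proof -
  have fin: "finite {n. real n \<le> c}" for c
    by (rule finite_subset[of _ "{..nat \<lfloor>c\<rfloor>}"]) (auto simp: le_nat_floor)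
  have "{\<zeta>. a - \<zeta> \<in> \<int>\<^sub>\<le>\<^sub>0 \<and> Re \<zeta> \<le> K} \<subseteq> (\<lambda>n. a + of_nat n) ` {n. real n \<le> K - Re a}"
  proof safe
    fix \<zeta> assume "a - \<zeta> \<in> \<int>\<^sub>\<le>\<^sub>0" "Re \<zeta> \<le> K"
    then obtain n where "a - \<zeta> = - of_nat n" by (auto elim: nonpos_Ints_cases')
    then have "\<zeta> = a + of_nat n" by (simp add: algebra_simps)
    with \<open>Re \<zeta> \<le> K\<close> show "\<zeta> \<in> (\<lambda>n. a + of_nat n) ` {n. real n \<le> K - Re a}" by auto
  qed
  then show "finite {\<zeta>. a - \<zeta> \<in> \<int>\<^sub>\<le>\<^sub>0 \<and> Re \<zeta> \<le> K}" by (rule finite_subset) (intro finite_imageI fin)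
  have "{\<zeta>. a + \<zeta> \<in> \<int>\<^sub>\<le>\<^sub>0 \<and> Re \<zeta> \<ge> K} \<subseteq> (\<lambda>n. - of_nat n - a) ` {n. real n \<le> - Re a - K}"
  proof safe
    fix \<zeta> assume "a + \<zeta> \<in> \<int>\<^sub>\<le>\<^sub>0" "Re \<zeta> \<ge> K"
    then obtain n where "a + \<zeta> = - of_nat n" by (auto elim: nonpos_Ints_cases')
    then have "\<zeta> = - of_nat n - a" by (simp add: algebra_simps)
    with \<open>Re \<zeta> \<ge> K\<close> show "\<zeta> \<in> (\<lambda>n. - of_nat n - a) ` {n. real n \<le> - Re a - K}" by auto
  qed
  then show "finite {\<zeta>. a + \<zeta> \<in> \<int>\<^sub>\<le>\<^sub>0 \<and> Re \<zeta> \<ge> K}" by (rule finite_subset) (intro finite_imageI fin)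
qed

text \<open>The negative rate is used twice: it makes the line integral u exist, and it kills the
  horizontal segments when another contour is compared with the line. The common value is \<i> * u,
  and its \<i> cancels against 1 / (2 pi \<i>).\<close>

proposition meijerG_log_eq_vertical_line:
  assumes bs: "\<And>\<beta>. \<beta> \<in> set bs \<Longrightarrow> \<sigma> < Re \<beta>" and as: "\<And>\<alpha>. \<alpha> \<in> set as \<Longrightarrow> Re \<alpha> - 1 < \<sigma>"
    and growth: "strip_growth r (meijerG_integrand as as' bs bs' l)" "r < 0"
  shows "meijerG_log as as' bs bs' l = (LBINT t. meijerG_integrand as as' bs bs' l (Complex \<sigma> t)) / (2 * of_real pi)"
proof -
  define f where "f = meijerG_integrand as as' bs bs' l"
  define PR where "PR = (\<Union>\<beta>\<in>set bs. {\<zeta>. \<beta> - \<zeta> \<in> \<int>\<^sub>\<le>\<^sub>0})"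
  define PL where "PL = (\<Union>\<alpha>\<in>set as. {\<zeta>. (1 - \<alpha>) + \<zeta> \<in> \<int>\<^sub>\<le>\<^sub>0})"
  define u where "u = (LBINT t. f (Complex \<sigma> t))"
  have PR: "\<exists>\<beta>\<in>set bs. \<exists>j::nat. \<zeta> = \<beta> + of_nat j" if \<zeta>: "\<zeta> \<in> PR" for \<zeta>
  proof -
    obtain \<beta> n where "\<beta> \<in> set bs" "\<beta> - \<zeta> = - of_nat n" using \<zeta> by (auto simp: PR_def elim: nonpos_Ints_cases')
    then show ?thesis by (intro bexI[of _ \<beta>] exI[of _ n]) (auto simp: algebra_simps)
  qed
  have PL: "\<exists>\<alpha>\<in>set as. \<exists>j::nat. \<zeta> = \<alpha> - 1 - of_nat j" if \<zeta>: "\<zeta> \<in> PL" for \<zeta>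
  proof -
    obtain \<alpha> n where "\<alpha> \<in> set as" "1 - \<alpha> + \<zeta> = - of_nat n" using \<zeta> by (auto simp: PL_def elim: nonpos_Ints_cases')
    then show ?thesis by (intro bexI[of _ \<alpha>] exI[of _ n]) (auto simp: algebra_simps)
  qed
  have "closed {\<zeta>. a - \<zeta> \<in> \<int>\<^sub>\<le>\<^sub>0}" "closed {\<zeta>. a + \<zeta> \<in> \<int>\<^sub>\<le>\<^sub>0}" for a :: complex
    using continuous_closed_vimage[OF closed_nonpos_Ints, of "\<lambda>\<zeta>. a - \<zeta>"] continuous_closed_vimage[OF closed_nonpos_Ints, of "\<lambda>\<zeta>. a + \<zeta>"]
    by (auto simp: vimage_def intro!: continuous_intros)
  then have op: "open (- (PR \<union> PL))"
    unfolding PR_def PL_def by (intro open_Compl closed_Un closed_UN) auto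
  have holo: "f holomorphic_on - (PR \<union> PL)"
    unfolding f_def by (rule holomorphic_on_meijerG_integrand) (auto simp: PR_def PL_def)
  have line_sub: "Complex \<sigma> t \<in> - (PR \<union> PL)" for t
    using PR[of "Complex \<sigma> t"] PL[of "Complex \<sigma> t"] bs as by (force simp: complex_eq_iff)
  have "continuous_on UNIV (\<lambda>t. f (Complex \<sigma> t))"
    using line_sub holomorphic_on_imp_continuous_on[OF holo]
    by (intro continuous_on_compose2[OF _ _ , of "- (PR \<union> PL)" f UNIV "Complex \<sigma>"])
      (auto simp: Complex_eq[abs_def] intro!: continuous_intros)
  then have "integrable lborel (\<lambda>t. f (Complex \<sigma> t))"
    using growth unfolding f_def by (rule strip_growth_line_integrable[rotated 2])
  then have line: "((\<lambda>t. f (Complex \<sigma> t)) has_integral u) UNIV"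
    unfolding u_def by (rule has_integral_integral_lborel)
  have "(THE v. \<exists>\<gamma>. mellin_barnes_contour as bs \<gamma> \<and> ((\<lambda>t. f (\<gamma> t) * vector_derivative \<gamma> (at t)) has_integral v) UNIV) = \<i> * u"
  proof (rule the_equality)
    have "((\<lambda>t. f (Complex \<sigma> t) * vector_derivative (Complex \<sigma>) (at t)) has_integral (u * \<i>)) UNIV"
      using has_integral_mult_left[OF line, of \<i>]
      by (simp add: vector_derivative_at[OF vertical_line_has_vector_derivative])
    then show "\<exists>\<gamma>. mellin_barnes_contour as bs \<gamma> \<and> ((\<lambda>t. f (\<gamma> t) * vector_derivative \<gamma> (at t)) has_integral (\<i> * u)) UNIV"
      using mellin_barnes_contour_vertical_line[of bs \<sigma> as] bs as by (auto simp: mult.commute)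
  next
    fix v assume "\<exists>\<gamma>. mellin_barnes_contour as bs \<gamma> \<and> ((\<lambda>t. f (\<gamma> t) * vector_derivative \<gamma> (at t)) has_integral v) UNIV"
    then obtain \<gamma> where \<gamma>: "mellin_barnes_contour as bs \<gamma>"
      and int: "((\<lambda>t. f (\<gamma> t) * vector_derivative \<gamma> (at t)) has_integral v) UNIV" by blast
    note \<gamma>' = \<gamma>[unfolded mellin_barnes_contour_def]
    obtain M where M: "\<And>t. \<bar>Re (\<gamma> t)\<bar> \<le> M" using \<gamma>' by (auto simp: bounded_iff)
    show "v = \<i> * u"
    proof (rule contour_integral_eq_vertical_line[of \<gamma> M PR \<sigma> PL f])
      show "right_of_contour \<gamma> p \<and> Re p > \<sigma>" if "p \<in> PR" for p
      proof -
        obtain \<beta> j where p: "\<beta> \<in> set bs" "p = \<beta> + of_nat j" using PR[OF \<open>p \<in> PR\<close>] by blast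
        show ?thesis using \<gamma>' p(1) bs[OF p(1)] unfolding p(2) by auto
      qed
      show "left_of_contour \<gamma> p \<and> Re p < \<sigma>" if "p \<in> PL" for p
      proof -
        obtain \<alpha> j where p: "\<alpha> \<in> set as" "p = \<alpha> - 1 - of_nat j" using PL[OF \<open>p \<in> PL\<close>] by blast
        show ?thesis using \<gamma>' p(1) as[OF p(1)] unfolding p(2) by auto
      qed
      show "finite {p \<in> PR. Re p \<le> K}" for K
      proof -
        have "{p \<in> PR. Re p \<le> K} = (\<Union>\<beta>\<in>set bs. {\<zeta>. \<beta> - \<zeta> \<in> \<int>\<^sub>\<le>\<^sub>0 \<and> Re \<zeta> \<le> K})" by (auto simp: PR_def)
        then show ?thesis using finite_nonpos_Ints_translates(1) by auto
      qed
      show "finite {p \<in> PL. Re p \<ge> K}" for K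
      proof -
        have "{p \<in> PL. Re p \<ge> K} = (\<Union>\<alpha>\<in>set as. {\<zeta>. (1 - \<alpha>) + \<zeta> \<in> \<int>\<^sub>\<le>\<^sub>0 \<and> Re \<zeta> \<ge> K})" by (auto simp: PL_def)
        then show ?thesis using finite_nonpos_Ints_translates(2) by auto
      qed
      show "\<exists>T. \<forall>z. \<bar>Re z\<bar> \<le> K \<longrightarrow> \<bar>Im z\<bar> \<ge> T \<longrightarrow> norm (f z) < e" if "e > 0" for K e
        using strip_growth_tendsto_0[OF growth that, of K] unfolding f_def by metis
    qed (use \<gamma>' M op holo int line in auto)
  qed
  then show ?thesis by (simp add: meijerG_log_def f_def u_def)
qed

subsection \<open>The integrands of the five G-functions\<close>

text \<open>At the poles both sides are 0, since \<open>Gamma\<close> is 0 there.\<close>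

lemma Gamma_duplication:
  "Gamma z * Gamma (z + 1/2) = exp ((1 - 2 * z) * of_real (ln 2)) * of_real (sqrt pi) * Gamma (2 * z :: complex)"
proof (cases "z \<in> \<int>\<^sub>\<le>\<^sub>0 \<or> z + 1/2 \<in> \<int>\<^sub>\<le>\<^sub>0")
  case True
  have "2 * z \<in> \<int>\<^sub>\<le>\<^sub>0"
  proof (cases "z \<in> \<int>\<^sub>\<le>\<^sub>0")
    case True
    then obtain n where "z = - of_nat n" by (auto elim: nonpos_Ints_cases')
    then have "2 * z = - of_nat (2 * n)" by simp
    then show ?thesis by (metis minus_of_nat_in_nonpos_Ints)
  next
    case False
    with True obtain n where "z + 1/2 = - of_nat n" by (auto elim: nonpos_Ints_cases')
    then have "2 * z + 1 = - of_nat (2 * n)" by (simp add: field_simps)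
    then have "2 * z = - of_nat (2 * n + 1)" by (simp add: algebra_simps eq_neg_iff_add_eq_0)
    then show ?thesis by (metis minus_of_nat_in_nonpos_Ints)
  qed
  then have "Gamma (2 * z) = 0" by (simp add: Gamma_eq_zero_iff)
  moreover have "Gamma z = 0 \<or> Gamma (z + 1/2) = 0" using True unfolding Gamma_eq_zero_iff .
  ultimately show ?thesis by auto
qed (use Gamma_legendre_duplication in auto)

text \<open>Duplication at z, at z + 1/4 and at 2 z; the exponents of 2 add up to 5/2 - 8 z.\<close>

lemma Gamma_quadruplication:
  "Gamma z * Gamma (z + 1/4) * Gamma (z + 1/2) * Gamma (z + 3/4) =
     exp ((5/2 - 8 * z) * of_real (ln 2)) * of_real (pi * sqrt pi) * Gamma (4 * z :: complex)"
proof -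
  have "Gamma z * Gamma (z + 1/4) * Gamma (z + 1/2) * Gamma (z + 3/4) =
     (Gamma z * Gamma (z + 1/2)) * (Gamma (z + 1/4) * Gamma (z + 1/4 + 1/2))"
  proof -
    have e: "z + 1/4 + 1/2 = z + 3/4" by simp
    show ?thesis unfolding e by (simp only: mult_ac)
  qed
  also have "\<dots> = exp ((1 - 2 * z) * of_real (ln 2)) * exp ((1 - 2 * (z + 1/4)) * of_real (ln 2)) * of_real (sqrt pi * sqrt pi)
       * (Gamma (2 * z) * Gamma (2 * z + 1/2))"
  proof -
    have e: "2 * (z + 1/4) = 2 * z + 1/2" by simp
    show ?thesis unfolding Gamma_duplication[of z] Gamma_duplication[of "z + 1/4"] e by (simp only: of_real_mult mult_ac)
  qed
  also have "\<dots> = (exp ((1 - 2 * z) * of_real (ln 2)) * exp ((1 - 2 * (z + 1/4)) * of_real (ln 2)) * exp ((1 - 2 * (2 * z)) * of_real (ln 2)))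
        * of_real (pi * sqrt pi) * Gamma (4 * z)"
    unfolding Gamma_duplication by simp
  also have "exp ((1 - 2 * z) * of_real (ln 2)) * exp ((1 - 2 * (z + 1/4)) * of_real (ln 2)) * exp ((1 - 2 * (2 * z)) * of_real (ln 2))
      = exp ((5/2 - 8 * z) * of_real (ln 2))"
    unfolding exp_add [symmetric] by (simp add: algebra_simps)
  finally show ?thesis .
qed

text \<open>Quadruplication at z and z + 1/8, followed by duplication at 4 z.\<close>

lemma Gamma_octuplication:
  "Gamma z * Gamma (z + 1/8) * Gamma (z + 2/8) * Gamma (z + 3/8) * Gamma (z + 4/8) * Gamma (z + 5/8) * Gamma (z + 6/8) * Gamma (z + 7/8) =
     exp ((5 - 24 * z) * of_real (ln 2)) * of_real (pi ^ 3 * sqrt pi) * Gamma (8 * z :: complex)"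
proof -
  have "Gamma z * Gamma (z + 1/8) * Gamma (z + 2/8) * Gamma (z + 3/8) * Gamma (z + 4/8) * Gamma (z + 5/8) * Gamma (z + 6/8) * Gamma (z + 7/8) =
     (Gamma z * Gamma (z + 1/4) * Gamma (z + 1/2) * Gamma (z + 3/4)) *
     (Gamma (z + 1/8) * Gamma (z + 1/8 + 1/4) * Gamma (z + 1/8 + 1/2) * Gamma (z + 1/8 + 3/4))"
  proof -
    have e: "z + 1/8 + 1/4 = z + 3/8" "z + 1/8 + 1/2 = z + 5/8" "z + 1/8 + 3/4 = z + 7/8"
      "z + 1/4 = z + 2/8" "z + 1/2 = z + 4/8" "z + 3/4 = z + 6/8" by simp_all
    show ?thesis unfolding e by (simp only: mult_ac)
  qed
  also have "\<dots> = exp ((5/2 - 8 * z) * of_real (ln 2)) * exp ((5/2 - 8 * (z + 1/8)) * of_real (ln 2)) * of_real (pi * sqrt pi * (pi * sqrt pi))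
       * (Gamma (4 * z) * Gamma (4 * z + 1/2))"
  proof -
    have e: "4 * (z + 1/8) = 4 * z + 1/2" by simp
    show ?thesis unfolding Gamma_quadruplication e by (simp only: of_real_mult mult_ac)
  qed
  also have "pi * sqrt pi * (pi * sqrt pi) = pi ^ 3" by (simp add: power3_eq_cube mult.left_commute)
  also have "exp ((5/2 - 8 * z) * of_real (ln 2)) * exp ((5/2 - 8 * (z + 1/8)) * of_real (ln 2)) * of_real (pi ^ 3) * (Gamma (4 * z) * Gamma (4 * z + 1/2)) =
     (exp ((5/2 - 8 * z) * of_real (ln 2)) * exp ((5/2 - 8 * (z + 1/8)) * of_real (ln 2)) * exp ((1 - 2 * (4 * z)) * of_real (ln 2)))
        * of_real (pi ^ 3 * sqrt pi) * Gamma (8 * z)"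
    unfolding Gamma_duplication by simp
  also have "exp ((5/2 - 8 * z) * of_real (ln 2)) * exp ((5/2 - 8 * (z + 1/8)) * of_real (ln 2)) * exp ((1 - 2 * (4 * z)) * of_real (ln 2))
      = exp ((5 - 24 * z) * of_real (ln 2))"
    unfolding exp_add [symmetric] by (simp add: algebra_simps)
  finally show ?thesis .
qed

text \<open>Reflection at 1/2 + z produces the cosine, and duplication at - z merges the two Gamma
  functions. At the excluded points the zero of the cosine meets a pole of Gamma(- 2 z): the right
  side evaluates to 0 there, but the left side does not vanish.\<close>

lemma Gamma_quotient_cos:
  assumes "1/2 - z \<notin> \<int>\<^sub>\<le>\<^sub>0"
  shows "Gamma (- z) / Gamma (1/2 + z) =
    exp ((1 + 2 * z) * of_real (ln 2)) / of_real (sqrt pi) * Gamma (- 2 * z) * cos (of_real pi * z :: complex)"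
proof -
  have "Gamma (1/2 + z) * Gamma (1 - (1/2 + z)) = of_real pi / sin (of_real pi * (1/2 + z))"
    by (rule Gamma_reflection_complex)
  also have "sin (of_real pi * (1/2 + z)) = cos (of_real pi * z)"
    by (simp add: ring_distribs sin_add)
  finally have refl: "Gamma (1/2 + z) * Gamma (1/2 - z) = of_real pi / cos (of_real pi * z)"
    by (simp add: algebra_simps)
  have "Gamma (1/2 - z) \<noteq> 0" using assms by (simp add: Gamma_eq_zero_iff)
  moreover have "1 / A = B * c / of_real pi" if "A * B = of_real pi / c" "B \<noteq> 0" for A B c :: complex
  proof (cases "c = 0")
    case False
    \<comment> \<open>The remaining case c = 0 reads \<open>A * B = 0\<close>, so A = 0 and both
      sides are 0: these are the poles of Gamma(1/2 + z).\<close>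
    with that have "A \<noteq> 0" by auto
    with that False show ?thesis by (simp add: field_simps)
  qed (use that in auto)
  ultimately have "1 / Gamma (1/2 + z) = Gamma (1/2 - z) * cos (of_real pi * z) / of_real pi"
    using refl by blast
  then have "Gamma (- z) / Gamma (1/2 + z) = Gamma (- z) * Gamma (- z + 1/2) * cos (of_real pi * z) / of_real pi"
    by (metis (no_types, lifting) add.commute mult.assoc mult.right_neutral times_divide_eq_right uminus_add_conv_diff)
  also have "\<dots> = exp ((1 + 2 * z) * of_real (ln 2)) * of_real (sqrt pi / pi) * Gamma (- 2 * z) * cos (of_real pi * z)"
    unfolding Gamma_duplication by simp
  also have "sqrt pi / pi = 1 / sqrt pi" by (simp add: real_div_sqrt divide_simps)
  finally show ?thesis by simp
qed

text \<open>Every Gamma argument involves only the difference of a parameter and \<zeta>, so a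
  common translation is felt by the exponential alone.\<close>

lemma meijerG_integrand_shift:
  "meijerG_integrand (map (\<lambda>a. a + d) as) (map (\<lambda>a. a + d) as') (map (\<lambda>b. b + d) bs) (map (\<lambda>b. b + d) bs') l (\<zeta> + d) =
     exp (d * l) * meijerG_integrand as as' bs bs' l \<zeta>"
  unfolding meijerG_integrand_def by (simp add: o_def algebra_simps exp_add)

lemma meijerG_log_shift:
  assumes "\<And>\<beta>. \<beta> \<in> set bs \<Longrightarrow> \<sigma> < Re \<beta>" "\<And>\<alpha>. \<alpha> \<in> set as \<Longrightarrow> Re \<alpha> - 1 < \<sigma>"
    and growth: "strip_growth r (meijerG_integrand as as' bs bs' l)" "r < 0"
  shows "meijerG_log (map (\<lambda>a. a + of_real d) as) (map (\<lambda>a. a + of_real d) as')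
      (map (\<lambda>b. b + of_real d) bs) (map (\<lambda>b. b + of_real d) bs') l =
    exp (of_real d * l) * meijerG_log as as' bs bs' l"
proof -
  let ?f = "meijerG_integrand as as' bs bs' l"
  let ?g = "meijerG_integrand (map (\<lambda>a. a + of_real d) as) (map (\<lambda>a. a + of_real d) as')
      (map (\<lambda>b. b + of_real d) bs) (map (\<lambda>b. b + of_real d) bs') l"
  have g: "?g \<zeta> = exp (of_real d * l) * ?f (of_real 1 * \<zeta> + of_real (- d))" for \<zeta>
    using meijerG_integrand_shift[of "of_real d" as as' bs bs' l "\<zeta> - of_real d"] by simp
  have "strip_growth (0 + r * \<bar>1\<bar>) ?g"
    unfolding g[abs_def] by (intro strip_growth_mult strip_growth_const strip_growth_affine growth) auto
  then have "meijerG_log (map (\<lambda>a. a + of_real d) as) (map (\<lambda>a. a + of_real d) as')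
      (map (\<lambda>b. b + of_real d) bs) (map (\<lambda>b. b + of_real d) bs') l = (LBINT t. ?g (Complex (\<sigma> + d) t)) / (2 * of_real pi)"
    using assms by (intro meijerG_log_eq_vertical_line[where r = r]) auto
  also have "(\<lambda>t. ?g (Complex (\<sigma> + d) t)) = (\<lambda>t. exp (of_real d * l) * ?f (Complex \<sigma> t))"
  proof
    fix t
    have "of_real 1 * Complex (\<sigma> + d) t + of_real (- d) = Complex \<sigma> t" by (simp add: complex_eq_iff)
    then show "?g (Complex (\<sigma> + d) t) = exp (of_real d * l) * ?f (Complex \<sigma> t)" unfolding g by (simp only:)
  qed
  also have "(LBINT t. exp (of_real d * l) * ?f (Complex \<sigma> t)) / (2 * of_real pi) = exp (of_real d * l) * ((LBINT t. ?f (Complex \<sigma> t)) / (2 * of_real pi))"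
    by simp
  also have "(LBINT t. ?f (Complex \<sigma> t)) / (2 * of_real pi) = meijerG_log as as' bs bs' l"
    using assms by (intro meijerG_log_eq_vertical_line[symmetric]) auto
  finally show ?thesis .
qed

text \<open>Averaging the Cahen-Mellin integrands for p = \<i> y and p = - \<i> y gives Gamma(z)
  y^(-z) cos(pi z / 2), and the Laplace transform contributes Gamma(2 v - 2 z) w^(2 z - 2 v). The
  kernel is the product with z replaced by - 2 z, which matches the variable of the G-functions.
  Powers are written as exponentials so that exponents can be added.\<close>

definition cos_Laplace_kernel :: "complex \<Rightarrow> real \<Rightarrow> complex \<Rightarrow> complex \<Rightarrow> complex" where
  "cos_Laplace_kernel v y w z = Gamma (- 2 * z) * exp (2 * z * of_real (ln y)) * cos (of_real pi * z) *
     (Gamma (2 * v + 4 * z) * exp (- (2 * v + 4 * z) * Ln w))"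

lemma strip_growth_cos_Laplace_kernel:
  assumes w: "Re w > 0"
  shows "\<exists>r<0. strip_growth r (cos_Laplace_kernel v y w)"
proof -
  define \<phi> where "\<phi> = \<bar>Im (Ln w)\<bar>"
  have "w \<noteq> 0" using w by auto
  then have \<phi>: "0 \<le> \<phi>" "\<phi> < pi / 2" using w Re_Ln_pos_lt[of w] by (auto simp: \<phi>_def)
  \<comment> \<open>The total rate is - 6 \<theta> + pi + 4 \<phi>. Its zero (pi + 4 \<phi>) / 6
    lies below pi / 2 because \<phi> < pi / 2; \<theta> is the midpoint of these two values.\<close>
  define \<theta> where "\<theta> = (pi + 4 * \<phi>) / 12 + pi / 4"
  have \<theta>: "0 \<le> \<theta>" "\<theta> < pi / 2" "pi + 4 * \<phi> < 6 * \<theta>" using \<phi> by (auto simp: \<theta>_def field_simps)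
  define r where "r = - \<theta> * \<bar>- 2\<bar> + \<bar>Im (of_real (2 * ln y))\<bar> + 1 * \<bar>pi\<bar> + (- \<theta> * \<bar>4\<bar> + \<bar>Im (- Ln w)\<bar> * \<bar>4\<bar>)"
  have "strip_growth r (\<lambda>z. Gamma (of_real (- 2) * z + 0) * exp (z * of_real (2 * ln y)) * cos (of_real pi * z + 0) *
     (Gamma (of_real 4 * z + 2 * v) * exp ((of_real 4 * z + 2 * v) * - Ln w)))"
    unfolding r_def using \<theta>
    by (intro strip_growth_mult strip_growth_exp strip_growth_affine[where f = "\<lambda>z. exp (z * - Ln w)"]
        strip_growth_affine[where f = Gamma] strip_growth_affine[where f = cos] strip_growth_cos strip_growth_Gamma) auto
  moreover have "(\<lambda>z. Gamma (of_real (- 2) * z + 0) * exp (z * of_real (2 * ln y)) * cos (of_real pi * z + 0) *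
     (Gamma (of_real 4 * z + 2 * v) * exp ((of_real 4 * z + 2 * v) * - Ln w))) = cos_Laplace_kernel v y w"
    by (rule ext) (simp add: cos_Laplace_kernel_def algebra_simps)
  moreover have "r < 0" using \<theta>(3) by (simp add: r_def \<phi>_def)
  ultimately show ?thesis by auto
qed

section \<open>The integrands for the concrete parameter lists\<close>

context
  fixes v w :: complex and y :: real
  assumes v: "Re v > 0" and w: "Re w > 0" and y: "y > 0"
begin

abbreviation (input) "l4 \<equiv> log_quot_power (64 * y ^ 2) w 4"
abbreviation (input) "l8 \<equiv> log_quot_power (4 ^ 8 * y ^ 4) w 8"
abbreviation (input) "as4 \<equiv> [(4 - 2 * v) / 4, (3 - 2 * v) / 4, (2 - 2 * v) / 4, (1 - 2 * v) / 4]"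
abbreviation (input) "as8 \<equiv> [(8 - 2 * v) / 8, (7 - 2 * v) / 8, (6 - 2 * v) / 8, (5 - 2 * v) / 8,
          (4 - 2 * v) / 8, (3 - 2 * v) / 8, (2 - 2 * v) / 8, (1 - 2 * v) / 8]"

lemma l4: "l4 = of_real (6 * ln 2 + 2 * ln y) - 4 * Ln w"
proof -
  have "ln (64 * y ^ 2) = ln (2 ^ 6) + 2 * ln y" using y by (simp add: ln_mult ln_realpow)
  then show ?thesis unfolding log_quot_power_def by (subst (asm) ln_realpow) auto
qed

lemma l8: "l8 = of_real (16 * ln 2 + 4 * ln y) - 8 * Ln w"
proof -
  have "ln (4 ^ 8 * y ^ 4) = ln (4 ^ 8) + ln (y ^ 4)" using y by (intro ln_mult_pos) auto
  also have "(4::real) ^ 8 = 2 ^ 16" by simp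
  finally have "ln (4 ^ 8 * y ^ 4) = 16 * ln 2 + 4 * ln y" using y by (simp only: ln_realpow) (simp add: ln_realpow)
  then show ?thesis unfolding log_quot_power_def by simp
qed

lemma meijerG_integrand_4:
  "meijerG_integrand as4 [] [0] [1 / 2] l4 \<zeta> = Gamma (- \<zeta>) / Gamma (1/2 + \<zeta>) *
     (exp ((5/2 - 4 * v - 8 * \<zeta>) * of_real (ln 2)) * of_real (pi * sqrt pi) * Gamma (2 * v + 4 * \<zeta>)) * exp (\<zeta> * l4)"
proof -
  have "meijerG_integrand as4 [] [0] [1 / 2] l4 \<zeta> = Gamma (- \<zeta>) / Gamma (1/2 + \<zeta>) *
      (Gamma (v / 2 + \<zeta>) * Gamma (v / 2 + \<zeta> + 1/4) * Gamma (v / 2 + \<zeta> + 1/2) * Gamma (v / 2 + \<zeta> + 3/4)) * exp (\<zeta> * l4)"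
    unfolding meijerG_integrand_def by (simp add: diff_divide_distrib algebra_simps)
  then show ?thesis unfolding Gamma_quadruplication by (simp add: algebra_simps)
qed

text \<open>The \<zeta>-dependent powers of 2 are 2^(2 \<zeta>) from the quotient, 2^(- 8 \<zeta>)
  from quadruplication and 64^\<zeta>; they cancel, leaving 2^(7/2 - 4 v).\<close>

lemma meijerG_integrand_4_eq_kernel:
  assumes "1/2 - \<zeta> \<notin> \<int>\<^sub>\<le>\<^sub>0"
  shows "meijerG_integrand as4 [] [0] [1 / 2] l4 \<zeta> =
    of_real pi * exp ((7/2 - 4 * v) * of_real (ln 2)) * exp (2 * v * Ln w) * cos_Laplace_kernel v y w \<zeta>"
proof -
  have "meijerG_integrand as4 [] [0] [1 / 2] l4 \<zeta> = of_real (pi * sqrt pi) / of_real (sqrt pi) *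
     (exp ((1 + 2 * \<zeta>) * of_real (ln 2)) * exp ((5/2 - 4 * v - 8 * \<zeta>) * of_real (ln 2)) * exp (\<zeta> * l4))
     * Gamma (- 2 * \<zeta>) * cos (of_real pi * \<zeta>) * Gamma (2 * v + 4 * \<zeta>)"
    unfolding meijerG_integrand_4 Gamma_quotient_cos[OF assms] by simp
  also have "of_real (pi * sqrt pi) / of_real (sqrt pi) = complex_of_real pi" by simp
  also have "exp ((1 + 2 * \<zeta>) * of_real (ln 2)) * exp ((5/2 - 4 * v - 8 * \<zeta>) * of_real (ln 2)) * exp (\<zeta> * l4) =
     exp ((7/2 - 4 * v) * of_real (ln 2)) * exp (2 * v * Ln w) * (exp (2 * \<zeta> * of_real (ln y)) * exp (- (2 * v + 4 * \<zeta>) * Ln w))"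
    unfolding exp_add [symmetric] l4 by (intro arg_cong[of _ _ exp]) (simp add: algebra_simps)
  finally show ?thesis by (simp add: cos_Laplace_kernel_def)
qed

lemma strip_growth_meijerG_integrand_4:
  "\<exists>r<0. strip_growth r (meijerG_integrand as4 [] [0] [1 / 2] l4)"
proof -
  obtain r where r: "r < 0" "strip_growth r (cos_Laplace_kernel v y w)"
    using strip_growth_cos_Laplace_kernel[OF w] by blast
  have "1/2 - z \<notin> \<int>\<^sub>\<le>\<^sub>0" if "Im z \<noteq> 0" for z
    using that by (auto simp: nonpos_Ints_def complex_eq_iff)
  note eq = meijerG_integrand_4_eq_kernel[OF this]
  have "strip_growth (0 + r) (\<lambda>\<zeta>. of_real pi * exp ((7/2 - 4 * v) * of_real (ln 2)) * exp (2 * v * Ln w) * cos_Laplace_kernel v y w \<zeta>)"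
    by (intro strip_growth_mult strip_growth_const r)
  then have "strip_growth (0 + r) (meijerG_integrand as4 [] [0] [1 / 2] l4)"
    by (rule strip_growth_cong) (rule eq[symmetric])
  with r show ?thesis by auto
qed

text \<open>With Re v > 0 this leaves room for a separating line: abscissae between - Re v / 2 and 0
  for \<open>as4\<close>, between - Re v / 4 and 0 for \<open>as8\<close>.\<close>

lemma Re_parameters:
  "\<alpha> \<in> set as4 \<Longrightarrow> Re \<alpha> - 1 \<le> - Re v / 2" "\<alpha> \<in> set as8 \<Longrightarrow> Re \<alpha> - 1 \<le> - Re v / 4"
  "\<beta> \<in> set [0, 1 / 2] \<Longrightarrow> 0 \<le> Re \<beta>"
proof -
  have "\<forall>\<alpha>\<in>set as4. Re \<alpha> - 1 \<le> - Re v / 2" "\<forall>\<alpha>\<in>set as8. Re \<alpha> - 1 \<le> - Re v / 4" "\<forall>\<beta>\<in>set [0, 1 / 2 :: complex]. 0 \<le> Re \<beta>"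
    by (simp_all add: field_simps)
  then show "\<alpha> \<in> set as4 \<Longrightarrow> Re \<alpha> - 1 \<le> - Re v / 2" "\<alpha> \<in> set as8 \<Longrightarrow> Re \<alpha> - 1 \<le> - Re v / 4"
    "\<beta> \<in> set [0, 1 / 2] \<Longrightarrow> 0 \<le> Re \<beta>" by blast+
qed

lemma meijerG_log_4_eq:
  assumes \<sigma>: "- Re v / 2 < \<sigma>" "\<sigma> < 0"
  shows "meijerG_log as4 [] [0] [1 / 2] l4 =
     exp ((5/2 - 4 * v) * of_real (ln 2)) * exp (2 * v * Ln w) * (LBINT t. cos_Laplace_kernel v y w (Complex \<sigma> t))"
proof -
  obtain r where r: "r < 0" "strip_growth r (meijerG_integrand as4 [] [0] [1 / 2] l4)"
    using strip_growth_meijerG_integrand_4 by blast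
  have "meijerG_log as4 [] [0] [1 / 2] l4 = (LBINT t. meijerG_integrand as4 [] [0] [1 / 2] l4 (Complex \<sigma> t)) / (2 * of_real pi)"
    using r \<sigma> v by (intro meijerG_log_eq_vertical_line le_less_trans[OF Re_parameters(1)]) auto
  also have "(\<lambda>t. meijerG_integrand as4 [] [0] [1 / 2] l4 (Complex \<sigma> t)) =
     (\<lambda>t. (of_real pi * exp ((7/2 - 4 * v) * of_real (ln 2)) * exp (2 * v * Ln w)) * cos_Laplace_kernel v y w (Complex \<sigma> t))"
    using \<sigma> by (intro ext meijerG_integrand_4_eq_kernel) (auto simp: nonpos_Ints_def complex_eq_iff)
  also have "(LBINT t. (of_real pi * exp ((7/2 - 4 * v) * of_real (ln 2)) * exp (2 * v * Ln w)) * cos_Laplace_kernel v y w (Complex \<sigma> t)) =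
      (of_real pi * exp ((7/2 - 4 * v) * of_real (ln 2)) * exp (2 * v * Ln w)) * (LBINT t. cos_Laplace_kernel v y w (Complex \<sigma> t))"
    by (rule integral_mult_right_zero)
  also have "exp ((7/2 - 4 * v) * of_real (ln 2)) = 2 * exp ((5/2 - 4 * v) * of_real (ln 2))"
  proof -
    have "(7/2 - 4 * v) * of_real (ln 2) = of_real (ln 2) + (5/2 - 4 * v) * of_real (ln 2)" by (simp add: algebra_simps)
    then show ?thesis by (simp only: exp_add exp_of_real) simp
  qed
  finally show ?thesis by simp
qed

lemma meijerG_log_4_shift:
  "meijerG_log (map (\<lambda>a. a + of_real d) as4) [] [of_real d] [1 / 2 + of_real d] l4 =
     exp (of_real d * l4) * meijerG_log as4 [] [0] [1 / 2] l4"
proof -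
  obtain r where r: "r < 0" "strip_growth r (meijerG_integrand as4 [] [0] [1 / 2] l4)"
    using strip_growth_meijerG_integrand_4 by blast
  have "meijerG_log (map (\<lambda>a. a + of_real d) as4) (map (\<lambda>a. a + of_real d) []) (map (\<lambda>b. b + of_real d) [0]) (map (\<lambda>b. b + of_real d) [1 / 2]) l4 =
     exp (of_real d * l4) * meijerG_log as4 [] [0] [1 / 2] l4"
    using v r by (intro meijerG_log_shift[where r = r and \<sigma> = "- Re v / 4"] le_less_trans[OF Re_parameters(1)]) auto
  then show ?thesis by simp
qed

text \<open>Duplication collapses the two numerator factors at - \<zeta> and the two denominator
  factors at 1/4 + \<zeta>, octuplication the eight at v / 4 + \<zeta>. The logarithms fit because
  l8 = 2 l4 + 4 ln 2. All the multiplication formulas hold at the poles too, so no \<zeta> is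
  excluded.\<close>

lemma meijerG_integrand_8:
  "meijerG_integrand as8 [] [0, 1 / 2] [1 / 4, 3 / 4] l8 \<zeta> =
     of_real (pi ^ 2) * exp ((3 - 2 * v) * of_real (ln 2)) * meijerG_integrand as4 [] [0] [1 / 2] l4 (2 * \<zeta>)"
proof -
  have "meijerG_integrand as8 [] [0, 1 / 2] [1 / 4, 3 / 4] l8 \<zeta> =
    (Gamma (- \<zeta>) * Gamma (- \<zeta> + 1/2)) / (Gamma (1/4 + \<zeta>) * Gamma (1/4 + \<zeta> + 1/2)) *
    (Gamma (v / 4 + \<zeta>) * Gamma (v / 4 + \<zeta> + 1/8) * Gamma (v / 4 + \<zeta> + 2/8) * Gamma (v / 4 + \<zeta> + 3/8) *
     Gamma (v / 4 + \<zeta> + 4/8) * Gamma (v / 4 + \<zeta> + 5/8) * Gamma (v / 4 + \<zeta> + 6/8) * Gamma (v / 4 + \<zeta> + 7/8)) * exp (\<zeta> * l8)"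
    unfolding meijerG_integrand_def by (simp add: diff_divide_distrib algebra_simps)
  also have "\<dots> = exp ((1 + 2 * \<zeta>) * of_real (ln 2)) / exp ((1/2 - 2 * \<zeta>) * of_real (ln 2)) * (Gamma (- 2 * \<zeta>) / Gamma (1/2 + 2 * \<zeta>)) *
    (exp ((5 - 24 * (v / 4 + \<zeta>)) * of_real (ln 2)) * of_real (pi ^ 3 * sqrt pi) * Gamma (2 * v + 8 * \<zeta>)) * exp (\<zeta> * l8)"
    unfolding Gamma_octuplication Gamma_duplication by (simp add: algebra_simps)
  also have "\<dots> = of_real (pi ^ 3 * sqrt pi) * (exp ((1 + 2 * \<zeta>) * of_real (ln 2)) / exp ((1/2 - 2 * \<zeta>) * of_real (ln 2)) *
      exp ((5 - 24 * (v / 4 + \<zeta>)) * of_real (ln 2)) * exp (\<zeta> * l8)) * (Gamma (- 2 * \<zeta>) / Gamma (1/2 + 2 * \<zeta>) * Gamma (2 * v + 8 * \<zeta>))"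
    by simp
  also have "exp ((1 + 2 * \<zeta>) * of_real (ln 2)) / exp ((1/2 - 2 * \<zeta>) * of_real (ln 2)) *
      exp ((5 - 24 * (v / 4 + \<zeta>)) * of_real (ln 2)) * exp (\<zeta> * l8) =
      exp ((3 - 2 * v) * of_real (ln 2)) * exp ((5/2 - 4 * v - 8 * (2 * \<zeta>)) * of_real (ln 2)) * exp (2 * \<zeta> * l4)"
    unfolding exp_add [symmetric] exp_diff [symmetric] l4 l8 by (intro arg_cong[of _ _ exp]) (simp add: algebra_simps)
  also have "pi ^ 3 * sqrt pi = pi ^ 2 * (pi * sqrt pi)" by (simp add: power3_eq_cube power2_eq_square)
  finally show ?thesis unfolding meijerG_integrand_4 by simp
qed

text \<open>The line at \<sigma> / 2 is mapped by doubling to the line at \<sigma>; the Jacobian 1/2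
  lowers the exponent of 2 from 3 - 2 v to 2 - 2 v.\<close>

lemma meijerG_log_8:
  "meijerG_log as8 [] [0, 1 / 2] [1 / 4, 3 / 4] l8 =
     of_real (pi ^ 2) * exp ((2 - 2 * v) * of_real (ln 2)) * meijerG_log as4 [] [0] [1 / 2] l4"
proof -
  define f where "f = meijerG_integrand as4 [] [0] [1 / 2] l4"
  define \<sigma> where "\<sigma> = - Re v / 4"
  define c where "c = of_real (pi ^ 2) * exp ((3 - 2 * v) * of_real (ln 2))"
  obtain r where r: "r < 0" "strip_growth r f"
    using strip_growth_meijerG_integrand_4 unfolding f_def by blast
  have eq: "meijerG_integrand as8 [] [0, 1 / 2] [1 / 4, 3 / 4] l8 = (\<lambda>\<zeta>. c * f (of_real 2 * \<zeta> + 0))"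
    unfolding meijerG_integrand_8[abs_def] f_def c_def by simp
  have "strip_growth (0 + r * \<bar>2\<bar>) (meijerG_integrand as8 [] [0, 1 / 2] [1 / 4, 3 / 4] l8)"
    unfolding eq by (intro strip_growth_mult strip_growth_const strip_growth_affine r) auto
  then have "meijerG_log as8 [] [0, 1 / 2] [1 / 4, 3 / 4] l8 =
      (LBINT t. meijerG_integrand as8 [] [0, 1 / 2] [1 / 4, 3 / 4] l8 (Complex (\<sigma> / 2) t)) / (2 * of_real pi)"
    using v r by (intro meijerG_log_eq_vertical_line[where r = "0 + r * \<bar>2\<bar>"] le_less_trans[OF Re_parameters(2)] less_le_trans[OF _ Re_parameters(3)]) (auto simp: \<sigma>_def)
  also have "(\<lambda>t. meijerG_integrand as8 [] [0, 1 / 2] [1 / 4, 3 / 4] l8 (Complex (\<sigma> / 2) t)) = (\<lambda>t. c * f (Complex \<sigma> (0 + 2 * t)))"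
  proof
    fix t
    have "of_real 2 * Complex (\<sigma> / 2) t + 0 = Complex \<sigma> (0 + 2 * t)" by (simp add: complex_eq_iff)
    then show "meijerG_integrand as8 [] [0, 1 / 2] [1 / 4, 3 / 4] l8 (Complex (\<sigma> / 2) t) = c * f (Complex \<sigma> (0 + 2 * t))"
      unfolding eq by (simp only:)
  qed
  also have "(LBINT t. c * f (Complex \<sigma> (0 + 2 * t))) = c * (LBINT t. f (Complex \<sigma> (0 + 2 * t)))" by (rule integral_mult_right_zero)
  also have "(LBINT t. f (Complex \<sigma> (0 + 2 * t))) = (LBINT t. f (Complex \<sigma> t)) / 2"
    using lborel_integral_real_affine[of 2 "\<lambda>t. f (Complex \<sigma> t)" 0] by (simp add: scaleR_conv_of_real)
  also have "c * ((LBINT t. f (Complex \<sigma> t)) / 2) / (2 * of_real pi) = c / 2 * ((LBINT t. f (Complex \<sigma> t)) / (2 * of_real pi))" by simp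
  also have "(LBINT t. f (Complex \<sigma> t)) / (2 * of_real pi) = meijerG_log as4 [] [0] [1 / 2] l4"
    unfolding f_def using v r unfolding f_def by (intro meijerG_log_eq_vertical_line[symmetric] le_less_trans[OF Re_parameters(1)]) (auto simp: \<sigma>_def)
  also have "c / 2 = of_real (pi ^ 2) * exp ((2 - 2 * v) * of_real (ln 2))"
  proof -
    have "(3 - 2 * v) * of_real (ln 2) = of_real (ln 2) + (2 - 2 * v) * of_real (ln 2)" by (simp add: algebra_simps)
    then show ?thesis unfolding c_def by (simp only: exp_add exp_of_real) simp
  qed
  finally show ?thesis .
qed

end

subsection \<open>The Cahen-Mellin integral\<close>

lemma continuous_on_Complex_line: "continuous_on S (Complex c)"
  unfolding Complex_eq[abs_def] by (intro continuous_intros)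

text \<open>A rate for Gamma halfway between |Im l| and pi / 2 still beats the exponential.\<close>

lemma strip_growth_Gamma_exp:
  assumes "\<bar>Im l\<bar> < pi / 2"
  shows "\<exists>r<0. strip_growth r (\<lambda>z. Gamma z * exp (z * l))"
proof -
  define \<theta> where "\<theta> = (\<bar>Im l\<bar> + pi / 2) / 2"
  have "strip_growth (- \<theta> + \<bar>Im l\<bar>) (\<lambda>z. Gamma z * exp (z * l))"
    using assms by (intro strip_growth_mult strip_growth_Gamma strip_growth_exp) (auto simp: \<theta>_def)
  moreover have "- \<theta> + \<bar>Im l\<bar> < 0" using assms by (simp add: \<theta>_def)
  ultimately show ?thesis by blast
qed

lemma not_nonpos_Ints_between:
  assumes "- real n - 1 < Re z" "Re z < - real n" shows "z \<notin> \<int>\<^sub>\<le>\<^sub>0"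
proof
  assume "z \<in> \<int>\<^sub>\<le>\<^sub>0"
  then obtain m where "z = - of_nat m" by (auto elim: nonpos_Ints_cases')
  with assms show False by simp
qed

section \<open>Moving the line of integration past the poles of Gamma\<close>

context
  fixes u :: complex and c :: real
  assumes u: "Re u > 0" and c: "0 < c" "c < 1"
begin

lemma Im_Ln_bound: "\<bar>Im (Ln u)\<bar> < pi / 2"
proof -
  have "u \<noteq> 0" using u by auto
  then show ?thesis using u Re_Ln_pos_lt by blast
qed

lemma continuous_on_Gamma_line:
  assumes "\<And>t. Complex x t \<notin> \<int>\<^sub>\<le>\<^sub>0"
  shows "continuous_on UNIV (\<lambda>t. Gamma (Complex x t) * exp (Complex x t * l))"
  by (intro continuous_intros continuous_on_compose2[OF continuous_on_Gamma[of "- \<int>\<^sub>\<le>\<^sub>0"]] continuous_on_Complex_line)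
    (use assms in auto)

lemma integrable_Gamma_exp_line:
  "integrable lborel (\<lambda>t. Gamma (Complex (c - real n) t) * exp (Complex (c - real n) t * - Ln u))"
proof -
  obtain r where r: "r < 0" "strip_growth r (\<lambda>z. Gamma z * exp (z * - Ln u))"
    using strip_growth_Gamma_exp[of "- Ln u"] Im_Ln_bound by auto
  have "Complex (c - real n) t \<notin> \<int>\<^sub>\<le>\<^sub>0" for t
  proof (cases n)
    case 0
    then show ?thesis using c by (auto simp: nonpos_Ints_def complex_eq_iff)
  next
    case (Suc m)
    then show ?thesis using c by (intro not_nonpos_Ints_between[of m]) auto
  qed
  from continuous_on_Gamma_line[OF this] show ?thesis
    by (rule strip_growth_line_integrable[OF r(2,1)])
qed

text \<open>The two lines enclose just the pole - n, where Gamma has residue (-1)^n / n!.\<close>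

lemma Gamma_line_shift:
  "(LBINT t. Gamma (Complex (c - real n) t) * exp (Complex (c - real n) t * - Ln u)) -
   (LBINT t. Gamma (Complex (c - real (Suc n)) t) * exp (Complex (c - real (Suc n)) t * - Ln u)) =
     2 * of_real pi * ((- u) ^ n / fact n)"
proof -
  define f where "f z = Gamma z * exp (z * - Ln u)" for z
  \<comment> \<open>By the functional equation this is (z + n) times the integrand, in a form that
    is holomorphic at - n.\<close>
  define g where "g z = Gamma (z + of_nat (Suc n)) / pochhammer z n * exp (z * - Ln u)" for z
  obtain r where r: "r < 0" "strip_growth r f"
    using strip_growth_Gamma_exp[of "- Ln u"] Im_Ln_bound unfolding f_def by auto
  have int: "((\<lambda>t. f (Complex (c - real k) t)) has_integral (LBINT t. f (Complex (c - real k) t))) UNIV" for k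
    unfolding f_def by (intro has_integral_integral_lborel integrable_Gamma_exp_line)
  have poch_nz: "pochhammer z n \<noteq> 0" if "Re z < - real n + 1" for z
  proof -
    have "z + of_nat k \<noteq> 0" if "k < n" for k
    proof
      assume "z + of_nat k = 0"
      then have "Re (z + of_nat k) = Re 0" by (rule arg_cong)
      with \<open>Re z < - real n + 1\<close> \<open>k < n\<close> show False by simp
    qed
    then show ?thesis by (simp add: pochhammer_prod)
  qed
  have fg: "f z = g z / (z - - of_nat n)" if z: "- real n - 1 < Re z" "Re z < - real n + 1" "z \<noteq> - of_nat n" for z
  proof -
    have nz: "z \<notin> \<int>\<^sub>\<le>\<^sub>0"
    proof
      assume "z \<in> \<int>\<^sub>\<le>\<^sub>0"
      then obtain m where m: "z = - of_nat m" by (auto elim: nonpos_Ints_cases')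
      with z have "m = n" by auto
      with m z(3) show False by simp
    qed
    have "Gamma (z + of_nat (Suc n)) = pochhammer z (Suc n) * Gamma z"
      using nz by (simp add: pochhammer_Gamma Gamma_eq_zero_iff del: of_nat_Suc)
    also have "pochhammer z (Suc n) = pochhammer z n * (z + of_nat n)" by (simp add: pochhammer_Suc)
    finally have "Gamma (z + of_nat (Suc n)) = pochhammer z n * (z + of_nat n) * Gamma z" .
    then have "g z = pochhammer z n * (z + of_nat n) * Gamma z / pochhammer z n * exp (z * - Ln u)"
      unfolding g_def by (rule arg_cong)
    also have "\<dots> = (z + of_nat n) * f z" using poch_nz[OF z(2)] by (simp add: f_def)
    finally show ?thesis using z(3) by (simp add: field_simps eq_neg_iff_add_eq_0)
  qed
  have "(LBINT t. f (Complex (c - real n) t)) - (LBINT t. f (Complex (c - real (Suc n)) t)) = 2 * of_real pi * g (- of_nat n)"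
  proof (rule vertical_line_shift[where A = "- real n - 1" and B = "- real n + 1" and f = f and g = g
        and p = "- of_nat n" and ca = "c - real (Suc n)" and cb = "c - real n"])
    show "g holomorphic_on {z. - real n - 1 < Re z \<and> Re z < - real n + 1}"
      unfolding g_def
    proof (intro holomorphic_intros)
      show "z + complex_of_nat (Suc n) \<notin> \<int>\<^sub>\<le>\<^sub>0" if "z \<in> {z. - real n - 1 < Re z \<and> Re z < - real n + 1}" for z
      proof
        assume "z + of_nat (Suc n) \<in> \<int>\<^sub>\<le>\<^sub>0"
        then obtain m where "z + of_nat (Suc n) = - complex_of_nat m" by (auto elim: nonpos_Ints_cases' simp del: of_nat_Suc)
        then have "Re (z + of_nat (Suc n)) = Re (- of_nat m)" by (rule arg_cong)
        with that show False by simp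
      qed

    qed (use poch_nz in auto)
    show "\<exists>T. \<forall>z. c - real (Suc n) \<le> Re z \<longrightarrow> Re z \<le> c - real n \<longrightarrow> \<bar>Im z\<bar> \<ge> T \<longrightarrow> norm (f z) < e" if "e > 0" for e
    proof -
      obtain T where T: "\<And>z. \<bar>Re z\<bar> \<le> real n + 1 \<Longrightarrow> \<bar>Im z\<bar> \<ge> T \<Longrightarrow> norm (f z) < e"
        using strip_growth_tendsto_0[OF r(2,1) \<open>e > 0\<close>] by metis
      show ?thesis using T c by (intro exI[of _ T]) auto
    qed
    show "((\<lambda>t. f (Complex (c - real (Suc n)) t)) has_integral (LBINT t. f (Complex (c - real (Suc n)) t))) UNIV"
      "((\<lambda>t. f (Complex (c - real n) t)) has_integral (LBINT t. f (Complex (c - real n) t))) UNIV"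
      by (rule int)+
  qed (use c fg in auto)
  also have "g (- of_nat n) = (- u) ^ n / fact n"
  proof -
    have "pochhammer (- of_nat n) n = ((-1) ^ n * fact n :: complex)"
      by (rule pochhammer_same)
    moreover have "exp (- of_nat n * - Ln u) = u ^ n"
      using u by (cases "u = 0") (auto simp: exp_of_nat_mult)
    moreover have "(-1) ^ n * (-1) ^ n = (1::complex)" by (simp flip: power_mult_distrib)
    ultimately show ?thesis by (simp add: g_def power_minus[of u] field_simps)
  qed
  finally show ?thesis by (simp add: f_def)
qed

text \<open>Each step to the left multiplies the integrand by u / (z - 1), up to unimodular factors.
  The first denominator has modulus at least 1 - c, the later ones at least 1, ..., m; all bounds
  are uniform in t.\<close>

lemma norm_Gamma_exp_line_le:
  "norm (Gamma (Complex (c - real (Suc m)) t) * exp (Complex (c - real (Suc m)) t * - Ln u)) \<le>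
     norm u ^ Suc m / ((1 - c) * fact m) * norm (Gamma (Complex c t) * exp (Complex c t * - Ln u))"
proof -
  define f where "f z = Gamma z * exp (z * - Ln u)" for z
  have u0: "u \<noteq> 0" using u by auto
  have step: "norm (f (z - 1)) \<le> norm (f z) * norm u / x" if "z - 1 \<notin> \<int>\<^sub>\<le>\<^sub>0" "0 < x" "x \<le> \<bar>Re (z - 1)\<bar>" for z x
  proof -
    have "Gamma z = (z - 1) * Gamma (z - 1)" using Gamma_plus1[OF that(1)] by simp
    moreover have "exp ((z - 1) * - Ln u) = exp (z * - Ln u) * u"
      using u0 by (simp add: algebra_simps exp_diff exp_add exp_minus divide_inverse)
    ultimately have "norm (f (z - 1)) * norm (z - 1) = norm (f z) * norm u"
      by (simp add: f_def norm_mult)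
    moreover have "norm (f (z - 1)) * x \<le> norm (f (z - 1)) * norm (z - 1)"
      using that abs_Re_le_cmod[of "z - 1"] by (intro mult_left_mono) auto
    ultimately show ?thesis using that by (simp add: field_simps)
  qed
  have "norm (f (Complex (c - real (Suc m)) t)) \<le> norm u ^ Suc m / ((1 - c) * fact m) * norm (f (Complex c t))"
  proof (induction m)
    case 0
    have "norm (f (Complex c t - 1)) \<le> norm (f (Complex c t)) * norm u / (1 - c)"
      using c by (intro step not_nonpos_Ints_between[of 0]) auto
    moreover have "Complex c t - 1 = Complex (c - real (Suc 0)) t" by (simp add: complex_eq_iff)
    ultimately have "norm (f (Complex (c - real (Suc 0)) t)) \<le> norm (f (Complex c t)) * norm u / (1 - c)" by (simp only:)
    then show ?case by (simp add: mult.commute)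
  next
    case (Suc m)
    have "norm (f (Complex (c - real (Suc m)) t - 1)) \<le> norm (f (Complex (c - real (Suc m)) t)) * norm u / real (Suc m)"
      using c by (intro step not_nonpos_Ints_between[of "Suc m"]) auto
    also have "\<dots> \<le> (norm u ^ Suc m / ((1 - c) * fact m) * norm (f (Complex c t))) * norm u / real (Suc m)"
      using Suc.IH by (intro divide_right_mono mult_right_mono) auto
    also have "\<dots> = norm u ^ Suc (Suc m) / ((1 - c) * fact (Suc m)) * norm (f (Complex c t))"
      by (simp add: mult_ac)
    also have "Complex (c - real (Suc m)) t - 1 = Complex (c - real (Suc (Suc m))) t" by (simp add: complex_eq_iff)
    finally show ?case .
  qed
  then show ?thesis by (simp only: f_def)
qed

text \<open>Shifting the line by N units collects the first N terms of the series of exp (- u). The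
  remaining line integral is O(|u|^m / m!) with m = N - 1 and vanishes in the limit.\<close>

theorem Cahen_Mellin:
  "(LBINT t. Gamma (Complex c t) * exp (Complex c t * - Ln u)) = 2 * of_real pi * exp (- u)"
proof -
  define f where "f z = Gamma z * exp (z * - Ln u)" for z
  define F where "F n = (LBINT t. f (Complex (c - real n) t))" for n
  have F_sum: "F 0 - F N = 2 * of_real pi * (\<Sum>n<N. (- u) ^ n / fact n)" for N
  proof -
    have "F 0 - F N = (\<Sum>n<N. F n - F (Suc n))" by (simp add: sum_lessThan_telescope')
    also have "\<dots> = (\<Sum>n<N. 2 * of_real pi * ((- u) ^ n / fact n))"
      unfolding F_def f_def Gamma_line_shift ..
    finally show ?thesis by (simp add: sum_distrib_left)
  qed
  define B where "B = (LBINT t. norm (f (Complex c t))) * norm u / (1 - c)"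
  have F_le: "norm (F (Suc m)) \<le> B * (norm u ^ m / fact m)" for m
  proof -
    have i: "integrable lborel (\<lambda>t. f (Complex c t))" "integrable lborel (\<lambda>t. f (Complex (c - real (Suc m)) t))"
      using integrable_Gamma_exp_line[of 0] integrable_Gamma_exp_line[of "Suc m"] unfolding f_def by simp_all
    have "norm (F (Suc m)) \<le> (LBINT t. norm u ^ Suc m / ((1 - c) * fact m) * norm (f (Complex c t)))"
      unfolding F_def
      by (rule Bochner_Integration.integral_norm_bound_integral) (use i norm_Gamma_exp_line_le in \<open>auto simp: f_def\<close>)
    also have "\<dots> = norm u ^ Suc m / ((1 - c) * fact m) * (LBINT t. norm (f (Complex c t)))"
      by (rule integral_mult_right_zero)
    finally show ?thesis by (simp add: B_def mult_ac)
  qed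
  have "(\<lambda>m. B * (norm u ^ m / fact m)) \<longlonglongrightarrow> B * 0"
    using summable_LIMSEQ_zero[OF summable_exp[of "norm u"]] by (intro tendsto_intros) (simp add: field_simps)
  then have "(\<lambda>m. B * (norm u ^ m / fact m)) \<longlonglongrightarrow> 0" by simp
  with always_eventually[OF allI[OF F_le]] have "(\<lambda>m. F (Suc m)) \<longlonglongrightarrow> 0"
    by (rule Lim_null_comparison)
  then have 1: "(\<lambda>N. F 0 - F (Suc N)) \<longlonglongrightarrow> F 0 - 0" by (intro tendsto_intros)
  have "(\<lambda>n. (- u) ^ n / fact n) sums exp (- u)"
    using exp_converges[of "- u"] by (simp add: scaleR_conv_of_real field_simps)
  then have "(\<lambda>N. 2 * of_real pi * (\<Sum>n<Suc N. (- u) ^ n / fact n)) \<longlonglongrightarrow> 2 * of_real pi * exp (- u)"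
    unfolding sums_def by (intro tendsto_intros LIMSEQ_Suc)
  from LIMSEQ_unique[OF 1[unfolded F_sum] this] show ?thesis by (simp add: F_def f_def)
qed

end

subsection \<open>The cosine integral\<close>

text \<open>Insert the Cahen-Mellin integral for \<open>exp (- p s\<^sup>2)\<close> and interchange the integrals.\<close>

proposition Laplace_Gaussian:
  assumes p: "Re p > 0" and w: "Re w > 0" and c: "0 < c" "c < 1" "c < Re v"
  shows "(LBINT s:{0<..}. of_real s powr (2 * v - 1) * exp (- w * of_real s) * exp (- p * of_real (s\<^sup>2))) =
    (LBINT t. Gamma (Complex c t) * exp (Complex c t * - Ln p) *
       (Gamma (2 * v - 2 * Complex c t) * w powr - (2 * v - 2 * Complex c t))) / (2 * of_real pi)"
proof -
  define A where "A s = indicator {0<..} s *\<^sub>R (of_real s powr (2 * v - 1) * exp (- w * of_real s))" for s :: real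
  define B where "B t = Gamma (Complex c t) * exp (Complex c t * - Ln p)" for t
  \<comment> \<open>The last exponential is s^(- 2 z) on the line z = c + \<i> t: it splits (p
    s^2)^(- z) into p^(- z), part of B, and a power of s.\<close>
  define G where "G = (\<lambda>(s, t). A s * (B t * exp (- 2 * (of_real c + \<i> * of_real t) * of_real (ln s))))"
  have p0: "p \<noteq> 0" using p by auto
  have B_int: "integrable lborel B"
    using integrable_Gamma_exp_line[OF p c(1,2), of 0] unfolding B_def[abs_def] by simp
  have [measurable]: "A \<in> borel_measurable borel" unfolding A_def by measurable
  have [measurable]: "B \<in> borel_measurable borel" using borel_measurable_integrable[OF B_int] by simp
  have G_meas [measurable]: "G \<in> borel_measurable (lborel \<Otimes>\<^sub>M lborel)" unfolding G_def by measurable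
  have A_powr: "of_real s powr (2 * v - 1) * exp (- w * of_real s) * exp (- 2 * z * of_real (ln s)) =
      of_real s powr ((2 * v - 2 * z) - 1) * exp (- w * of_real s)" if "s > 0" for s z
    using that by (simp add: of_real_powr_eq_exp algebra_simps flip: exp_add)
  have inner_s: "(LBINT s. G (s, t)) = B t * (Gamma (2 * v - 2 * Complex c t) * w powr - (2 * v - 2 * Complex c t))" for t
  proof -
    have "(LBINT s. G (s, t)) = (LBINT s. B t * (indicator {0<..} s *\<^sub>R (of_real s powr ((2 * v - 2 * Complex c t) - 1) * exp (- w * of_real s))))"
    proof (intro Bochner_Integration.integral_cong refl)
      fix s :: real
      show "G (s, t) = B t * (indicator {0<..} s *\<^sub>R (of_real s powr ((2 * v - 2 * Complex c t) - 1) * exp (- w * of_real s)))"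
      proof (cases "s > 0")
        case True
        then have "G (s, t) = B t * (of_real s powr (2 * v - 1) * exp (- w * of_real s) * exp (- 2 * Complex c t * of_real (ln s)))"
          by (simp add: G_def A_def Complex_eq mult_ac)
        then show ?thesis using True unfolding A_powr[OF True] by simp
      qed (simp add: G_def A_def)
    qed
    also have "\<dots> = B t * (LBINT s:{0<..}. of_real s powr ((2 * v - 2 * Complex c t) - 1) * exp (- w * of_real s))"
      unfolding set_lebesgue_integral_def by (rule integral_mult_right_zero)
    also have "(LBINT s:{0<..}. of_real s powr ((2 * v - 2 * Complex c t) - 1) * exp (- w * of_real s)) =
        Gamma (2 * v - 2 * Complex c t) * w powr - (2 * v - 2 * Complex c t)"
      using c w by (intro Laplace_powr) auto
    finally show ?thesis .
  qed
  have inner_t: "(LBINT t. G (s, t)) = 2 * of_real pi * (A s * exp (- p * of_real (s\<^sup>2)))" for s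
  proof (cases "s > 0")
    case True
    have u: "Re (p * of_real (s\<^sup>2)) > 0" using p True by simp
    \<comment> \<open>The factor s^2 is positive, so the argument of p is unchanged.\<close>
    have "Ln (p * of_real (s\<^sup>2)) = Ln p + of_real (2 * ln s)"
      using True p0 Ln_times_of_real[of "s\<^sup>2" p] Ln_of_real[of "s\<^sup>2"]
      by (simp add: ln_realpow mult.commute add.commute)
    then have "G (s, t) = A s * (Gamma (Complex c t) * exp (Complex c t * - Ln (p * of_real (s\<^sup>2))))" for t
      by (simp add: G_def B_def Complex_eq algebra_simps flip: exp_add)
    then have "(LBINT t. G (s, t)) = A s * (LBINT t. Gamma (Complex c t) * exp (Complex c t * - Ln (p * of_real (s\<^sup>2))))"
      by (simp only: integral_mult_right_zero)
    then show ?thesis unfolding Cahen_Mellin[OF u c(1,2)] by (simp add: mult_ac)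
  qed (simp add: G_def A_def)
  have "integrable (lborel \<Otimes>\<^sub>M lborel) G"
  proof (rule lborel_pair.Fubini_integrable[OF G_meas])
    \<comment> \<open>The modulus separates into a function of t times a function of s; the latter
      is integrable at 0 because c < Re v.\<close>
    have normG: "norm (G (s, t)) = norm (B t) * (indicator {0<..} s *\<^sub>R (s powr ((2 * Re v - 2 * c) - 1) * exp (- Re w * s)))" for s t
    proof (cases "s > 0")
      case True
      then show ?thesis
        by (simp add: G_def A_def norm_mult norm_of_real_powr norm_exp_eq_Re powr_def[of s] algebra_simps flip: exp_add)
    qed (simp add: G_def A_def)
    have "integrable lborel (\<lambda>s. (LBINT t. norm (B t)) * (indicator {0<..} s *\<^sub>R (s powr ((2 * Re v - 2 * c) - 1) * exp (- Re w * s))))"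
      using set_integrable_powr_exp[of "2 * Re v - 2 * c" "Re w"] c w unfolding set_integrable_def by (intro integrable_mult_right) auto
    then show "integrable lborel (\<lambda>s. LBINT t. norm (G (s, t)))" unfolding normG by (simp only: integral_mult_left_zero)
    show "AE s in lborel. integrable lborel (\<lambda>t. G (s, t))"
    proof (intro AE_I2)
      fix s :: real
      have "integrable lborel (\<lambda>t. norm (B t) * (indicator {0<..} s *\<^sub>R (s powr ((2 * Re v - 2 * c) - 1) * exp (- Re w * s))))"
        by (intro integrable_mult_left integrable_norm B_int)
      then have "integrable lborel (\<lambda>t. norm (G (s, t)))" unfolding normG .
      then show "integrable lborel (\<lambda>t. G (s, t))" by (rule integrable_norm_cancel) measurable
    qed
  qed
  then have "(LBINT t. LBINT s. G (s, t)) = (LBINT s. LBINT t. G (s, t))"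
    by (intro lborel_pair.Fubini_integral) (simp add: case_prod_beta')
  also have "\<dots> = 2 * of_real pi * (LBINT s. A s * exp (- p * of_real (s\<^sup>2)))"
    unfolding inner_t by (rule integral_mult_right_zero)
  also have "(LBINT s. A s * exp (- p * of_real (s\<^sup>2))) =
      (LBINT s:{0<..}. of_real s powr (2 * v - 1) * exp (- w * of_real s) * exp (- p * of_real (s\<^sup>2)))"
    unfolding A_def set_lebesgue_integral_def by simp
  finally show ?thesis unfolding inner_s B_def by (simp add: field_simps)
qed

section \<open>The imaginary values of p and the cosine\<close>

context
  fixes v w :: complex and c :: real
  assumes w: "Re w > 0" and c: "0 < c" "c < 1" "c < Re v"
begin

text \<open>The rate must lie below - pi / 2, not merely below 0: for imaginary p the factor p^(- z)
  consumes pi / 2.\<close>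

lemma Gamma_Gamma_line_bound:
  obtains C r where "r < - pi / 2" "\<And>t. norm (Gamma (Complex c t) * (Gamma (2 * v - 2 * Complex c t) * w powr - (2 * v - 2 * Complex c t))) \<le> C * exp (r * \<bar>t\<bar>)"
proof -
  have w0: "w \<noteq> 0" using w by auto
  define \<phi> where "\<phi> = \<bar>Im (Ln w)\<bar>"
  have \<phi>: "0 \<le> \<phi>" "\<phi> < pi / 2" using w Re_Ln_pos_lt[OF w0] by (auto simp: \<phi>_def)
  \<comment> \<open>Midpoint of pi / 2 and the value (pi / 2 + 2 \<phi>) / 3 at which the rate - 3
    \<theta> + 2 \<phi> equals - pi / 2.\<close>
  define \<theta> where "\<theta> = (pi / 2 + 2 * \<phi>) / 6 + pi / 4"
  have \<theta>: "0 \<le> \<theta>" "\<theta> < pi / 2" "pi / 2 + 2 * \<phi> < 3 * \<theta>" using \<phi> by (auto simp: \<theta>_def field_simps)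
  define f where "f z = Gamma z * (Gamma (of_real (- 2) * z + 2 * v) * exp ((of_real (- 2) * z + 2 * v) * - Ln w))" for z
  have "strip_growth (- \<theta> + (- \<theta> * \<bar>- 2\<bar> + \<bar>Im (- Ln w)\<bar> * \<bar>- 2\<bar>)) f"
    unfolding f_def using \<theta>
    by (intro strip_growth_mult strip_growth_affine[where f = "\<lambda>z. exp (z * - Ln w)"]
        strip_growth_affine[where f = Gamma] strip_growth_exp strip_growth_Gamma) auto
  moreover have "continuous_on UNIV (\<lambda>t. f (Complex c t))"
    unfolding f_def using c
    by (intro continuous_intros continuous_on_compose2[OF continuous_on_Gamma[of "- \<int>\<^sub>\<le>\<^sub>0"]] continuous_on_Complex_line)
      (auto simp: nonpos_Ints_def complex_eq_iff)
  ultimately obtain C where C: "\<And>t. norm (f (Complex c t)) \<le> C * exp ((- \<theta> + (- \<theta> * \<bar>- 2\<bar> + \<bar>Im (- Ln w)\<bar> * \<bar>- 2\<bar>)) * \<bar>t\<bar>)"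
    using strip_growth_line_bound by blast
  have "- \<theta> + (- \<theta> * \<bar>- 2\<bar> + \<bar>Im (- Ln w)\<bar> * \<bar>- 2\<bar>) < - pi / 2" using \<theta>(3) by (simp add: \<phi>_def)
  moreover have "f z = Gamma z * (Gamma (2 * v - 2 * z) * w powr - (2 * v - 2 * z))" for z
    using w0 by (simp add: f_def powr_def algebra_simps)
  ultimately show thesis using C by (intro that) auto
qed

lemma continuous_on_Gamma_Gamma_line:
  "continuous_on UNIV (\<lambda>t. Gamma (Complex c t) * exp (Complex c t * l) * (Gamma (2 * v - 2 * Complex c t) * w powr - (2 * v - 2 * Complex c t)))"
proof -
  have w0: "w \<noteq> 0" using w by auto
  show ?thesis unfolding powr_def using c w0
    by (simp, intro continuous_intros continuous_on_compose2[OF continuous_on_Gamma[of "- \<int>\<^sub>\<le>\<^sub>0"]] continuous_on_Complex_line)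
      (auto simp: nonpos_Ints_def complex_eq_iff)
qed

text \<open>The case \<open>Re p = 0\<close>, as the limit of \<open>p + 1 / n\<close>.\<close>

lemma Laplace_Fresnel:
  assumes p: "Re p = 0" "Im p \<noteq> 0"
  shows "(LBINT s:{0<..}. of_real s powr (2 * v - 1) * exp (- w * of_real s) * exp (- p * of_real (s\<^sup>2))) =
    (LBINT t. Gamma (Complex c t) * exp (Complex c t * - Ln p) *
       (Gamma (2 * v - 2 * Complex c t) * w powr - (2 * v - 2 * Complex c t))) / (2 * of_real pi)"
    and "set_integrable lborel {0<..} (\<lambda>s. of_real s powr (2 * v - 1) * exp (- w * of_real s) * exp (- p * of_real (s\<^sup>2)))"
    and "integrable lborel (\<lambda>t. Gamma (Complex c t) * exp (Complex c t * - Ln p) *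
       (Gamma (2 * v - 2 * Complex c t) * w powr - (2 * v - 2 * Complex c t)))"
proof -
  define q where "q n = p + of_real (inverse (real (Suc n)))" for n
  have Re_q: "Re (q n) > 0" "Im (q n) = Im p" for n using p by (auto simp: q_def)
  have q_lim: "q \<longlonglongrightarrow> p"
    unfolding q_def[abs_def]
    using tendsto_add[OF tendsto_const[of p] tendsto_of_real[OF LIMSEQ_inverse_real_of_nat, where 'a = complex]]
    by (simp only: of_real_0 add_0_right)
  \<comment> \<open>Off the branch cut \<open>Ln\<close> is continuous, so \<open>Ln (q n)\<close>
    converges to \<open>Ln p\<close>.\<close>
  have p_slit: "p \<notin> \<real>\<^sub>\<le>\<^sub>0" using p by (auto simp: complex_nonpos_Reals_iff)
  define D where "D s = indicator {0<..} s *\<^sub>R (s powr (2 * Re v - 1) * exp (- Re w * s))" for s :: real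
  have D_int: "integrable lborel D"
    using set_integrable_powr_exp[of "2 * Re v" "Re w"] c w by (simp add: set_integrable_def D_def[abs_def])
  define K where "K t = Gamma (2 * v - 2 * Complex c t) * w powr - (2 * v - 2 * Complex c t)" for t
  obtain C r where r: "r < - pi / 2" and C: "\<And>t. norm (Gamma (Complex c t) * K t) \<le> C * exp (r * \<bar>t\<bar>)"
    using Gamma_Gamma_line_bound unfolding K_def by metis
  define S where "S p s = indicator {0<..} s *\<^sub>R (of_real s powr (2 * v - 1) * exp (- w * of_real s) * exp (- p * of_real (s\<^sup>2)))" for p and s :: real
  define R where "R p t = Gamma (Complex c t) * exp (Complex c t * - Ln p) * K t" for p t
  have S_meas: "S p \<in> borel_measurable lborel" for p unfolding S_def by measurable
  have R_meas: "R p \<in> borel_measurable lborel" for p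
    using borel_measurable_continuous_onI[OF continuous_on_Gamma_Gamma_line[of "- Ln p"]] unfolding R_def K_def by simp
  have S_lim: "AE s in lborel. (\<lambda>n. S (q n) s) \<longlonglongrightarrow> S p s"
    unfolding S_def by (intro AE_I2 tendsto_intros q_lim)
  have S_le: "norm (S p' s) \<le> D s" if "Re p' \<ge> 0" for p' s
  proof (cases "s > 0")
    case True
    have "norm (exp (- p' * of_real (s\<^sup>2))) \<le> 1" using that by (simp add: norm_exp_eq_Re)
    then have "s powr (2 * Re v - 1) * exp (- Re w * s) * norm (exp (- p' * of_real (s\<^sup>2))) \<le> s powr (2 * Re v - 1) * exp (- Re w * s) * 1"
      by (intro mult_left_mono) auto
    then show ?thesis using True by (simp add: S_def D_def norm_mult norm_of_real_powr)
  qed (simp add: S_def D_def)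
  \<comment> \<open>Dominates the integrands for p and all q n together: |Im (Ln p')| \<le> pi / 2
    costs exp (pi/2 |t|), and |p'| \<ge> |Im p| with c > 0 bounds |p'|^(- c).\<close>
  define E where "E t = \<bar>Im p\<bar> powr - c * (C * exp ((r + pi / 2) * \<bar>t\<bar>))" for t
  have E_int: "integrable lborel E"
    unfolding E_def using r by (intro integrable_mult_right integrable_exp_abs) auto
  have R_lim: "AE t in lborel. (\<lambda>n. R (q n) t) \<longlonglongrightarrow> R p t"
    unfolding R_def by (intro AE_I2 tendsto_intros q_lim p_slit)
  have R_le: "norm (R p' t) \<le> E t" if p': "Re p' \<ge> 0" "Im p' = Im p" for p' t
  proof -
    have p'0: "p' \<noteq> 0" using p p' by auto
    have "\<bar>Im (Ln p')\<bar> \<le> pi / 2" using Re_Ln_pos_le[OF p'0] p' by simp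
    then have "t * Im (Ln p') \<le> \<bar>t\<bar> * (pi / 2)"
      by (metis abs_ge_self abs_mult abs_ge_zero mult_left_mono order_trans)
    moreover have "ln \<bar>Im p\<bar> \<le> ln (norm p')"
      using p p'0 abs_Im_le_cmod[of p'] p' by (subst ln_le_cancel_iff) auto
    then have "- c * ln (norm p') \<le> - c * ln \<bar>Im p\<bar>" using c by simp
    ultimately have "norm (exp (Complex c t * - Ln p')) \<le> exp (- c * ln \<bar>Im p\<bar> + \<bar>t\<bar> * (pi / 2))"
      using p'0 by (simp add: norm_exp_eq_Re)
    also have "\<dots> = \<bar>Im p\<bar> powr - c * exp (pi / 2 * \<bar>t\<bar>)"
      using p by (simp add: powr_def mult.commute flip: exp_add)
    finally have "norm (exp (Complex c t * - Ln p')) * norm (Gamma (Complex c t) * K t)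
        \<le> (\<bar>Im p\<bar> powr - c * exp (pi / 2 * \<bar>t\<bar>)) * (C * exp (r * \<bar>t\<bar>))"
      using C by (intro mult_mono) auto
    then show ?thesis by (simp add: R_def E_def norm_mult mult_ac ring_distribs exp_add)
  qed
  have "(\<lambda>n. LBINT s. S (q n) s) \<longlonglongrightarrow> (LBINT s. S p s)"
    by (rule integral_dominated_convergence[OF S_meas S_meas D_int S_lim])
      (rule AE_I2, rule S_le[OF less_imp_le[OF Re_q(1)]])
  moreover have "(\<lambda>n. LBINT t. R (q n) t) \<longlonglongrightarrow> (LBINT t. R p t)"
    by (rule integral_dominated_convergence[OF R_meas R_meas E_int R_lim])
      (rule AE_I2, rule R_le[OF less_imp_le[OF Re_q(1)] Re_q(2)])
  then have "(\<lambda>n. (LBINT t. R (q n) t) / (2 * of_real pi)) \<longlonglongrightarrow> (LBINT t. R p t) / (2 * of_real pi)"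
    by (intro tendsto_intros) auto
  moreover have "(LBINT s. S (q n) s) = (LBINT t. R (q n) t) / (2 * of_real pi)" for n
    using Laplace_Gaussian[OF Re_q(1) w c, of n] unfolding S_def R_def K_def set_lebesgue_integral_def .
  ultimately have "(LBINT s. S p s) = (LBINT t. R p t) / (2 * of_real pi)"
    by (simp only:) (rule LIMSEQ_unique)
  then show "(LBINT s:{0<..}. of_real s powr (2 * v - 1) * exp (- w * of_real s) * exp (- p * of_real (s\<^sup>2))) =
    (LBINT t. Gamma (Complex c t) * exp (Complex c t * - Ln p) *
       (Gamma (2 * v - 2 * Complex c t) * w powr - (2 * v - 2 * Complex c t))) / (2 * of_real pi)"
    unfolding S_def R_def K_def set_lebesgue_integral_def .
  have "integrable lborel (S p)"
    by (rule Bochner_Integration.integrable_bound[OF D_int S_meas]) (use S_le[of p] p in \<open>auto intro!: AE_I2 order_trans[OF _ abs_ge_self]\<close>)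
  then show "set_integrable lborel {0<..} (\<lambda>s. of_real s powr (2 * v - 1) * exp (- w * of_real s) * exp (- p * of_real (s\<^sup>2)))"
    unfolding S_def[abs_def] set_integrable_def .
  have "integrable lborel (R p)"
    by (rule Bochner_Integration.integrable_bound[OF E_int R_meas]) (use R_le[of p] p in \<open>auto intro!: AE_I2 order_trans[OF _ abs_ge_self]\<close>)
  then show "integrable lborel (\<lambda>t. Gamma (Complex c t) * exp (Complex c t * - Ln p) *
       (Gamma (2 * v - 2 * Complex c t) * w powr - (2 * v - 2 * Complex c t)))"
    unfolding R_def[abs_def] K_def .
qed

proposition Laplace_cos_eq_kernel:
  assumes y: "y > 0"
  defines "h \<equiv> \<lambda>s. of_real s powr (2 * v - 1) * exp (- w * of_real s) * of_real (cos (y * s\<^sup>2))"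
  shows "set_integrable lborel {0<..} h"
    and "(LBINT s:{0<..}. h s) = (LBINT t. cos_Laplace_kernel v y w (Complex (- c / 2) t)) / of_real pi"
proof -
  define f where "f p s = of_real s powr (2 * v - 1) * exp (- w * of_real s) * exp (- p * of_real (s\<^sup>2))" for p and s :: real
  define R where "R p t = Gamma (Complex c t) * exp (Complex c t * - Ln p) *
       (Gamma (2 * v - 2 * Complex c t) * w powr - (2 * v - 2 * Complex c t))" for p t
  define p where "p = \<i> * of_real y"
  have w0: "w \<noteq> 0" using w by auto
  have p: "Re p = 0" "Im p \<noteq> 0" "Re (- p) = 0" "Im (- p) \<noteq> 0" using y by (auto simp: p_def)
  note F = Laplace_Fresnel[OF p(1,2), folded f_def R_def] Laplace_Fresnel[OF p(3,4), folded f_def R_def]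
  have Ln_p: "Ln p = of_real (ln y) + \<i> * of_real pi / 2" "Ln (- p) = of_real (ln y) - \<i> * of_real pi / 2"
  proof -
    have "Ln p = Ln \<i> + of_real (ln y)" unfolding p_def using y Ln_times_of_real[of y \<i>] by (simp add: mult_ac add.commute Ln_of_real)
    then show "Ln p = of_real (ln y) + \<i> * of_real pi / 2" by simp
    have "Ln (- p) = Ln (- \<i>) + of_real (ln y)" unfolding p_def using y Ln_times_of_real[of y "- \<i>"] by (simp add: mult_ac Ln_of_real)
    then show "Ln (- p) = of_real (ln y) - \<i> * of_real pi / 2" by simp
  qed
  have h: "h s = (f p s + f (- p) s) / 2" for s
  proof -
    have "of_real (cos (y * s\<^sup>2)) = (exp (- p * of_real (s\<^sup>2)) + exp (- (- p) * of_real (s\<^sup>2))) / 2"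
      unfolding cos_of_real [symmetric] cos_exp_eq by (simp add: p_def add.commute mult_ac)
    then show ?thesis by (simp add: h_def f_def ring_distribs add_divide_distrib)
  qed
  have int: "set_integrable lborel {0<..} (\<lambda>s. f p s + f (- p) s)" using F by (intro set_integral_add)
  then show "set_integrable lborel {0<..} h"
    unfolding h[abs_def] by (rule set_integrable_divide)
  have "(LBINT s:{0<..}. h s) = ((LBINT s:{0<..}. f p s) + (LBINT s:{0<..}. f (- p) s)) / 2"
    unfolding h using F by (simp add: set_integral_divide_zero set_integral_add)
  also have "\<dots> = (LBINT t. R p t + R (- p) t) / (4 * of_real pi)"
    using F by (simp add: add_divide_distrib)
  \<comment> \<open>Substitution z = - 2 \<zeta>, so the line Re z = c becomes Re \<zeta> = - c / 2.
    The arguments pi / 2 and - pi / 2 of p and - p combine into the cosine of pi z / 2, and the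
    Jacobian is 2.\<close>
  also have "(\<lambda>t. R p t + R (- p) t) = (\<lambda>t. 2 * cos_Laplace_kernel v y w (Complex (- c / 2) (0 + (- 1 / 2) * t)))"
  proof
    fix t
    define z where "z = Complex c t"
    have "Complex (- c / 2) (0 + (- 1 / 2) * t) = - z / 2" by (simp add: z_def complex_eq_iff)
    moreover have "exp (z * - Ln p) + exp (z * - Ln (- p)) = 2 * (exp (- z * of_real (ln y)) * cos (of_real pi * (- z / 2)))"
      unfolding Ln_p cos_exp_eq by (simp add: algebra_simps flip: exp_add)
    moreover have "R p t + R (- p) t = (exp (z * - Ln p) + exp (z * - Ln (- p))) * (Gamma z * (Gamma (2 * v - 2 * z) * w powr - (2 * v - 2 * z)))"
      by (simp add: R_def z_def algebra_simps)
    ultimately show "R p t + R (- p) t = 2 * cos_Laplace_kernel v y w (Complex (- c / 2) (0 + (- 1 / 2) * t))"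
      using w0 by (simp add: cos_Laplace_kernel_def powr_def mult_ac)
  qed
  also have "(LBINT t. 2 * cos_Laplace_kernel v y w (Complex (- c / 2) (0 + (- 1 / 2) * t))) = 4 * (LBINT t. cos_Laplace_kernel v y w (Complex (- c / 2) t))"
    using lborel_integral_real_affine[of "- 1 / 2" "\<lambda>t. cos_Laplace_kernel v y w (Complex (- c / 2) t)" 0]
    by (simp add: scaleR_conv_of_real mult.commute)
  finally show "(LBINT s:{0<..}. h s) = (LBINT t. cos_Laplace_kernel v y w (Complex (- c / 2) t)) / of_real pi" by simp
qed

text \<open>Substitute x = s^2: the Jacobian 2 s turns s^(2 v - 2) into 2 s^(2 v - 1). The
  substitution rule used here asks for integrability on both sides, one assumed and one from
  \<open>Laplace_cos_eq_kernel\<close>.\<close>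

lemma IC_integral_eq_kernel:
  assumes y: "y > 0" and int: "set_integrable lborel {0<..} (IC_integrand v w y)"
  shows "(LBINT x:{0<..}. IC_integrand v w y x) = 2 / of_real pi * (LBINT t. cos_Laplace_kernel v y w (Complex (- c / 2) t))"
proof -
  define h where "h s = of_real s powr (2 * v - 1) * exp (- w * of_real s) * of_real (cos (y * s\<^sup>2))" for s :: real
  have sub: "(2 * s) *\<^sub>R IC_integrand v w y (s\<^sup>2) = 2 * h s" if "s > 0" for s :: real
  proof -
    have "of_real s * of_real (s\<^sup>2) powr (v - 1) = of_real s powr (2 * v - 1)"
    proof -
      have "complex_of_real s = exp (of_real (ln s))" using that by (simp add: exp_of_real)
      then have "of_real s * of_real (s\<^sup>2) powr (v - 1) = exp (of_real (ln s)) * exp ((v - 1) * of_real (2 * ln s))"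
        using that by (subst of_real_powr_eq_exp) (auto simp: ln_realpow)
      also have "\<dots> = of_real s powr (2 * v - 1)"
        unfolding exp_add [symmetric] using that by (subst of_real_powr_eq_exp) (auto simp: algebra_simps)
      finally show ?thesis .
    qed
    then show ?thesis using that by (simp add: IC_integrand_def h_def scaleR_conv_of_real mult_ac)
  qed
  have img: "einterval 0 \<infinity> = {0::real<..}" by (auto simp: einterval_def)
  have h_int: "set_integrable lborel {0<..} h"
    using Laplace_cos_eq_kernel(1)[OF y] unfolding h_def .
  have "(LBINT x=0..\<infinity>. IC_integrand v w y x) = (LBINT s=0..\<infinity>. (2 * s) *\<^sub>R IC_integrand v w y (s\<^sup>2))"
  proof (rule interval_integral_substitution_integrable)
    have "continuous_on {0<..} (IC_integrand v w y)"
    proof (rule continuous_on_eq)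
      show "continuous_on {0<..} (\<lambda>x. exp ((v - 1) * of_real (ln x)) * exp (- w * of_real (sqrt x)) * of_real (cos (x * y)))"
        by (intro continuous_intros) auto
    qed (simp add: IC_integrand_def of_real_powr_eq_exp)
    then show "isCont (IC_integrand v w y) (s\<^sup>2)" if "0 < ereal s" for s
      using that by (simp add: continuous_on_eq_continuous_at)
    show "DERIV (\<lambda>s. s\<^sup>2) s :> 2 * s" for s :: real by (auto intro!: derivative_eq_intros)
    show "set_integrable lborel (einterval 0 \<infinity>) (\<lambda>s. (2 * s) *\<^sub>R IC_integrand v w y (s\<^sup>2))"
    proof -
      have "set_integrable lborel {0<..} (\<lambda>s. 2 * h s)" using h_int by simp
      also have "?this \<longleftrightarrow> set_integrable lborel {0<..} (\<lambda>s. (2 * s) *\<^sub>R IC_integrand v w y (s\<^sup>2))"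
        by (intro set_integrable_cong refl) (simp add: sub)
      finally show ?thesis unfolding img .
    qed
    show "((ereal \<circ> (\<lambda>s. s\<^sup>2) \<circ> real_of_ereal) \<longlongrightarrow> 0) (at_right 0)"
      unfolding zero_ereal_def by (auto simp: ereal_tendsto_simps intro!: tendsto_eq_intros)
    show "((ereal \<circ> (\<lambda>s. s\<^sup>2) \<circ> real_of_ereal) \<longlongrightarrow> \<infinity>) (at_left \<infinity>)"
      by (simp add: ereal_tendsto_simps) (intro filterlim_pow_at_top filterlim_ident; simp)
    show "set_integrable lborel (einterval 0 \<infinity>) (IC_integrand v w y)" using int unfolding img .
  qed auto
  then have "(LBINT x:{0<..}. IC_integrand v w y x) = (LBINT s:{0<..}. (2 * s) *\<^sub>R IC_integrand v w y (s\<^sup>2))"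
    by (simp add: interval_lebesgue_integral_def img)
  also have "\<dots> = (LBINT s:{0<..}. 2 * h s)"
    by (intro set_lebesgue_integral_cong) (auto simp: sub)
  also have "\<dots> = 2 * (LBINT s:{0<..}. h s)" by (rule set_integral_mult_right)
  also have "(LBINT s:{0<..}. h s) = (LBINT t. cos_Laplace_kernel v y w (Complex (- c / 2) t)) / of_real pi"
    using Laplace_cos_eq_kernel(2)[OF y] unfolding h_def .
  finally show ?thesis by simp
qed

end

subsection \<open>Integrability and summation\<close>

lemma not_set_integrable_inverse:
  assumes d: "d \<ge> 0" shows "\<not> set_integrable lborel {1..} (\<lambda>x::real. 1 / (x + d))"
proof
  assume int: "set_integrable lborel {1..} (\<lambda>x. 1 / (x + d))"
  define I where "I = (LBINT x:{1..}. 1 / (x + d))"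
  have le: "ln (n + d) - ln (1 + d) \<le> I" if n: "n \<ge> 1" for n
  proof -
    have "((\<lambda>x. 1 / (x + d)) has_integral (ln (n + d) - ln (1 + d))) {1..n}"
    proof (rule fundamental_theorem_of_calculus[OF n])
      fix x assume "x \<in> {1..n}"
      then show "((\<lambda>x. ln (x + d)) has_vector_derivative 1 / (x + d)) (at x within {1..n})"
        using d unfolding has_real_derivative_iff_has_vector_derivative[symmetric]
        by (auto intro!: derivative_eq_intros)
    qed
    moreover have sub: "set_integrable lborel {1..n} (\<lambda>x. 1 / (x + d))"
      by (rule set_integrable_subset[OF int]) auto
    ultimately have "ln (n + d) - ln (1 + d) = (LBINT x:{1..n}. 1 / (x + d))"
      using set_borel_integral_eq_integral(2)[OF sub] by (simp add: integral_unique)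
    also have "\<dots> \<le> I"
      unfolding I_def set_lebesgue_integral_def using sub int d unfolding set_integrable_def
      by (intro integral_mono) (auto simp: indicator_def)
    finally show ?thesis .
  qed
  \<comment> \<open>Chosen so that ln (n + d) - ln (1 + d) exceeds I.\<close>
  define n where "n = exp (\<bar>I\<bar> + ln (1 + d) + 1)"
  have "\<bar>I\<bar> + ln (1 + d) + 1 \<ge> 0" using d by (simp add: add_nonneg_nonneg)
  then have n: "n \<ge> 1" by (simp add: n_def)
  have "\<bar>I\<bar> + ln (1 + d) + 1 = ln n" by (simp add: n_def)
  also have "\<dots> \<le> ln (n + d)" using n d by (subst ln_le_cancel_iff) auto
  finally show False using le[OF n] by linarith
qed

text \<open>If \<open>Re w \<le> 0\<close>, the modulus of the integrand dominates \<open>\<bar>cos (x y)\<bar> / x\<close> on \<open>[1, \<infinity>)\<close>;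
  adding the translate by a quarter period leaves a multiple of the non-integrable \<open>1 / x\<close>.\<close>

lemma Re_pos_of_integrable:
  assumes v: "Re v > 0" and y: "y > 0" and int: "set_integrable lborel {0<..} (IC_integrand v w y)"
  shows "Re w > 0"
proof (rule ccontr)
  assume "\<not> Re w > 0"
  then have w: "Re w \<le> 0" by simp
  define d where "d = pi / (2 * y)"
  have d: "d > 0" using y by (simp add: d_def)
  define h where "h x = indicator {1..} x * (\<bar>cos (x * y)\<bar> / x)" for x :: real
  have "integrable lborel (\<lambda>x. indicator {0<..} x *\<^sub>R IC_integrand v w y x)"
    using int unfolding set_integrable_def .
  then have h: "integrable lborel h"
  proof (rule Bochner_Integration.integrable_bound)
    show "AE x in lborel. norm (h x) \<le> norm (indicator {0<..} x *\<^sub>R IC_integrand v w y x)"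
    proof (intro AE_I2)
      fix x :: real
      show "norm (h x) \<le> norm (indicator {0<..} x *\<^sub>R IC_integrand v w y x)"
      proof (cases "x \<ge> 1")
        case True
        have "x powr (- 1) \<le> x powr (Re v - 1)" using True v by (intro powr_mono) auto
        moreover have "1 \<le> exp (- Re w * sqrt x)" using w True by (simp add: mult_nonpos_nonneg)
        ultimately have "(1 / x) * 1 * \<bar>cos (x * y)\<bar> \<le> x powr (Re v - 1) * exp (- Re w * sqrt x) * \<bar>cos (x * y)\<bar>"
          using True by (intro mult_mono) (auto simp: powr_minus_divide)
        then show ?thesis using True
          by (simp add: h_def IC_integrand_def norm_mult norm_of_real_powr norm_exp_eq_Re)
      qed (simp add: h_def)
    qed
  qed (simp add: h_def[abs_def])
  have h': "integrable lborel (\<lambda>x. h (d + 1 * x))"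
    by (rule lborel_integrable_real_affine[OF h]) simp
  \<comment> \<open>The translate turns |cos| into |sin|, and |sin| + |cos| \<ge> 1. The larger
    denominator x + d serves both summands.\<close>
  have "integrable lborel (\<lambda>x. indicator {1..} x *\<^sub>R (1 / (x + d)))"
  proof (rule Bochner_Integration.integrable_bound[OF Bochner_Integration.integrable_add[OF h h']])
    show "AE x in lborel. norm (indicator {1..} x *\<^sub>R (1 / (x + d))) \<le> norm (h x + h (d + 1 * x))"
    proof (intro AE_I2)
      fix x :: real
      show "norm (indicator {1..} x *\<^sub>R (1 / (x + d))) \<le> norm (h x + h (d + 1 * x))"
      proof (cases "x \<ge> 1")
        case True
        have "cos ((d + x) * y) = - sin (x * y)"
        proof -
          have "(d + x) * y = pi / 2 + x * y" using y by (simp add: d_def field_simps)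
          then show ?thesis by (simp add: cos_add)
        qed
        then have hd: "h (d + 1 * x) = \<bar>sin (x * y)\<bar> / (x + d)" using True d by (simp add: h_def add.commute)
        have "1 = (sin (x * y))\<^sup>2 + (cos (x * y))\<^sup>2" by simp
        also have "\<dots> \<le> (\<bar>sin (x * y)\<bar> + \<bar>cos (x * y)\<bar>)\<^sup>2"
          by (simp add: power2_sum)
        finally have "1\<^sup>2 \<le> (\<bar>sin (x * y)\<bar> + \<bar>cos (x * y)\<bar>)\<^sup>2" by (simp only: one_power2)
        then have "1 \<le> \<bar>sin (x * y)\<bar> + \<bar>cos (x * y)\<bar>" by (rule power2_le_imp_le) auto
        then have "1 / (x + d) \<le> (\<bar>sin (x * y)\<bar> + \<bar>cos (x * y)\<bar>) / (x + d)"
          using True d by (intro divide_right_mono) auto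
        also have "\<dots> = \<bar>cos (x * y)\<bar> / (x + d) + h (d + 1 * x)" unfolding hd by (simp add: add_divide_distrib)
        also have "\<bar>cos (x * y)\<bar> / (x + d) \<le> h x" using True d by (simp add: h_def divide_left_mono)
        finally show ?thesis using True d by simp
      qed simp
    qed
  qed measurable
  then have "set_integrable lborel {1..} (\<lambda>x. 1 / (x + d))" unfolding set_integrable_def .
  then show False using not_set_integrable_inverse[of d] d by simp
qed

section \<open>The G-functions in terms of the cosine integrals\<close>

context
  fixes v w :: complex and y :: real
  assumes v: "Re v > 0" and w: "Re w > 0" and y: "y > 0" and int: "set_integrable lborel {0<..} (IC_integrand v w y)"
begin

lemma meijerG_log_4_eq_IC_integral:
  "meijerG_log [(4 - 2 * v) / 4, (3 - 2 * v) / 4, (2 - 2 * v) / 4, (1 - 2 * v) / 4] [] [0] [1 / 2] (log_quot_power (64 * y ^ 2) w 4) =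
     of_real pi * exp ((3/2 - 4 * v) * of_real (ln 2)) * exp (2 * v * Ln w) * (LBINT x:{0<..}. IC_integrand v w y x)"
proof -
  \<comment> \<open>Any c in (0, min 1 (Re v)) would serve; then - c / 2 also lies in the strip (-
    Re v / 2, 0) of the G-function.\<close>
  define c where "c = min 1 (Re v) / 2"
  have c: "0 < c" "c < 1" "c < Re v" using v by (auto simp: c_def)
  define X where "X = (LBINT t. cos_Laplace_kernel v y w (Complex (- c / 2) t))"
  have "exp ((5/2 - 4 * v) * of_real (ln 2)) = 2 * exp ((3/2 - 4 * v) * of_real (ln 2))"
  proof -
    have "(5/2 - 4 * v) * of_real (ln 2) = of_real (ln 2) + (3/2 - 4 * v) * of_real (ln 2)" by (simp add: algebra_simps)
    then show ?thesis by (simp only: exp_add exp_of_real) simp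
  qed
  then show ?thesis
    using c meijerG_log_4_eq[OF v w y, of "- c / 2"] IC_integral_eq_kernel[OF w c y int]
    by (simp add: X_def [symmetric])
qed

text \<open>The translation factor exp (d * l4) equals 2^(6 d) y^(2 d) w^(- 4 d). Its w-part turns
  the exponent 2 v into 2 v - 4 d, and the rest goes into the prefactor.\<close>

lemma meijerG_log_4_shift_eq_IC_integral:
  "meijerG_log (map (\<lambda>a. a + of_real d) [(4 - 2 * v) / 4, (3 - 2 * v) / 4, (2 - 2 * v) / 4, (1 - 2 * v) / 4]) []
      [of_real d] [1 / 2 + of_real d] (log_quot_power (64 * y ^ 2) w 4) / w powr (2 * v - 4 * of_real d) =
    of_real pi * exp ((3/2 - 4 * v) * of_real (ln 2)) * exp (of_real (d * (6 * ln 2 + 2 * ln y))) * (LBINT x:{0<..}. IC_integrand v w y x)"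
proof -
  have w0: "w \<noteq> 0" using w by auto
  have "exp (of_real d * log_quot_power (64 * y ^ 2) w 4) * exp (2 * v * Ln w) =
      exp (of_real (d * (6 * ln 2 + 2 * ln y))) * w powr (2 * v - 4 * of_real d)"
    unfolding l4[OF v w y] using w0 by (simp add: powr_def algebra_simps flip: exp_add)
  then show ?thesis
    unfolding meijerG_log_4_shift[OF v w y] meijerG_log_4_eq_IC_integral using w0 by (simp add: field_simps)
qed

lemma meijerG_log_8_eq_IC_integral:
  "meijerG_log [(8 - 2 * v) / 8, (7 - 2 * v) / 8, (6 - 2 * v) / 8, (5 - 2 * v) / 8,
          (4 - 2 * v) / 8, (3 - 2 * v) / 8, (2 - 2 * v) / 8, (1 - 2 * v) / 8] [] [0, 1 / 2] [1 / 4, 3 / 4]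
      (log_quot_power (4 ^ 8 * y ^ 4) w 8) / w powr (2 * v) =
    of_real (pi ^ 3) * exp ((7/2 - 6 * v) * of_real (ln 2)) * (LBINT x:{0<..}. IC_integrand v w y x)"
proof -
  have w0: "w \<noteq> 0" using w by auto
  have e: "exp ((7/2 - 6 * v) * of_real (ln 2)) = exp ((2 - 2 * v) * of_real (ln 2)) * exp ((3/2 - 4 * v) * of_real (ln 2))"
    unfolding exp_add [symmetric] by (simp add: algebra_simps)
  show ?thesis
    unfolding meijerG_log_8[OF v w y] meijerG_log_4_eq_IC_integral e using w0
    by (simp add: powr_def power3_eq_cube power2_eq_square)
qed

end

text \<open>As Re (w k) increases with k, the integrand for k = 0 dominates all the others, which
  bounds the integrals uniformly.\<close>

lemma norm_IC_integrand_mono: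
  assumes "Re w \<le> Re w'" "x > 0"
  shows "norm (IC_integrand v w' y x) \<le> norm (IC_integrand v w y x)"
proof -
  have "exp (- Re w' * sqrt x) \<le> exp (- Re w * sqrt x)" using assms by (simp add: mult_right_mono)
  then show ?thesis
    by (simp add: IC_integrand_def norm_mult norm_exp_eq_Re mult_left_mono mult_right_mono)
qed

text \<open>Each of the five series is a constant multiple of the series of \<open>IC_term\<close>,
  term by term; C * c = 1 expresses that the displayed prefactor undoes this constant.\<close>

lemma summable_eq_suminf_cmult:
  fixes t :: "nat \<Rightarrow> complex"
  assumes "summable t" "\<And>k. g k = c * t k" "C * c = 1"
  shows "summable g \<and> suminf t = C * (\<Sum>k. g k)"
proof -
  have "g = (\<lambda>k. c * t k)" using assms(2) by auto
  moreover have "(\<Sum>k. c * t k) = c * suminf t" using assms(1) by (rule suminf_mult)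
  ultimately show ?thesis using assms by (simp add: summable_mult flip: mult.assoc)
qed

text \<open>Summability accompanies each equality, because \<open>suminf\<close> by itself assigns a
  value even to a divergent series.\<close>

theorem theorem1:
  fixes \<Theta> :: "nat \<Rightarrow> complex" and \<upsilon> b c lam :: complex and y :: real
  assumes "bounded (range \<Theta>)"
    and "Re \<upsilon> > 0" and "Re c > 0" and "y > 0"
    and "(Re lam > 0 \<and> Re b > 0) \<or> (Re lam < 0 \<and> Re b < 0)"
    and integrals_exist:
      "\<And>k. set_integrable lborel {0<..} (IC_integrand \<upsilon> (wC lam b c k) y)"
  defines "w \<equiv> wC lam b c"
  defines "G1 \<equiv> \<lambda>k. \<Theta> k / (fact k * w k powr (2 * \<upsilon>)) *
      meijerG_log [(4 - 2 * \<upsilon>) / 4, (3 - 2 * \<upsilon>) / 4, (2 - 2 * \<upsilon>) / 4, (1 - 2 * \<upsilon>) / 4] []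
        [0] [1 / 2] (log_quot_power (64 * y ^ 2) (w k) 4)"
  defines "G2 \<equiv> \<lambda>k. \<Theta> k / (fact k * w k powr (2 * \<upsilon> + 1)) *
      meijerG_log [(3 - 2 * \<upsilon>) / 4, (2 - 2 * \<upsilon>) / 4, (1 - 2 * \<upsilon>) / 4, (- 2 * \<upsilon>) / 4] []
        [- 1 / 4] [1 / 4] (log_quot_power (64 * y ^ 2) (w k) 4)"
  defines "G3 \<equiv> \<lambda>k. \<Theta> k / (fact k * w k powr (2 * \<upsilon> - 2)) *
      meijerG_log [(6 - 2 * \<upsilon>) / 4, (5 - 2 * \<upsilon>) / 4, (4 - 2 * \<upsilon>) / 4, (3 - 2 * \<upsilon>) / 4] []
        [1 / 2] [1] (log_quot_power (64 * y ^ 2) (w k) 4)"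
  defines "G4 \<equiv> \<lambda>k. \<Theta> k / (fact k * w k powr (2 * \<upsilon> + 2)) *
      meijerG_log [(2 - 2 * \<upsilon>) / 4, (1 - 2 * \<upsilon>) / 4, (- 2 * \<upsilon>) / 4, (- 1 - 2 * \<upsilon>) / 4] []
        [- 1 / 2] [0] (log_quot_power (64 * y ^ 2) (w k) 4)"
  defines "G5 \<equiv> \<lambda>k. \<Theta> k / (fact k * w k powr (2 * \<upsilon>)) *
      meijerG_log [(8 - 2 * \<upsilon>) / 8, (7 - 2 * \<upsilon>) / 8, (6 - 2 * \<upsilon>) / 8, (5 - 2 * \<upsilon>) / 8,
          (4 - 2 * \<upsilon>) / 8, (3 - 2 * \<upsilon>) / 8, (2 - 2 * \<upsilon>) / 8, (1 - 2 * \<upsilon>) / 8] []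
        [0, 1 / 2] [1 / 4, 3 / 4] (log_quot_power (4 ^ 8 * y ^ 4) (w k) 8)"
  shows "summable (IC_term \<Theta> \<upsilon> b c lam y) \<and>
    summable G1 \<and> IC_star \<Theta> \<upsilon> b c lam y =
      2 powr (4 * \<upsilon> - 3 / 2) / of_real pi * (\<Sum>k. G1 k) \<and>
    summable G2 \<and> IC_star \<Theta> \<upsilon> b c lam y =
      of_real (sqrt y) * 2 powr (4 * \<upsilon>) / of_real pi * (\<Sum>k. G2 k) \<and>
    summable G3 \<and> IC_star \<Theta> \<upsilon> b c lam y =
      2 powr (4 * \<upsilon> - 9 / 2) / (of_real pi * of_real y) * (\<Sum>k. G3 k) \<and>
    summable G4 \<and> IC_star \<Theta> \<upsilon> b c lam y =
      of_real y * 2 powr (4 * \<upsilon> + 3 / 2) / of_real pi * (\<Sum>k. G4 k) \<and>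
    summable G5 \<and> IC_star \<Theta> \<upsilon> b c lam y =
      2 powr (6 * \<upsilon> - 7 / 2) / of_real (pi ^ 3) * (\<Sum>k. G5 k)"
proof -
  define t where "t = IC_term \<Theta> \<upsilon> b c lam y"
  define I where "I k = (LBINT x:{0<..}. IC_integrand \<upsilon> (w k) y x)" for k
  have int: "set_integrable lborel {0<..} (IC_integrand \<upsilon> (w k) y)" for k
    using integrals_exist unfolding w_def .
  have w0: "Re (w 0) > 0" using Re_pos_of_integrable[OF assms(2,4) int] .
  have Re_w_le: "Re (w 0) \<le> Re (w k)" for k
    using \<open>Re c > 0\<close> by (simp add: w_def wC_def)
  have w: "Re (w k) > 0" for k using w0 Re_w_le[of k] by linarith
  have t_eq: "t k = \<Theta> k / fact k * I k" for k by (simp add: t_def IC_term_def I_def w_def)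
  obtain B where B: "\<And>k. norm (\<Theta> k) \<le> B" using \<open>bounded (range \<Theta>)\<close> by (auto simp: bounded_iff)
  have B0: "B \<ge> 0" using B[of 0] norm_ge_zero order_trans by blast
  \<comment> \<open>A bound for all integrals at once; with \<Theta> bounded, the series is compared
    with a multiple of the series of 1 / k!.\<close>
  define J where "J = (LBINT x. norm (indicator {0<..} x *\<^sub>R IC_integrand \<upsilon> (w 0) y x))"
  have I_le: "norm (I k) \<le> J" for k
    unfolding I_def J_def set_lebesgue_integral_def
    using int[of k] int[of 0] norm_IC_integrand_mono[OF Re_w_le[of k]] unfolding set_integrable_def
    by (intro Bochner_Integration.integral_norm_bound_integral integrable_norm) (auto simp: indicator_def)
  have "summable t"
  proof (rule summable_comparison_test)
    show "\<exists>N. \<forall>n\<ge>N. norm (t n) \<le> B * J * (inverse (fact n))"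
    proof (intro exI allI impI)
      fix n
      have "norm (\<Theta> n) * norm (I n) \<le> B * J" using B I_le B0 by (intro mult_mono) auto
      then show "norm (t n) \<le> B * J * inverse (fact n)"
        by (simp add: t_eq norm_mult norm_divide divide_inverse[symmetric] divide_right_mono)
    qed
    show "summable (\<lambda>n. B * J * inverse (fact n))"
      using summable_exp[of "1::real"] by (intro summable_mult) simp
  qed
  note fact = summable_eq_suminf_cmult[OF this]
  have two_powr: "(2::complex) powr z = exp (z * of_real (ln 2))" for z
    using of_real_powr_eq_exp[of 2 z] by simp
  have y: "complex_of_real y = exp (of_real (ln y))" "complex_of_real (sqrt y) = exp (of_real (ln y / 2))"
  proof -
    have "y = exp (ln y)" "sqrt y = exp (ln y / 2)"
      using \<open>y > 0\<close> by (simp_all add: powr_half_sqrt [symmetric] powr_def)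
    then show "complex_of_real y = exp (of_real (ln y))" "complex_of_real (sqrt y) = exp (of_real (ln y / 2))"
      unfolding exp_of_real by simp_all
  qed
  define C where "C d = of_real pi * exp ((3/2 - 4 * \<upsilon>) * of_real (ln 2)) * exp (of_real (d * (6 * ln 2 + 2 * ln y)))" for d
  have shift: "\<Theta> k / (fact k * w k powr (2 * \<upsilon> - 4 * of_real d)) *
      meijerG_log (map (\<lambda>a. a + of_real d) [(4 - 2 * \<upsilon>) / 4, (3 - 2 * \<upsilon>) / 4, (2 - 2 * \<upsilon>) / 4, (1 - 2 * \<upsilon>) / 4]) []
        [of_real d] [1 / 2 + of_real d] (log_quot_power (64 * y ^ 2) (w k) 4) = C d * t k" for d k
  proof -
    have e: "\<Theta> k / (fact k * w k powr (2 * \<upsilon> - 4 * of_real d)) * m = \<Theta> k / fact k * (m / w k powr (2 * \<upsilon> - 4 * of_real d))" for m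
      by simp
    show ?thesis
      unfolding e meijerG_log_4_shift_eq_IC_integral[OF assms(2) w assms(4) int] t_eq C_def I_def by simp
  qed
  \<comment> \<open>The translations d = 0, -1/4, 1/2, -1/2 give the exponents 2 \<upsilon>, 2
    \<upsilon> + 1, 2 \<upsilon> - 2, 2 \<upsilon> + 2 of w k; the factor 2^(6 d) y^(2 d) in
    \<open>C d\<close> accounts for the differing powers of 2 and y.\<close>
  have G1: "G1 k = C 0 * t k" for k
    using shift[of k 0] by (simp add: G1_def)
  have G2: "G2 k = C (- 1 / 4) * t k" for k
    using shift[of k "- 1 / 4"] by (simp add: G2_def add_divide_distrib diff_divide_distrib)
  have G3: "G3 k = C (1 / 2) * t k" for k
    using shift[of k "1 / 2"] by (simp add: G3_def add_divide_distrib diff_divide_distrib)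
  have G4: "G4 k = C (- 1 / 2) * t k" for k
    using shift[of k "- 1 / 2"] by (simp add: G4_def add_divide_distrib diff_divide_distrib)
  have G5: "G5 k = of_real (pi ^ 3) * exp ((7/2 - 6 * \<upsilon>) * of_real (ln 2)) * t k" for k
  proof -
    have e: "\<Theta> k / (fact k * w k powr (2 * \<upsilon>)) * m = \<Theta> k / fact k * (m / w k powr (2 * \<upsilon>))" for m by simp
    show ?thesis
      unfolding G5_def e meijerG_log_8_eq_IC_integral[OF assms(2) w assms(4) int] t_eq I_def by simp
  qed
  \<comment> \<open>Writing 2 and y as exponentials leaves a linear identity in ln 2 and ln y to
    check for each prefactor.\<close>
  have C: "exp a / of_real pi * C d = 1" if "a + (3/2 - 4 * \<upsilon>) * of_real (ln 2) + of_real (d * (6 * ln 2 + 2 * ln y)) = 0" for a d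
    using that by (simp add: C_def flip: exp_add) (simp add: add.assoc)
  have "2 powr (4 * \<upsilon> - 3 / 2) / of_real pi * C 0 = 1"
    unfolding two_powr by (rule C) (simp add: algebra_simps)
  note 1 = fact[OF G1 this]
  have "of_real (sqrt y) * 2 powr (4 * \<upsilon>) / of_real pi * C (- 1 / 4) = 1"
    unfolding two_powr y exp_add [symmetric] by (rule C) (simp add: field_simps)
  note 2 = fact[OF G2 this]
  have "2 powr (4 * \<upsilon> - 9 / 2) / (of_real pi * of_real y) * C (1 / 2) = 1"
  proof -
    have "2 powr (4 * \<upsilon> - 9 / 2) / (of_real pi * of_real y) = exp ((4 * \<upsilon> - 9 / 2) * of_real (ln 2) - of_real (ln y)) / of_real pi"
      unfolding two_powr y exp_diff by simp
    also have "\<dots> * C (1 / 2) = 1" by (rule C) (simp add: field_simps)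
    finally show ?thesis .
  qed
  note 3 = fact[OF G3 this]
  have "of_real y * 2 powr (4 * \<upsilon> + 3 / 2) / of_real pi * C (- 1 / 2) = 1"
    unfolding two_powr y exp_add [symmetric] by (rule C) (simp add: field_simps)
  note 4 = fact[OF G4 this]
  have "2 powr (6 * \<upsilon> - 7 / 2) / of_real (pi ^ 3) * (of_real (pi ^ 3) * exp ((7/2 - 6 * \<upsilon>) * of_real (ln 2))) = 1"
    unfolding two_powr by (simp add: algebra_simps flip: exp_add)
  note 5 = fact[OF G5 this]
  show ?thesis
    using \<open>summable t\<close> 1 2 3 4 5 unfolding IC_star_def t_def by blast
qed

end
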